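(* Let $p>1$ be an integer, $\beta>0$, and let $Q$ be a $p\times p$ symmetric positive definite matrix. In the multivariate Gaussian sequence model with noise level $\varepsilon$, the linear estimator $\hat{\theta}_{\mathrm{P}}=(\hat{\theta}_{\mathrm{P},i})_{i\ge1}$ given by $$\hat{\theta}_{\mathrm{P},i}=C_{\mathrm{P},i}\,y_i,\qquad C_{\mathrm{P},i}=(I_p-a_{\beta,i}\,\kappa\, Q^{-1})_+,$$ where $\kappa=\kappa(\varepsilon)>0$ is the unique solution of $\varepsilon^2\kappa^{-1}\sum_{i=1}^{\infty}a_{\beta,i}\,\mathrm{tr}\left((I_p-a_{\beta,i}\kappa Q^{-1})_+\right)=1$, is asymptotically minimax under $L_Q$ on the multivariate Sobolev ellipsoid $\Theta(\beta,Q)$: $$\sup_{\theta\in\Theta(\beta,Q)}R_Q(\theta,\hat{\theta}_{\mathrm{P}})\sim\inf_{\hat{\theta}}\sup_{\theta\in\Theta(\beta,Q)}R_Q(\theta,\hat{\theta})\sim P(\beta,Q)\,\varepsilon^{4\beta/(2\beta+1)}$$ as $\varepsilon\to0$, where the infimum is taken over all estimators and $$P(\beta,Q)=(2\beta+1)^{1/(2\beta+1)}\left(\frac{\beta\,\mathrm{tr}(Q^{(\beta+1)/\beta})}{\beta+1}\right)^{2\beta/(2\beta+1)}.$$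
   Context: Multivariate Gaussian sequence model: one observes $y=(y_i)_{i\ge1}$ with $y_i=\theta_i+\varepsilon\xi_i\in\mathbb{R}^p$, $i=1,2,\dots$, where $\varepsilon>0$, $\theta=(\theta_i)_{i\ge1}$ is an unknown sequence in $\mathbb{R}^p$, and $\xi_i\sim\mathrm{N}_p(0,I_p)$ are independent. An estimator $\hat\theta=(\hat\theta_i)_{i\ge 1}$ is a function of $y$. Loss and risk: $L_Q(\theta,\hat\theta)=\sum_{i=1}^\infty(\hat\theta_i-\theta_i)^{\top}Q(\hat\theta_i-\theta_i)$ and $R_Q(\theta,\hat\theta)=\mathrm{E}_\theta[L_Q(\theta,\hat\theta)]$. Coefficients: $a_{\beta,i}=i^\beta$ for $i$ even and $a_{\beta,i}=(i-1)^\beta$ for $i$ odd. Multivariate Sobolev ellipsoid: for a $p\times p$ positive definite $R$, $\Theta(\beta,R)=\{\theta=(\theta_1,\theta_2,\dots)\mid\sum_{i=1}^\infty a_{\beta,i}^2\,\theta_i^{\top}R^{-1}\theta_i\le1\}$. For a symmetric matrix $S=U^{\top}\Lambda U$ with $U$ orthogonal and $\Lambda=\mathrm{diag}(\lambda_1,\dots,\lambda_p)$, $S_+=U^{\top}\mathrm{diag}(\max(0,\lambda_1),\dots,\max(0,\lambda_p))U$ is its projection onto the positive semidefinite cone. Real powers of $Q$ are defined by the spectral calculus. $a\sim b$ means $a/b\to1$. *)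

theory Defs
  imports "HOL-Probability.Probability" "HOL-Library.Landau_Symbols"
begin

definition pos_def :: "real^'n^'n \<Rightarrow> bool" where
  "pos_def A \<longleftrightarrow> transpose A = A \<and> (\<forall>x. x \<noteq> 0 \<longrightarrow> x \<bullet> (A *v x) > 0)"

definition diag_mat :: "real^'n \<Rightarrow> real^'n^'n" where
  "diag_mat l = (\<chi> i j. if i = j then l $ i else 0)"

definition spectral_map :: "(real \<Rightarrow> real) \<Rightarrow> real^'n^'n \<Rightarrow> real^'n^'n" where
  "spectral_map f S = (THE T. \<exists>U l. orthogonal_matrix U \<and> S = transpose U ** diag_mat l ** U \<and>
      T = transpose U ** diag_mat (\<chi> i. f (l $ i)) ** U)"

definition psd_part :: "real^'n^'n \<Rightarrow> real^'n^'n" where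
  "psd_part S = spectral_map (\<lambda>x. max 0 x) S"

definition mat_powr :: "real^'n^'n \<Rightarrow> real \<Rightarrow> real^'n^'n" where
  "mat_powr S r = spectral_map (\<lambda>x. x powr r) S"

lemma matrix_mult_diag_mat_nth: "(A ** diag_mat l) $ i $ j = A $ i $ j * l $ j"
  by (simp add: matrix_matrix_mult_def diag_mat_def if_distrib cong: if_cong)

lemma diag_mat_matrix_mult_nth: "(diag_mat l ** A) $ i $ j = l $ i * A $ i $ j"
  by (simp add: matrix_matrix_mult_def diag_mat_def if_distrib [where f = "\<lambda>x. x * _"] cong: if_cong)

lemma spectral_map_unique:
  fixes U V :: "real^'n^'n"
  assumes U: "orthogonal_matrix U" and V: "orthogonal_matrix V"
    and eq: "transpose U ** diag_mat l ** U = transpose V ** diag_mat m ** V"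
  shows "transpose U ** diag_mat (\<chi> i. f (l $ i)) ** U
       = transpose V ** diag_mat (\<chi> i. f (m $ i)) ** V"
proof -
  have u: "U ** transpose U = mat 1" "transpose U ** U = mat 1"
    and v: "V ** transpose V = mat 1" "transpose V ** V = mat 1"
    using U V by (auto simp: orthogonal_matrix_def)
  define W where "W = V ** transpose U"
  have "W ** diag_mat l = V ** (transpose U ** diag_mat l ** U) ** transpose U"
    by (metis W_def matrix_mul_assoc matrix_mul_rid u(1))
  also have "\<dots> = diag_mat m ** W"
    unfolding eq by (metis W_def matrix_mul_assoc matrix_mul_lid v(1))
  finally have W: "W ** diag_mat l = diag_mat m ** W" .
  have "W $ i $ j * l $ j = m $ i * W $ i $ j" for i j
    using W by (metis matrix_mult_diag_mat_nth diag_mat_matrix_mult_nth)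
  then have "W $ i $ j * f (l $ j) = f (m $ i) * W $ i $ j" for i j
    by (metis mult.commute mult_cancel_left mult_zero_left)
  then have Wf: "W ** diag_mat (\<chi> i. f (l $ i)) = diag_mat (\<chi> i. f (m $ i)) ** W"
    by (simp add: vec_eq_iff matrix_mult_diag_mat_nth diag_mat_matrix_mult_nth)
  have "transpose U ** diag_mat (\<chi> i. f (l $ i)) ** U
      = transpose V ** (W ** diag_mat (\<chi> i. f (l $ i))) ** U"
    by (metis W_def matrix_mul_assoc matrix_mul_lid v(2))
  also have "\<dots> = transpose V ** diag_mat (\<chi> i. f (m $ i)) ** V"
    unfolding Wf by (metis W_def matrix_mul_assoc matrix_mul_rid u(2))
  finally show ?thesis .
qed

lemma spectral_map_eq:
  assumes "orthogonal_matrix U" and "S = transpose U ** diag_mat l ** U"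
  shows "spectral_map f S = transpose U ** diag_mat (\<chi> i. f (l $ i)) ** U"
  unfolding spectral_map_def
proof (rule the_equality)
  show "\<exists>V m. orthogonal_matrix V \<and> S = transpose V ** diag_mat m ** V \<and>
      transpose U ** diag_mat (\<chi> i. f (l $ i)) ** U
      = transpose V ** diag_mat (\<chi> i. f (m $ i)) ** V"
    using assms by blast
next
  fix T
  assume "\<exists>V m. orthogonal_matrix V \<and> S = transpose V ** diag_mat m ** V \<and>
      T = transpose V ** diag_mat (\<chi> i. f (m $ i)) ** V"
  then show "T = transpose U ** diag_mat (\<chi> i. f (l $ i)) ** U"
    using assms spectral_map_unique by metis
qed

text \<open>
  Sequences are functions on \<^typ>\<open>nat\<close> of which only the indices \<open>i \<ge> 1\<close> are used; a series over
  \<open>i \<ge> 1\<close> is written as a series over \<open>i \<ge> 0\<close> with \<open>Suc i\<close> in place of \<open>i\<close>.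
\<close>

definition mvn_std_density :: "real^'p \<Rightarrow> real" where
  "mvn_std_density x = (2 * pi) powr (- real CARD('p) / 2) * exp (- (x \<bullet> x) / 2)"

definition standard_gaussian_noise :: "'a measure \<Rightarrow> (nat \<Rightarrow> 'a \<Rightarrow> real^'p) \<Rightarrow> bool" where
  "standard_gaussian_noise M \<xi> \<longleftrightarrow> prob_space M \<and>
     prob_space.indep_vars M (\<lambda>_. borel) \<xi> {1..} \<and>
     (\<forall>i\<ge>1. distributed M lborel (\<xi> i) (\<lambda>x. ennreal (mvn_std_density x)))"

definition observation ::
  "(nat \<Rightarrow> 'a \<Rightarrow> real^'p) \<Rightarrow> real \<Rightarrow> (nat \<Rightarrow> real^'p) \<Rightarrow> 'a \<Rightarrow> nat \<Rightarrow> real^'p" where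
  "observation \<xi> \<epsilon> \<theta> \<omega> = (\<lambda>i\<in>{1..}. \<theta> i + \<epsilon> *\<^sub>R \<xi> i \<omega>)"

definition estimators :: "((nat \<Rightarrow> real^'p) \<Rightarrow> (nat \<Rightarrow> real^'p)) set" where
  "estimators = measurable (Pi\<^sub>M {1..} (\<lambda>_. borel)) (Pi\<^sub>M {1..} (\<lambda>_. borel))"

text \<open>
  Loss and risk may be infinite, hence \<^typ>\<open>ennreal\<close>; the summands of the loss are nonnegative
  for positive definite \<open>Q\<close>.
\<close>

definition loss :: "real^'p^'p \<Rightarrow> (nat \<Rightarrow> real^'p) \<Rightarrow> (nat \<Rightarrow> real^'p) \<Rightarrow> ennreal" where
  "loss Q \<theta> t = (\<Sum>i. ennreal ((t (Suc i) - \<theta> (Suc i)) \<bullet> (Q *v (t (Suc i) - \<theta> (Suc i)))))"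

definition risk :: "'a measure \<Rightarrow> (nat \<Rightarrow> 'a \<Rightarrow> real^'p) \<Rightarrow> real \<Rightarrow> real^'p^'p \<Rightarrow>
    (nat \<Rightarrow> real^'p) \<Rightarrow> ((nat \<Rightarrow> real^'p) \<Rightarrow> (nat \<Rightarrow> real^'p)) \<Rightarrow> ennreal" where
  "risk M \<xi> \<epsilon> Q \<theta> t = (\<integral>\<^sup>+\<omega>. loss Q \<theta> (t (observation \<xi> \<epsilon> \<theta> \<omega>)) \<partial>M)"

definition sob_coeff :: "real \<Rightarrow> nat \<Rightarrow> real" where
  "sob_coeff \<beta> i = (if even i then real i powr \<beta> else (real i - 1) powr \<beta>)"

definition sob_ellipsoid :: "real \<Rightarrow> real^'p^'p \<Rightarrow> (nat \<Rightarrow> real^'p) set" where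
  "sob_ellipsoid \<beta> R =
     {\<theta>. summable (\<lambda>i. (sob_coeff \<beta> (Suc i))\<^sup>2 * (\<theta> (Suc i) \<bullet> (matrix_inv R *v \<theta> (Suc i)))) \<and>
         (\<Sum>i. (sob_coeff \<beta> (Suc i))\<^sup>2 * (\<theta> (Suc i) \<bullet> (matrix_inv R *v \<theta> (Suc i)))) \<le> 1}"

definition minimax_risk ::
  "'a measure \<Rightarrow> (nat \<Rightarrow> 'a \<Rightarrow> real^'p) \<Rightarrow> real \<Rightarrow> real^'p^'p \<Rightarrow> (nat \<Rightarrow> real^'p) set \<Rightarrow> ennreal" where
  "minimax_risk M \<xi> \<epsilon> Q \<Theta> = (INF t\<in>estimators. SUP \<theta>\<in>\<Theta>. risk M \<xi> \<epsilon> Q \<theta> t)"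

definition pinsker_weight :: "real \<Rightarrow> real^'p^'p \<Rightarrow> real \<Rightarrow> nat \<Rightarrow> real^'p^'p" where
  "pinsker_weight \<beta> Q \<kappa> i = psd_part (mat 1 - (sob_coeff \<beta> i * \<kappa>) *\<^sub>R matrix_inv Q)"

definition pinsker_eq :: "real \<Rightarrow> real^'p^'p \<Rightarrow> real \<Rightarrow> real \<Rightarrow> bool" where
  "pinsker_eq \<beta> Q \<epsilon> \<kappa> \<longleftrightarrow>
     summable (\<lambda>i. sob_coeff \<beta> (Suc i) * trace (pinsker_weight \<beta> Q \<kappa> (Suc i))) \<and>
     \<epsilon>\<^sup>2 * inverse \<kappa> * (\<Sum>i. sob_coeff \<beta> (Suc i) * trace (pinsker_weight \<beta> Q \<kappa> (Suc i))) = 1"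

definition pinsker_kappa :: "real \<Rightarrow> real^'p^'p \<Rightarrow> real \<Rightarrow> real" where
  "pinsker_kappa \<beta> Q \<epsilon> = (THE \<kappa>. \<kappa> > 0 \<and> pinsker_eq \<beta> Q \<epsilon> \<kappa>)"

definition pinsker_estimator ::
  "real \<Rightarrow> real^'p^'p \<Rightarrow> real \<Rightarrow> (nat \<Rightarrow> real^'p) \<Rightarrow> nat \<Rightarrow> real^'p" where
  "pinsker_estimator \<beta> Q \<epsilon> y =
     (\<lambda>i\<in>{1..}. pinsker_weight \<beta> Q (pinsker_kappa \<beta> Q \<epsilon>) i *v y i)"

definition pinsker_const :: "real \<Rightarrow> real^'p^'p \<Rightarrow> real" where
  "pinsker_const \<beta> Q = (2 * \<beta> + 1) powr (1 / (2 * \<beta> + 1)) *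
     (\<beta> * trace (mat_powr Q ((\<beta> + 1) / \<beta>)) / (\<beta> + 1)) powr (2 * \<beta> / (2 * \<beta> + 1))"

end

theory Submission
  imports Defs "HOL-Real_Asymp.Real_Asymp"
begin

text \<open>
  Write \<open>Q = U\<^sup>T diag(l) U\<close> and pass to the coordinates \<open>w\<^sub>i\<^sub>j = u\<^sub>j \<bullet> \<theta>\<^sub>i\<close>, where \<open>u\<^sub>j\<close> is the \<open>j\<close>-th
  row of \<open>U\<close>. The noise stays standard Gaussian with independent coordinates, the loss becomes
  \<open>\<Sum> l\<^sub>j (t\<^sub>i\<^sub>j - w\<^sub>i\<^sub>j)\<^sup>2\<close>, the ellipsoid becomes \<open>\<Sum> (a\<^sub>i\<^sup>2 / l\<^sub>j) w\<^sub>i\<^sub>j\<^sup>2 \<le> 1\<close>, and the Pinsker weight acts on the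
  \<open>j\<close>-th coordinate as multiplication by \<open>c\<^sub>i\<^sub>j = max(0, 1 - a\<^sub>i \<kappa> / l\<^sub>j)\<close>. What remains is a scalar
  Pinsker problem indexed by pairs. Let \<open>r(\<epsilon>) = \<epsilon>\<^sup>2 \<Sum> l\<^sub>j c\<^sub>i\<^sub>j\<close>, with \<open>\<kappa> = \<kappa>(\<epsilon>)\<close>; both risks are
  compared with \<open>r(\<epsilon>)\<close>.

  Upper bound (\<open>pinsker_risk_le\<close>). The variance part of the risk is \<open>\<epsilon>\<^sup>2 \<Sum> l\<^sub>j c\<^sub>i\<^sub>j\<^sup>2\<close>, and since
  \<open>1 - c\<^sub>i\<^sub>j \<le> a\<^sub>i \<kappa> / l\<^sub>j\<close> the bias part is at most \<open>\<kappa>\<^sup>2\<close> on the ellipsoid. The equation that defines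
  \<open>\<kappa>\<close> says exactly that these two bounds add up to \<open>r(\<epsilon>)\<close>.

  Lower bound (\<open>pinsker_lower_bound\<close>). The minimax risk dominates the Bayes risk of every prior
  restricted to the ellipsoid. Take independent centred Gaussians on the finitely many coordinates
  with \<open>a\<^sub>i > 0\<close> and \<open>c\<^sub>i\<^sub>j > 0\<close>, with variances \<open>(1 - \<delta>) \<epsilon>\<^sup>2 c\<^sub>i\<^sub>j / (1 - c\<^sub>i\<^sub>j)\<close>. For \<open>\<delta> = 0\<close> the Bayes risk of a
  coordinate would be \<open>\<epsilon>\<^sup>2 c\<^sub>i\<^sub>j\<close>, and the mean of the quadratic form of the ellipsoid would be \<open>1\<close>; the
  factor \<open>1 - \<delta>\<close> leaves room for the prior to concentrate on the ellipsoid
  (\<open>gaussian_quadratic_form_tail\<close>). Restricting the prior costs only a factor close to \<open>1\<close> in each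
  coordinate separately: given everything except \<open>\<theta>\<^sub>i\<^sub>j\<close> and its own noise, the posterior of
  \<open>\<theta>\<^sub>i\<^sub>j\<close> is Gaussian, and deleting an event of small probability cannot reduce its mean squared error
  by much, because the fourth moment of a Gaussian is controlled by the square of the second
  (\<open>truncated_gaussian_bayes_risk\<close>). The error is relative to the Bayes risk of that coordinate,
  uniformly in the value of the estimator, so a probability that merely tends to zero is enough. One
  coordinate of the noise is isolated by resampling it (\<open>mvn_std_resample_direction\<close>).

  Rates (\<open>pinsker_rates\<close>). The sums over \<open>i\<close> are finite sums of powers of even integers, so they
  are asymptotic to powers of \<open>\<kappa>\<close>; eliminating \<open>\<kappa>\<close> through its defining equation turns \<open>r(\<epsilon>)\<close> into
  the stated constant times \<open>\<epsilon> powr (4 * \<beta> / (2 * \<beta> + 1))\<close>.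
\<close>

section \<open>Diagonalization of symmetric matrices\<close>

lemma matrix_symmetric_inner:
  fixes A :: "real^'n^'n"
  assumes "transpose A = A"
  shows "x \<bullet> (A *v y) = (A *v x) \<bullet> y"
  by (metis assms dot_lmul_matrix transpose_matrix_vector)

text \<open>
  The quadratic form of \<open>A\<close> attains its maximum over the unit sphere of the subspace. At a maximizer
  \<open>x\<close> the first variation vanishes in all directions orthogonal to \<open>x\<close>, in particular in the
  direction of the residual \<open>A x - \<mu> x\<close>, which forces this residual to be zero.
\<close>
lemma symmetric_eigenvector_in_invariant_subspace:
  fixes A :: "real^'n^'n"
  assumes sym: "transpose A = A" and S: "subspace S" and inv: "\<And>x. x \<in> S \<Longrightarrow> A *v x \<in> S"
    and nz: "S \<noteq> {0}"
  obtains x \<mu> where "x \<in> S" "norm x = 1" "A *v x = \<mu> *\<^sub>R x"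
proof -
  let ?q = "\<lambda>x. x \<bullet> (A *v x)"
  have "compact (sphere 0 1 \<inter> S)"
    by (intro compact_Int_closed closed_subspace S) simp
  moreover from nz S obtain y where y: "y \<in> S" "y \<noteq> 0" by (auto dest: subspace_0)
  then have "(1 / norm y) *\<^sub>R y \<in> sphere 0 1 \<inter> S"
    using S by (auto simp: subspace_scale)
  then have "sphere 0 1 \<inter> S \<noteq> {}" by blast
  moreover have "continuous_on (sphere 0 1 \<inter> S) ?q"
    by (intro continuous_intros linear_continuous_on) (simp add: linear_linear)
  ultimately obtain x where x: "x \<in> sphere 0 1 \<inter> S"
    and max: "\<And>z. z \<in> sphere 0 1 \<inter> S \<Longrightarrow> ?q z \<le> ?q x"
    using continuous_attains_sup[of "sphere 0 1 \<inter> S" ?q] by metis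
  have nx: "norm x = 1" "x \<in> S" using x by auto
  define \<mu> where "\<mu> = ?q x"
  have q_le: "?q z \<le> \<mu> * (z \<bullet> z)" if "z \<in> S" for z
  proof (cases "z = 0")
    case False
    have "(1 / norm z) *\<^sub>R z \<in> sphere 0 1 \<inter> S"
      using False that S by (auto simp: subspace_scale)
    from max[OF this] have "?q z / (norm z)\<^sup>2 \<le> \<mu>"
      by (simp add: \<mu>_def matrix_vector_mult_scaleR power2_eq_square)
    then show ?thesis using False by (simp add: field_simps power2_norm_eq_inner)
  qed simp
  define y where "y = A *v x - \<mu> *\<^sub>R x"
  have yS: "y \<in> S" using nx S inv by (simp add: y_def subspace_diff subspace_scale)
  have xx: "x \<bullet> x = 1" using nx by (simp add: norm_eq_1)
  have xy: "x \<bullet> y = 0" by (simp add: y_def inner_diff_right xx \<mu>_def)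
  have yy: "y \<bullet> (A *v x) = y \<bullet> y"
  proof -
    have "y \<bullet> (A *v x) - y \<bullet> y = \<mu> * (x \<bullet> y)"
      by (simp add: y_def inner_diff_right inner_diff_left inner_commute algebra_simps)
    then show ?thesis using xy by simp
  qed
  \<comment> \<open>Perturb the maximizer to \<open>x + t y\<close>: the linear term of the form must be beaten by \<open>t\<^sup>2\<close>.\<close>
  have key: "2 * t * (y \<bullet> y) \<le> t\<^sup>2 * (\<mu> * (y \<bullet> y) - ?q y)" for t
  proof -
    have "?q (x + t *\<^sub>R y) \<le> \<mu> * ((x + t *\<^sub>R y) \<bullet> (x + t *\<^sub>R y))"
      using nx yS S by (intro q_le) (simp add: subspace_add subspace_scale)
    moreover have "?q (x + t *\<^sub>R y) = \<mu> + 2 * t * (y \<bullet> y) + t\<^sup>2 * ?q y"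
      using matrix_symmetric_inner[OF sym, of x y] yy
      by (simp add: matrix_vector_right_distrib matrix_vector_mult_scaleR inner_add_left inner_add_right
          \<mu>_def inner_commute power2_eq_square algebra_simps)
    moreover have "(x + t *\<^sub>R y) \<bullet> (x + t *\<^sub>R y) = 1 + t\<^sup>2 * (y \<bullet> y)"
      using xx xy by (simp add: inner_add_left inner_add_right inner_commute power2_eq_square)
    ultimately have "\<mu> + 2 * t * (y \<bullet> y) + t\<^sup>2 * ?q y \<le> \<mu> * (1 + t\<^sup>2 * (y \<bullet> y))"
      by metis
    then show ?thesis by (simp add: algebra_simps)
  qed
  have "y \<bullet> y = 0"
  proof (rule ccontr)
    assume "y \<bullet> y \<noteq> 0"
    then have p: "y \<bullet> y > 0" by simp
    define K where "K = max 1 (\<mu> * (y \<bullet> y) - ?q y)"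
    have K: "K \<ge> 1" "\<mu> * (y \<bullet> y) - ?q y \<le> K" by (auto simp: K_def)
    define t where "t = (y \<bullet> y) / K"
    have t: "t > 0" using p K by (simp add: t_def)
    have "2 * t * (y \<bullet> y) \<le> t\<^sup>2 * K"
      using key[of t] K mult_left_mono[of _ K "t\<^sup>2"] by (meson order_trans zero_le_power2)
    also have "\<dots> = t * (y \<bullet> y)" using K by (simp add: t_def power2_eq_square)
    finally show False using t p by simp
  qed
  then have "A *v x = \<mu> *\<^sub>R x" by (simp add: y_def)
  with nx that show ?thesis by blast
qed

text \<open>
  Induction on the dimension: the part of an invariant subspace that is orthogonal to an eigenvector
  is again invariant, by symmetry of \<open>A\<close>.
\<close>
lemma symmetric_orthonormal_eigenbasis:
  fixes A :: "real^'n^'n"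
  assumes sym: "transpose A = A"
  shows "subspace S \<Longrightarrow> (\<And>x. x \<in> S \<Longrightarrow> A *v x \<in> S) \<Longrightarrow> dim S = n \<Longrightarrow>
    \<exists>B \<subseteq> S. finite B \<and> card B = n \<and> pairwise orthogonal B \<and> (\<forall>b\<in>B. norm b = 1 \<and> (\<exists>\<mu>. A *v b = \<mu> *\<^sub>R b))"
proof (induction n arbitrary: S)
  case 0
  then show ?case by (intro exI[of _ "{}"]) (auto simp: pairwise_def)
next
  case (Suc n)
  then have "S \<noteq> {0}" by (metis dim_singleton dim_eq_0 order_refl nat.distinct(1))
  with Suc.prems sym obtain x \<mu> where x: "x \<in> S" "norm x = 1" "A *v x = \<mu> *\<^sub>R x"
    by (metis symmetric_eigenvector_in_invariant_subspace)
  define T where "T = {y \<in> S. orthogonal x y}"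
  have T: "subspace T"
    using Suc.prems(1) by (auto simp: T_def subspace_def orthogonal_def inner_add_right)
  have inv: "A *v y \<in> T" if "y \<in> T" for y
    using that Suc.prems(2) x matrix_symmetric_inner[OF sym, of x y] by (auto simp: T_def orthogonal_def)
  have xx: "x \<bullet> x = 1" using x by (simp add: norm_eq_1)
  have "dim T = n"
  proof -
    have "S = span (insert x T)"
    proof
      show "span (insert x T) \<subseteq> S"
        using x Suc.prems(1) by (intro span_minimal) (auto simp: T_def)
      show "S \<subseteq> span (insert x T)"
      proof
        fix y assume y: "y \<in> S"
        have "y - (x \<bullet> y) *\<^sub>R x \<in> T"
          using y x Suc.prems(1) xx
          by (auto simp: T_def subspace_diff subspace_scale orthogonal_def inner_diff_right)
        then show "y \<in> span (insert x T)"
          by (metis insert_iff span_base span_breakdown_eq)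
      qed
    qed
    moreover have "x \<notin> span T"
      using xx T by (auto simp: span_eq_iff[THEN iffD2] T_def orthogonal_def)
    ultimately show ?thesis
      using Suc.prems(3) by (simp add: dim_insert)
  qed
  from Suc.IH[OF T inv this] obtain B where B: "B \<subseteq> T" "finite B" "card B = n" "pairwise orthogonal B"
    "\<forall>b\<in>B. norm b = 1 \<and> (\<exists>\<mu>. A *v b = \<mu> *\<^sub>R b)" by blast
  have "x \<notin> B" using B(1) xx by (auto simp: T_def orthogonal_def)
  moreover have "B \<subseteq> S" "\<And>b. b \<in> B \<Longrightarrow> orthogonal x b \<and> orthogonal b x"
    using B(1) by (auto simp: T_def orthogonal_commute)
  ultimately show ?case
    using B x by (intro exI[of _ "insert x B"]) (auto simp: pairwise_insert)
qed

theorem symmetric_matrix_diagonalization: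
  fixes A :: "real^'n^'n"
  assumes sym: "transpose A = A"
  obtains U l where "orthogonal_matrix U" "A = transpose U ** diag_mat l ** U"
proof -
  obtain B where B: "finite B" "card B = CARD('n)" "pairwise orthogonal B"
    "\<And>b. b \<in> B \<Longrightarrow> norm b = 1" "\<And>b. b \<in> B \<Longrightarrow> \<exists>\<mu>. A *v b = \<mu> *\<^sub>R b"
    using symmetric_orthonormal_eigenbasis[OF sym subspace_UNIV, of "CARD('n)"] by auto
  then obtain u where u: "bij_betw u (UNIV :: 'n set) B"
    by (metis bij_betw_iff_card finite)
  then have uB: "u j \<in> B" and uinj: "inj u" for j
    by (auto simp: bij_betw_def)
  obtain \<mu> where \<mu>: "\<And>b. b \<in> B \<Longrightarrow> A *v b = \<mu> b *\<^sub>R b"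
    using B(5) by metis
  define U :: "real^'n^'n" where "U = (\<chi> j. u j)"
  define l :: "real^'n" where "l = (\<chi> j. \<mu> (u j))"
  have row: "row j U = u j" for j by (simp add: row_def U_def)
  have U: "orthogonal_matrix U"
    unfolding orthogonal_matrix_orthonormal_rows row
    using B(3,4) uB uinj unfolding pairwise_def inj_def by metis
  then have UU: "transpose U ** U = mat 1" by (simp add: orthogonal_matrix)
  have symA: "A $ k $ j = A $ j $ k" for j k
    using arg_cong[OF sym, of "\<lambda>A. A $ j $ k"] by (simp add: transpose_def)
  have "(U ** A) $ i $ j = (diag_mat l ** U) $ i $ j" for i j
  proof -
    have "(U ** A) $ i $ j = (\<Sum>k\<in>UNIV. u i $ k * A $ k $ j)"
      by (simp add: matrix_matrix_mult_def U_def)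
    also have "\<dots> = (\<Sum>k\<in>UNIV. A $ j $ k * u i $ k)"
      using symA by (simp add: mult.commute)
    also have "\<dots> = (A *v u i) $ j" by (simp add: matrix_vector_mult_def)
    also have "\<dots> = l $ i * U $ i $ j" by (simp add: \<mu>[OF uB] l_def U_def)
    finally show ?thesis by (simp add: diag_mat_matrix_mult_nth)
  qed
  then have "U ** A = diag_mat l ** U" by (simp add: vec_eq_iff)
  then have "A = transpose U ** diag_mat l ** U"
    by (metis UU matrix_mul_assoc matrix_mul_lid)
  with U that show ?thesis by blast
qed

lemma orthogonal_rows_inner:
  fixes U :: "real^'n^'n"
  assumes "orthogonal_matrix U"
  shows "row i U \<bullet> row j U = (if i = j then 1 else 0)"
  using assms by (auto simp: orthogonal_matrix_orthonormal_rows orthogonal_def norm_eq_1)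

lemma mat_vec_mult_row: "(U *v x) $ j = row j U \<bullet> x"
  by (simp add: matrix_vector_mult_def row_def inner_vec_def)

lemma diag_mat_vec_mult: "(diag_mat d *v x) $ j = d $ j * x $ j"
  by (simp add: matrix_vector_mult_def diag_mat_def if_distrib [where f = "\<lambda>x. x * _"] cong: if_cong)

lemma inner_transpose_diag_mat:
  fixes U :: "real^'n^'n"
  shows "x \<bullet> ((transpose U ** diag_mat d ** U) *v y) = (\<Sum>j\<in>UNIV. d $ j * (row j U \<bullet> x) * (row j U \<bullet> y))"
proof -
  have "x \<bullet> ((transpose U ** diag_mat d ** U) *v y) = x \<bullet> (transpose U *v (diag_mat d *v (U *v y)))"
    by (simp add: matrix_vector_mul_assoc matrix_mul_assoc)
  also have "\<dots> = (U *v x) \<bullet> (diag_mat d *v (U *v y))"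
    by (metis dot_lmul_matrix vector_transpose_matrix transpose_transpose)
  also have "\<dots> = (\<Sum>j\<in>UNIV. d $ j * (row j U \<bullet> x) * (row j U \<bullet> y))"
    unfolding inner_vec_def[of "U *v x"] diag_mat_vec_mult unfolding mat_vec_mult_row
    by (simp add: mult_ac)
  finally show ?thesis .
qed

lemma row_inner_transpose_diag_mat:
  fixes U :: "real^'n^'n"
  assumes "orthogonal_matrix U"
  shows "row j U \<bullet> ((transpose U ** diag_mat d ** U) *v y) = d $ j * (row j U \<bullet> y)"
  by (simp add: inner_transpose_diag_mat orthogonal_rows_inner[OF assms] if_distrib
      [where f = "\<lambda>x. x * _"] if_distrib [where f = "\<lambda>x. _ * x"] cong: if_cong)

lemma trace_transpose_diag_mat:
  fixes U :: "real^'n^'n"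
  assumes "orthogonal_matrix U"
  shows "trace (transpose U ** diag_mat d ** U) = (\<Sum>j\<in>UNIV. d $ j)"
proof -
  have "trace (transpose U ** diag_mat d ** U) = trace (U ** (transpose U ** diag_mat d))"
    by (rule trace_mul_sym)
  also have "U ** (transpose U ** diag_mat d) = diag_mat d"
    using assms by (simp add: matrix_mul_assoc orthogonal_matrix_def)
  finally show ?thesis by (simp add: trace_def diag_mat_def)
qed

lemma transpose_diag_mat_mult:
  fixes U :: "real^'n^'n"
  assumes "orthogonal_matrix U"
  shows "(transpose U ** diag_mat c ** U) ** (transpose U ** diag_mat d ** U)
    = transpose U ** diag_mat (\<chi> j. c $ j * d $ j) ** U"
proof -
  have "diag_mat c ** diag_mat d = diag_mat (\<chi> j. c $ j * d $ j)"
    by (simp add: vec_eq_iff diag_mat_matrix_mult_nth) (simp add: diag_mat_def)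
  moreover have "(transpose U ** diag_mat c ** U) ** (transpose U ** diag_mat d ** U)
    = transpose U ** (diag_mat c ** (U ** transpose U) ** diag_mat d) ** U"
    by (simp add: matrix_mul_assoc)
  ultimately show ?thesis
    using assms by (simp add: orthogonal_matrix_def)
qed

lemma diag_mat_1: "diag_mat (\<chi> j. 1) = mat 1"
  by (simp add: vec_eq_iff diag_mat_def mat_def)

lemma matrix_inv_transpose_diag_mat:
  fixes U :: "real^'n^'n"
  assumes U: "orthogonal_matrix U" and l: "\<And>j. l $ j \<noteq> 0"
  shows "matrix_inv (transpose U ** diag_mat l ** U) = transpose U ** diag_mat (\<chi> j. 1 / l $ j) ** U"
proof -
  have "(transpose U ** diag_mat l ** U) ** (transpose U ** diag_mat (\<chi> j. 1 / l $ j) ** U) = mat 1" (is "?A ** ?B = _")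
    using U l by (simp add: transpose_diag_mat_mult diag_mat_1 orthogonal_matrix_def)
  then have AB: "?A ** ?B = mat 1" "?B ** ?A = mat 1"
    by (simp_all add: matrix_left_right_inverse)
  have "?A ** matrix_inv ?A = mat 1"
    unfolding matrix_inv_def by (rule someI2[of _ ?B]) (use AB in auto)
  then have "?B ** (?A ** matrix_inv ?A) = ?B" by simp
  moreover have "?B ** (?A ** matrix_inv ?A) = (?B ** ?A) ** matrix_inv ?A"
    by (rule matrix_mul_assoc)
  ultimately show ?thesis by (simp only: AB matrix_mul_lid)
qed

lemma mat_1_minus_transpose_diag_mat:
  fixes U :: "real^'n^'n"
  assumes U: "orthogonal_matrix U"
  shows "mat 1 - c *\<^sub>R (transpose U ** diag_mat d ** U) = transpose U ** diag_mat (\<chi> j. 1 - c * d $ j) ** U"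
proof -
  have "diag_mat (\<chi> j. 1 - c * d $ j) = diag_mat (\<chi> j. 1) - c *\<^sub>R diag_mat d"
    by (simp add: vec_eq_iff diag_mat_def)
  moreover have "transpose U ** diag_mat (\<chi> j. 1) ** U = mat 1"
    using U by (simp add: diag_mat_1 orthogonal_matrix_def)
  moreover have "A ** (B - c *\<^sub>R C) = A ** B - c *\<^sub>R (A ** C)"
    "(B - c *\<^sub>R C) ** A = B ** A - c *\<^sub>R (C ** A)" for A B C :: "real^'n^'n"
    by (simp_all add: vec_eq_iff matrix_matrix_mult_def sum_subtractf sum_distrib_left
        right_diff_distrib left_diff_distrib mult_ac)
  ultimately show ?thesis by simp
qed

section \<open>Sums over the Sobolev coefficients\<close>

definition power_sum :: "real \<Rightarrow> nat \<Rightarrow> real" where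
  "power_sum \<gamma> M = (\<Sum>m=1..M. real m powr \<gamma>)"

text \<open>
  The mean value theorem for \<open>x powr (\<gamma> + 1)\<close> on a unit interval; summing these bounds telescopes and
  compares a power sum with the integral of \<open>x powr \<gamma>\<close>.
\<close>
lemma powr_Suc_diff_bounds:
  assumes "\<gamma> > 0"
  shows "(\<gamma> + 1) * real m powr \<gamma> \<le> real (Suc m) powr (\<gamma> + 1) - real m powr (\<gamma> + 1)"
    and "real (Suc m) powr (\<gamma> + 1) - real m powr (\<gamma> + 1) \<le> (\<gamma> + 1) * real (Suc m) powr \<gamma>"
proof -
  have "\<exists>l z. real m < z \<and> z < real (Suc m) \<and> ((\<lambda>x. x powr (\<gamma> + 1)) has_real_derivative l) (at z) \<and>
    real (Suc m) powr (\<gamma> + 1) - real m powr (\<gamma> + 1) = (real (Suc m) - real m) * l"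
  proof (rule MVT)
    show "continuous_on {real m..real (Suc m)} (\<lambda>x. x powr (\<gamma> + 1))"
      using assms by (intro continuous_on_powr' continuous_intros) auto
    show "(\<lambda>x. x powr (\<gamma> + 1)) differentiable (at z)" if "real m < z" for z
      using that has_real_derivative_powr[of z "\<gamma> + 1"] real_differentiable_def by fastforce
  qed simp
  then obtain d z where z: "real m < z" "z < real (Suc m)"
    and d: "((\<lambda>x. x powr (\<gamma> + 1)) has_real_derivative d) (at z)"
    and e: "real (Suc m) powr (\<gamma> + 1) - real m powr (\<gamma> + 1) = d"
    by auto
  have "d = (\<gamma> + 1) * z powr \<gamma>"
    using DERIV_unique[OF d has_real_derivative_powr[of z "\<gamma> + 1"]] z by simp
  moreover have "real m powr \<gamma> \<le> z powr \<gamma>" "z powr \<gamma> \<le> real (Suc m) powr \<gamma>"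
    using z assms by (auto intro!: powr_mono2)
  ultimately show "(\<gamma> + 1) * real m powr \<gamma> \<le> real (Suc m) powr (\<gamma> + 1) - real m powr (\<gamma> + 1)"
    "real (Suc m) powr (\<gamma> + 1) - real m powr (\<gamma> + 1) \<le> (\<gamma> + 1) * real (Suc m) powr \<gamma>"
    using assms e by auto
qed

lemma power_sum_bounds:
  assumes "\<gamma> > 0"
  shows "real M powr (\<gamma> + 1) \<le> (\<gamma> + 1) * power_sum \<gamma> M"
    and "(\<gamma> + 1) * power_sum \<gamma> M \<le> real M powr (\<gamma> + 1) + (\<gamma> + 1) * real M powr \<gamma>"
proof -
  show "real M powr (\<gamma> + 1) \<le> (\<gamma> + 1) * power_sum \<gamma> M"
  proof (induction M)
    case (Suc M)
    then show ?case using powr_Suc_diff_bounds(2)[OF assms, of M]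
      by (simp add: power_sum_def algebra_simps)
  qed (use assms in \<open>simp add: power_sum_def\<close>)
  show "(\<gamma> + 1) * power_sum \<gamma> M \<le> real M powr (\<gamma> + 1) + (\<gamma> + 1) * real M powr \<gamma>"
  proof (induction M)
    case (Suc M)
    then show ?case using powr_Suc_diff_bounds(1)[OF assms, of M]
      by (simp add: power_sum_def algebra_simps)
  qed (use assms in \<open>simp add: power_sum_def\<close>)
qed

lemma power_sum_asymptotics:
  assumes "\<gamma> > 0"
  shows "(\<lambda>M. power_sum \<gamma> M / real M powr (\<gamma> + 1)) \<longlonglongrightarrow> 1 / (\<gamma> + 1)"
proof (rule tendsto_sandwich)
  show "eventually (\<lambda>M. 1 / (\<gamma> + 1) \<le> power_sum \<gamma> M / real M powr (\<gamma> + 1)) sequentially"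
    using eventually_gt_at_top[of "0::nat"]
  proof eventually_elim
    case (elim M)
    then show ?case using power_sum_bounds(1)[OF assms, of M] assms by (simp add: field_simps)
  qed
  show "eventually (\<lambda>M. power_sum \<gamma> M / real M powr (\<gamma> + 1) \<le> 1 / (\<gamma> + 1) + 1 / real M) sequentially"
    using eventually_gt_at_top[of "0::nat"]
  proof eventually_elim
    case (elim M)
    have "(\<gamma> + 1) * power_sum \<gamma> M \<le> real M powr (\<gamma> + 1) + (\<gamma> + 1) * (real M powr (\<gamma> + 1) / real M)"
      using power_sum_bounds(2)[OF assms, of M] elim by (simp add: powr_add)
    also have "\<dots> = (\<gamma> + 1) * ((1 / (\<gamma> + 1) + 1 / real M) * real M powr (\<gamma> + 1))"
    proof -
      have "P + g * (P / m) = g * ((1 / g + 1 / m) * P)" if "g \<noteq> 0" for g m P :: real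
        using that by (simp add: distrib_right distrib_left)
      then show ?thesis using assms by simp
    qed
    finally have "power_sum \<gamma> M \<le> (1 / (\<gamma> + 1) + 1 / real M) * real M powr (\<gamma> + 1)"
      using assms by (simp only: mult_le_cancel_left_pos)
    then show ?case using elim by (simp add: divide_le_eq)
  qed
  show "(\<lambda>M. 1 / (\<gamma> + 1) + 1 / real M) \<longlonglongrightarrow> 1 / (\<gamma> + 1)"
    using tendsto_add[OF tendsto_const lim_1_over_n, of "1 / (\<gamma> + 1)"] by simp
qed simp

text \<open>
  A formula that is uniform in the parity of the index: the coefficients \<open>a\<^sub>2\<^sub>m\<close> and \<open>a\<^sub>2\<^sub>m\<^sub>+\<^sub>1\<close> are
  both \<open>(2 m) powr \<beta>\<close>.
\<close>
lemma sob_coeff_Suc: "sob_coeff \<beta> (Suc i) = real (2 * (Suc i div 2)) powr \<beta>"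
proof (cases "even (Suc i)")
  case False
  then have "2 * (Suc i div 2) = i" by presburger
  with False show ?thesis by (simp add: sob_coeff_def)
qed (simp add: sob_coeff_def)

lemma sob_coeff_nonneg: "sob_coeff \<beta> i \<ge> 0"
  by (simp add: sob_coeff_def)

lemma sob_coeff_pos: "i \<ge> 2 \<Longrightarrow> sob_coeff \<beta> i > 0"
  by (auto simp: sob_coeff_def)

lemma sum_sob_coeff:
  "(\<Sum>i<2*M+1. f (sob_coeff \<beta> (Suc i))) = f 0 + 2 * (\<Sum>m=1..M. f (real (2 * m) powr \<beta>))"
  for f :: "real \<Rightarrow> real"
proof (induction M)
  case (Suc M)
  have "(\<Sum>i<2*Suc M+1. f (sob_coeff \<beta> (Suc i)))
      = (\<Sum>i<2*M+1. f (sob_coeff \<beta> (Suc i))) + f (sob_coeff \<beta> (2*M+2)) + f (sob_coeff \<beta> (2*M+3))"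
    by (simp add: eval_nat_numeral)
  also have "sob_coeff \<beta> (2*M+2) = real (2 * Suc M) powr \<beta>"
    using sob_coeff_Suc[of \<beta> "2*M+1"] by simp
  also have "sob_coeff \<beta> (2*M+3) = real (2 * Suc M) powr \<beta>"
    using sob_coeff_Suc[of \<beta> "2*M+2"] by (simp add: numeral_3_eq_3)
  finally show ?case using Suc by simp
qed (simp add: sob_coeff_def)

text \<open>
  The largest \<open>m\<close> with \<open>(2 m) powr \<beta> * \<kappa> \<le> 1\<close>: the frequencies \<open>1, \<dots>, 2 m + 1\<close> are those that
  can receive a positive weight.
\<close>
definition cutoff :: "real \<Rightarrow> real \<Rightarrow> nat" where
  "cutoff \<beta> \<kappa> = nat \<lfloor>\<kappa> powr (-1/\<beta>) / 2\<rfloor>"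

lemma sob_coeff_le_cutoff:
  assumes "\<beta> > 0" "\<kappa> > 0" "i < 2 * cutoff \<beta> \<kappa> + 1"
  shows "sob_coeff \<beta> (Suc i) * \<kappa> \<le> 1"
proof -
  have "Suc i div 2 \<le> cutoff \<beta> \<kappa>" using assms(3) by auto
  then have "real (2 * (Suc i div 2)) \<le> 2 * real (cutoff \<beta> \<kappa>)"
    by (metis of_nat_le_iff of_nat_mult of_nat_numeral mult_le_mono2)
  also have "real (cutoff \<beta> \<kappa>) \<le> \<kappa> powr (-1/\<beta>) / 2"
    unfolding cutoff_def by (subst of_nat_nat) (simp_all, linarith)
  finally have "real (2 * (Suc i div 2)) \<le> \<kappa> powr (-1/\<beta>)" by simp
  then have "real (2 * (Suc i div 2)) powr \<beta> \<le> (\<kappa> powr (-1/\<beta>)) powr \<beta>"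
    using assms by (intro powr_mono2) auto
  also have "\<dots> = 1 / \<kappa>" using assms by (subst powr_powr) (simp add: powr_minus_divide)
  finally show ?thesis
    unfolding sob_coeff_Suc using assms(2) by (simp only: pos_le_divide_eq)
qed

lemma sob_coeff_ge_cutoff:
  assumes "\<beta> > 0" "\<kappa> > 0" "i \<ge> 2 * cutoff \<beta> \<kappa> + 1"
  shows "sob_coeff \<beta> (Suc i) * \<kappa> \<ge> 1"
proof -
  have "\<kappa> powr (-1/\<beta>) / 2 \<le> real (cutoff \<beta> \<kappa>) + 1"
    unfolding cutoff_def by linarith
  also have "cutoff \<beta> \<kappa> + 1 \<le> Suc i div 2" using assms(3) by auto
  then have "real (cutoff \<beta> \<kappa>) + 1 \<le> real (Suc i div 2)" by linarith
  finally have "\<kappa> powr (-1/\<beta>) \<le> real (2 * (Suc i div 2))" by simp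
  then have "(\<kappa> powr (-1/\<beta>)) powr \<beta> \<le> real (2 * (Suc i div 2)) powr \<beta>"
    using assms by (intro powr_mono2) auto
  moreover have "(\<kappa> powr (-1/\<beta>)) powr \<beta> = 1 / \<kappa>"
    using assms by (subst powr_powr) (simp add: powr_minus_divide)
  ultimately show ?thesis
    unfolding sob_coeff_Suc using assms(2) by (simp only: pos_divide_le_eq)
qed

text \<open>
  The eigenvalues of the Pinsker weight matrices: on an eigenvector of \<open>Q\<close> with eigenvalue \<open>l\<close>, the
  \<open>i\<close>-th weight matrix multiplies by \<open>shrink \<beta> (\<kappa> / l) i\<close>.
\<close>
definition shrink :: "real \<Rightarrow> real \<Rightarrow> nat \<Rightarrow> real" where
  "shrink \<beta> \<kappa> i = max 0 (1 - sob_coeff \<beta> i * \<kappa>)"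

definition shrink_sum :: "real \<Rightarrow> real \<Rightarrow> real" where
  "shrink_sum \<beta> \<kappa> = (\<Sum>i. shrink \<beta> \<kappa> (Suc i))"

definition weighted_shrink_sum :: "real \<Rightarrow> real \<Rightarrow> real" where
  "weighted_shrink_sum \<beta> \<kappa> = (\<Sum>i. sob_coeff \<beta> (Suc i) * shrink \<beta> \<kappa> (Suc i))"

lemma shrink_nonneg: "shrink \<beta> \<kappa> i \<ge> 0" by (simp add: shrink_def)

lemma shrink_mono: "\<kappa> \<le> \<kappa>' \<Longrightarrow> shrink \<beta> \<kappa>' i \<le> shrink \<beta> \<kappa> i"
  using mult_left_mono[OF _ sob_coeff_nonneg, of \<kappa> \<kappa>' \<beta> i] by (auto simp: shrink_def)

lemma shrink_eq_0:
  assumes "\<beta> > 0" "\<kappa> > 0" "i \<ge> 2 * cutoff \<beta> \<kappa> + 1"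
  shows "shrink \<beta> \<kappa> (Suc i) = 0"
  using sob_coeff_ge_cutoff[OF assms] by (simp add: shrink_def)

lemma shrink_sums:
  assumes "\<beta> > 0" "\<kappa> > 0" "n \<ge> 2 * cutoff \<beta> \<kappa> + 1"
  shows "(\<lambda>i. g i * shrink \<beta> \<kappa> (Suc i)) sums (\<Sum>i<n. g i * shrink \<beta> \<kappa> (Suc i))"
  using assms by (intro sums_finite) (auto intro!: shrink_eq_0)

text \<open>
  Below the cutoff the positive part is inactive and above it the weights vanish, which reduces both
  sums to ordinary power sums.
\<close>
lemma shrink_sum_eq:
  assumes "\<beta> > 0" "\<kappa> > 0"
  defines "M \<equiv> cutoff \<beta> \<kappa>"
  shows "shrink_sum \<beta> \<kappa> = 2 * real M + 1 - \<kappa> * (2 powr (\<beta> + 1) * power_sum \<beta> M)"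
    and "weighted_shrink_sum \<beta> \<kappa> =
      2 powr (\<beta> + 1) * power_sum \<beta> M - \<kappa> * (2 powr (2 * \<beta> + 1) * power_sum (2 * \<beta>) M)"
proof -
  have s: "shrink \<beta> \<kappa> (Suc i) = 1 - sob_coeff \<beta> (Suc i) * \<kappa>" if "i < 2 * M + 1" for i
    using sob_coeff_le_cutoff[of \<beta> \<kappa> i] assms that by (simp add: shrink_def M_def)
  have "shrink_sum \<beta> \<kappa> = (\<Sum>i<2*M+1. shrink \<beta> \<kappa> (Suc i))"
    using sums_unique[OF shrink_sums[OF assms(1,2), of "2*M+1" "\<lambda>i. 1"]]
    by (simp add: shrink_sum_def M_def)
  also have "\<dots> = (\<Sum>i<2*M+1. 1 - sob_coeff \<beta> (Suc i) * \<kappa>)"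
    using s by (intro sum.cong) auto
  also have "\<dots> = 1 + 2 * (\<Sum>m=1..M. 1 - real (2 * m) powr \<beta> * \<kappa>)"
    using sum_sob_coeff[where f="\<lambda>a. 1 - a * \<kappa>"] by simp
  also have "\<dots> = 2 * real M + 1 - \<kappa> * (2 powr (\<beta> + 1) * power_sum \<beta> M)"
    by (simp add: sum_subtractf power_sum_def sum_distrib_left powr_mult powr_add mult_ac)
  finally show "shrink_sum \<beta> \<kappa> = 2 * real M + 1 - \<kappa> * (2 powr (\<beta> + 1) * power_sum \<beta> M)" .
  have "weighted_shrink_sum \<beta> \<kappa> = (\<Sum>i<2*M+1. sob_coeff \<beta> (Suc i) * shrink \<beta> \<kappa> (Suc i))"
    using sums_unique[OF shrink_sums[OF assms(1,2), of "2*M+1" "\<lambda>i. sob_coeff \<beta> (Suc i)"]]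
    by (simp add: weighted_shrink_sum_def M_def)
  also have "\<dots> = (\<Sum>i<2*M+1. sob_coeff \<beta> (Suc i) * (1 - sob_coeff \<beta> (Suc i) * \<kappa>))"
    using s by (intro sum.cong) auto
  also have "\<dots> = 2 * (\<Sum>m=1..M. real (2 * m) powr \<beta> * (1 - real (2 * m) powr \<beta> * \<kappa>))"
    using sum_sob_coeff[where f="\<lambda>a. a * (1 - a * \<kappa>)"] by simp
  also have "\<dots> = 2 powr (\<beta> + 1) * power_sum \<beta> M - \<kappa> * (2 powr (2 * \<beta> + 1) * power_sum (2 * \<beta>) M)"
  proof -
    have "real (2 * m) powr \<beta> * (1 - real (2 * m) powr \<beta> * \<kappa>)
        = 2 powr \<beta> * real m powr \<beta> - \<kappa> * (2 powr (2 * \<beta>) * real m powr (2 * \<beta>))" for m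
    proof -
      have "real (2 * m) powr \<beta> * real (2 * m) powr \<beta> = 2 powr (2 * \<beta>) * real m powr (2 * \<beta>)"
      proof -
        have "x powr \<beta> * x powr \<beta> = x powr (2 * \<beta>)" for x :: real
          unfolding mult_2 powr_add ..
        from this[of "real (2 * m)"] show ?thesis by (simp only: of_nat_mult of_nat_numeral powr_mult)
      qed
      then have "real (2 * m) powr \<beta> * (1 - real (2 * m) powr \<beta> * \<kappa>)
          = real (2 * m) powr \<beta> - \<kappa> * (2 powr (2 * \<beta>) * real m powr (2 * \<beta>))"
      proof -
        have "a * (1 - a * \<kappa>) = a - \<kappa> * b" if "a * a = b" for a b :: real
          unfolding that[symmetric] by (simp add: algebra_simps)
        then show ?thesis using \<open>_ = 2 powr (2 * \<beta>) * real m powr (2 * \<beta>)\<close> .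
      qed
      then show ?thesis by (simp only: of_nat_mult of_nat_numeral powr_mult)
    qed
    then show ?thesis
      by (simp only: sum_subtractf power_sum_def powr_add powr_one sum_distrib_left[symmetric])
        (simp add: algebra_simps)
  qed
  finally show "weighted_shrink_sum \<beta> \<kappa> =
      2 powr (\<beta> + 1) * power_sum \<beta> M - \<kappa> * (2 powr (2 * \<beta> + 1) * power_sum (2 * \<beta>) M)" .
qed

lemma cutoff_asymptotics:
  assumes "\<beta> > 0"
  shows "((\<lambda>\<kappa>. real (cutoff \<beta> \<kappa>) * \<kappa> powr (1/\<beta>)) \<longlongrightarrow> 1 / 2) (at_right 0)"
    and "filterlim (cutoff \<beta>) at_top (at_right 0)"
proof -
  have x: "filterlim (\<lambda>\<kappa>. \<kappa> powr (-1/\<beta>)) at_top (at_right (0::real))"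
    using assms by real_asymp
  have "((\<lambda>x::real. real (nat \<lfloor>x / 2\<rfloor>) / x) \<longlongrightarrow> 1 / 2) at_top"
    by real_asymp
  from filterlim_compose[OF this x]
  show "((\<lambda>\<kappa>. real (cutoff \<beta> \<kappa>) * \<kappa> powr (1/\<beta>)) \<longlongrightarrow> 1 / 2) (at_right 0)"
    by (simp add: cutoff_def powr_minus_divide)
  have "filterlim (\<lambda>x::real. nat \<lfloor>x / 2\<rfloor>) at_top at_top"
    by real_asymp
  from filterlim_compose[OF this x]
  show "filterlim (cutoff \<beta>) at_top (at_right 0)"
    unfolding cutoff_def .
qed

lemma power_sum_cutoff_asymptotics:
  assumes "\<beta> > 0" "\<gamma> > 0"
  shows "((\<lambda>\<kappa>. 2 powr (\<gamma> + 1) * power_sum \<gamma> (cutoff \<beta> \<kappa>) * \<kappa> powr ((\<gamma> + 1)/\<beta>)) \<longlongrightarrow> 1 / (\<gamma> + 1)) (at_right 0)"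
proof -
  let ?M = "cutoff \<beta>"
  have "((\<lambda>\<kappa>. 2 powr (\<gamma> + 1) * (power_sum \<gamma> (?M \<kappa>) / real (?M \<kappa>) powr (\<gamma> + 1)) *
      (real (?M \<kappa>) * \<kappa> powr (1/\<beta>)) powr (\<gamma> + 1)) \<longlongrightarrow>
      2 powr (\<gamma> + 1) * (1 / (\<gamma> + 1)) * (1 / 2) powr (\<gamma> + 1)) (at_right 0)"
    using assms
    by (intro tendsto_mult tendsto_const tendsto_powr cutoff_asymptotics
        filterlim_compose[OF power_sum_asymptotics cutoff_asymptotics(2)]) auto
  also have "2 powr (\<gamma> + 1) * (1 / (\<gamma> + 1)) * (1 / 2) powr (\<gamma> + 1) = 1 / (\<gamma> + 1)"
    by (simp add: powr_divide)
  finally show ?thesis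
  proof (rule Lim_transform_eventually)
    have "eventually (\<lambda>\<kappa>. ?M \<kappa> > 0) (at_right 0)"
      using cutoff_asymptotics(2)[OF assms(1)] unfolding filterlim_at_top
      by (auto elim!: eventually_mono dest!: spec[of _ 1])
    then show "eventually (\<lambda>\<kappa>. 2 powr (\<gamma> + 1) * (power_sum \<gamma> (?M \<kappa>) / real (?M \<kappa>) powr (\<gamma> + 1)) *
      (real (?M \<kappa>) * \<kappa> powr (1/\<beta>)) powr (\<gamma> + 1) =
      2 powr (\<gamma> + 1) * power_sum \<gamma> (?M \<kappa>) * \<kappa> powr ((\<gamma> + 1)/\<beta>)) (at_right 0)"
    proof eventually_elim
      case (elim \<kappa>)
      then show ?case by (simp add: powr_mult powr_powr)
    qed
  qed
qed

lemma shrink_sum_asymptotics: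
  assumes "\<beta> > 0"
  shows "((\<lambda>\<kappa>. shrink_sum \<beta> \<kappa> * \<kappa> powr (1/\<beta>)) \<longlongrightarrow> \<beta> / (\<beta> + 1)) (at_right 0)"
proof -
  have *: "((\<lambda>\<kappa>. \<kappa> powr (1/\<beta>)) \<longlongrightarrow> 0) (at_right (0::real))" using assms by real_asymp
  have "((\<lambda>\<kappa>. 2 * (real (cutoff \<beta> \<kappa>) * \<kappa> powr (1/\<beta>)) + \<kappa> powr (1/\<beta>) -
      2 powr (\<beta> + 1) * power_sum \<beta> (cutoff \<beta> \<kappa>) * \<kappa> powr ((\<beta> + 1)/\<beta>)) \<longlongrightarrow> 2 * (1/2) + 0 - 1 / (\<beta> + 1)) (at_right 0)"
    using assms by (intro tendsto_intros * cutoff_asymptotics power_sum_cutoff_asymptotics)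
  also have "2 * (1/2) + 0 - 1 / (\<beta> + 1) = \<beta> / (\<beta> + 1)" using assms by (simp add: field_simps)
  finally show ?thesis
  proof (rule Lim_transform_eventually)
    show "eventually (\<lambda>\<kappa>. 2 * (real (cutoff \<beta> \<kappa>) * \<kappa> powr (1/\<beta>)) + \<kappa> powr (1/\<beta>) -
      2 powr (\<beta> + 1) * power_sum \<beta> (cutoff \<beta> \<kappa>) * \<kappa> powr ((\<beta> + 1)/\<beta>) = shrink_sum \<beta> \<kappa> * \<kappa> powr (1/\<beta>)) (at_right 0)"
      using eventually_at_right_less[of 0]
    proof eventually_elim
      case (elim \<kappa>)
      have "\<kappa> powr ((\<beta> + 1)/\<beta>) = \<kappa> * \<kappa> powr (1/\<beta>)"
        using assms elim by (simp add: add_divide_distrib powr_add)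
      then show ?case using assms elim by (simp add: shrink_sum_eq algebra_simps)
    qed
  qed
qed

lemma weighted_shrink_sum_asymptotics:
  assumes "\<beta> > 0"
  shows "((\<lambda>\<kappa>. weighted_shrink_sum \<beta> \<kappa> * \<kappa> powr (1 + 1/\<beta>)) \<longlongrightarrow> \<beta> / ((\<beta> + 1) * (2 * \<beta> + 1))) (at_right 0)"
proof -
  have "((\<lambda>\<kappa>. 2 powr (\<beta> + 1) * power_sum \<beta> (cutoff \<beta> \<kappa>) * \<kappa> powr ((\<beta> + 1)/\<beta>) -
      2 powr (2 * \<beta> + 1) * power_sum (2 * \<beta>) (cutoff \<beta> \<kappa>) * \<kappa> powr ((2 * \<beta> + 1)/\<beta>)) \<longlongrightarrow>
      1 / (\<beta> + 1) - 1 / (2 * \<beta> + 1)) (at_right 0)"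
    using assms by (intro tendsto_intros power_sum_cutoff_asymptotics) auto
  also have "1 / (\<beta> + 1) - 1 / (2 * \<beta> + 1) = \<beta> / ((\<beta> + 1) * (2 * \<beta> + 1))"
    using assms by (simp add: field_simps)
  finally show ?thesis
  proof (rule Lim_transform_eventually)
    show "eventually (\<lambda>\<kappa>. 2 powr (\<beta> + 1) * power_sum \<beta> (cutoff \<beta> \<kappa>) * \<kappa> powr ((\<beta> + 1)/\<beta>) -
      2 powr (2 * \<beta> + 1) * power_sum (2 * \<beta>) (cutoff \<beta> \<kappa>) * \<kappa> powr ((2 * \<beta> + 1)/\<beta>)
      = weighted_shrink_sum \<beta> \<kappa> * \<kappa> powr (1 + 1/\<beta>)) (at_right 0)"
      using eventually_at_right_less[of 0]
    proof eventually_elim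
      case (elim \<kappa>)
      have "\<kappa> powr ((\<beta> + 1)/\<beta>) = \<kappa> powr (1 + 1/\<beta>)"
        using assms by (simp add: add_divide_distrib)
      moreover have "\<kappa> powr ((2 * \<beta> + 1)/\<beta>) = \<kappa> * \<kappa> powr (1 + 1/\<beta>)"
      proof -
        have "(2 * \<beta> + 1)/\<beta> = 1 + (1 + 1/\<beta>)" using assms by (simp add: field_simps)
        then show ?thesis using elim by (simp only: powr_add powr_one)
      qed
      ultimately show ?case using assms elim by (simp add: shrink_sum_eq algebra_simps)
    qed
  qed
qed

lemma weighted_shrink_sum_nonneg: "\<beta> > 0 \<Longrightarrow> \<kappa> > 0 \<Longrightarrow> weighted_shrink_sum \<beta> \<kappa> \<ge> 0"
  unfolding weighted_shrink_sum_def
  by (intro suminf_nonneg sums_summable[OF shrink_sums] mult_nonneg_nonneg sob_coeff_nonneg shrink_nonneg) auto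

lemma weighted_shrink_sum_antimono:
  assumes "\<beta> > 0" "0 < \<kappa>" "\<kappa> \<le> \<kappa>'"
  shows "weighted_shrink_sum \<beta> \<kappa>' \<le> weighted_shrink_sum \<beta> \<kappa>"
  unfolding weighted_shrink_sum_def
  using assms by (intro suminf_le sums_summable[OF shrink_sums] mult_left_mono sob_coeff_nonneg shrink_mono) auto

lemma weighted_shrink_sum_eq_0:
  assumes "\<beta> > 0" "\<kappa> \<ge> 1"
  shows "weighted_shrink_sum \<beta> \<kappa> = 0"
proof -
  have "\<kappa> powr (-1/\<beta>) \<le> 1 powr (-1/\<beta>)" using assms by (intro powr_mono2') auto
  then have "cutoff \<beta> \<kappa> = 0" by (simp add: cutoff_def floor_eq_iff)
  then show ?thesis using assms by (simp add: shrink_sum_eq power_sum_def)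
qed

text \<open>
  Near \<open>\<kappa>\<close> only the terms up to the cutoff of \<open>\<kappa> / 2\<close> contribute, so that the series is locally a
  fixed finite sum of continuous functions.
\<close>
lemma isCont_weighted_shrink_sum:
  assumes "\<beta> > 0" "\<kappa> > 0"
  shows "isCont (weighted_shrink_sum \<beta>) \<kappa>"
proof -
  let ?n = "2 * cutoff \<beta> (\<kappa>/2) + 1"
  have eq: "weighted_shrink_sum \<beta> x = (\<Sum>i<?n. sob_coeff \<beta> (Suc i) * shrink \<beta> x (Suc i))" if "x > \<kappa> / 2" for x
  proof -
    have "shrink \<beta> x (Suc i) = 0" if "i \<ge> ?n" for i
      using shrink_eq_0[of \<beta> "\<kappa>/2" i] shrink_mono[of "\<kappa>/2" x \<beta> "Suc i"] shrink_nonneg[of \<beta> x "Suc i"] assms that \<open>x > \<kappa>/2\<close>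
      by auto
    then show ?thesis unfolding weighted_shrink_sum_def
      by (intro sums_unique[symmetric] sums_finite) auto
  qed
  have "isCont (\<lambda>x. \<Sum>i<?n. sob_coeff \<beta> (Suc i) * shrink \<beta> x (Suc i)) \<kappa>"
    unfolding shrink_def by (intro continuous_intros)
  moreover have "eventually (\<lambda>x. weighted_shrink_sum \<beta> x = (\<Sum>i<?n. sob_coeff \<beta> (Suc i) * shrink \<beta> x (Suc i))) (nhds \<kappa>)"
    using eventually_gt_at_top eq assms
    by (intro eventually_nhds[THEN iffD2] exI[of _ "{\<kappa>/2<..}"]) auto
  ultimately show ?thesis using isCont_cong by force
qed

section \<open>The Lagrange multiplier and its rate\<close>

text \<open>
  With \<open>l\<close> the eigenvalues of \<open>Q\<close> and \<open>C\<^sub>i\<close> the Pinsker weights, the following two functions are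
  \<open>\<Sum>\<^sub>i tr (Q C\<^sub>i)\<close> and \<open>\<Sum>\<^sub>i a\<^sub>i tr C\<^sub>i\<close>. The first is the asymptotic minimax risk divided by
  \<open>\<epsilon>\<^sup>2\<close>, the second enters the equation for \<open>\<kappa>\<close>.
\<close>
definition total_shrink :: "real \<Rightarrow> ('p::finite \<Rightarrow> real) \<Rightarrow> real \<Rightarrow> real" where
  "total_shrink \<beta> l \<kappa> = (\<Sum>j\<in>UNIV. l j * shrink_sum \<beta> (\<kappa> / l j))"

definition total_weighted_shrink :: "real \<Rightarrow> ('p::finite \<Rightarrow> real) \<Rightarrow> real \<Rightarrow> real" where
  "total_weighted_shrink \<beta> l \<kappa> = (\<Sum>j\<in>UNIV. weighted_shrink_sum \<beta> (\<kappa> / l j))"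

lemma filterlim_divide_at_right_0:
  "c > 0 \<Longrightarrow> filterlim (\<lambda>\<kappa>::real. \<kappa> / c) (at_right 0) (at_right 0)"
  by real_asymp

lemma total_shrink_asymptotics:
  fixes l :: "'p::finite \<Rightarrow> real"
  assumes "\<beta> > 0" "\<And>j. l j > 0"
  shows "((\<lambda>\<kappa>. total_shrink \<beta> l \<kappa> * \<kappa> powr (1/\<beta>)) \<longlongrightarrow>
    \<beta> / (\<beta> + 1) * (\<Sum>j\<in>UNIV. l j powr ((\<beta> + 1)/\<beta>))) (at_right 0)"
proof -
  have "((\<lambda>\<kappa>. \<Sum>j\<in>UNIV. l j powr ((\<beta> + 1)/\<beta>) * (shrink_sum \<beta> (\<kappa> / l j) * (\<kappa> / l j) powr (1/\<beta>))) \<longlongrightarrow>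
    (\<Sum>j\<in>UNIV. l j powr ((\<beta> + 1)/\<beta>) * (\<beta> / (\<beta> + 1)))) (at_right 0)"
    using assms
    by (intro tendsto_sum tendsto_mult tendsto_const filterlim_compose[OF shrink_sum_asymptotics filterlim_divide_at_right_0])
  also have "(\<Sum>j\<in>UNIV. l j powr ((\<beta> + 1)/\<beta>) * (\<beta> / (\<beta> + 1))) = \<beta> / (\<beta> + 1) * (\<Sum>j\<in>UNIV. l j powr ((\<beta> + 1)/\<beta>))"
    by (subst sum_distrib_left) (simp only: mult.commute)
  finally show ?thesis
  proof (rule Lim_transform_eventually)
    show "eventually (\<lambda>\<kappa>. (\<Sum>j\<in>UNIV. l j powr ((\<beta> + 1)/\<beta>) * (shrink_sum \<beta> (\<kappa> / l j) * (\<kappa> / l j) powr (1/\<beta>)))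
      = total_shrink \<beta> l \<kappa> * \<kappa> powr (1/\<beta>)) (at_right 0)"
      using eventually_at_right_less[of 0]
    proof eventually_elim
      case (elim \<kappa>)
      have "l j powr ((\<beta> + 1)/\<beta>) * (shrink_sum \<beta> (\<kappa> / l j) * (\<kappa> / l j) powr (1/\<beta>))
        = l j * shrink_sum \<beta> (\<kappa> / l j) * \<kappa> powr (1/\<beta>)" for j
      proof -
        have "l j powr ((\<beta> + 1)/\<beta>) = l j * l j powr (1/\<beta>)"
          using assms(1) assms(2)[of j] by (simp add: add_divide_distrib powr_add)
        moreover have "(\<kappa> / l j) powr (1/\<beta>) * l j powr (1/\<beta>) = \<kappa> powr (1/\<beta>)"
          using assms(2)[of j] elim by (simp flip: powr_mult)
        ultimately show ?thesis by (metis (no_types, lifting) mult.assoc mult.commute)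
      qed
      then show ?case unfolding total_shrink_def sum_distrib_right by (rule sum.cong[OF refl])
    qed
  qed
qed

lemma total_weighted_shrink_asymptotics:
  fixes l :: "'p::finite \<Rightarrow> real"
  assumes "\<beta> > 0" "\<And>j. l j > 0"
  shows "((\<lambda>\<kappa>. total_weighted_shrink \<beta> l \<kappa> * \<kappa> powr (1 + 1/\<beta>)) \<longlongrightarrow>
    \<beta> / ((\<beta> + 1) * (2 * \<beta> + 1)) * (\<Sum>j\<in>UNIV. l j powr ((\<beta> + 1)/\<beta>))) (at_right 0)"
proof -
  let ?c = "\<beta> / ((\<beta> + 1) * (2 * \<beta> + 1))"
  have "((\<lambda>\<kappa>. \<Sum>j\<in>UNIV. l j powr ((\<beta> + 1)/\<beta>) * (weighted_shrink_sum \<beta> (\<kappa> / l j) * (\<kappa> / l j) powr (1 + 1/\<beta>))) \<longlongrightarrow>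
    (\<Sum>j\<in>UNIV. l j powr ((\<beta> + 1)/\<beta>) * ?c)) (at_right 0)"
    using assms
    by (intro tendsto_sum tendsto_mult tendsto_const filterlim_compose[OF weighted_shrink_sum_asymptotics filterlim_divide_at_right_0])
  also have "(\<Sum>j\<in>UNIV. l j powr ((\<beta> + 1)/\<beta>) * ?c) = ?c * (\<Sum>j\<in>UNIV. l j powr ((\<beta> + 1)/\<beta>))"
    by (subst sum_distrib_left) (simp only: mult.commute)
  finally show ?thesis
  proof (rule Lim_transform_eventually)
    show "eventually (\<lambda>\<kappa>. (\<Sum>j\<in>UNIV. l j powr ((\<beta> + 1)/\<beta>) * (weighted_shrink_sum \<beta> (\<kappa> / l j) * (\<kappa> / l j) powr (1 + 1/\<beta>)))
      = total_weighted_shrink \<beta> l \<kappa> * \<kappa> powr (1 + 1/\<beta>)) (at_right 0)"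
      using eventually_at_right_less[of 0]
    proof eventually_elim
      case (elim \<kappa>)
      have "l j powr ((\<beta> + 1)/\<beta>) * (weighted_shrink_sum \<beta> (\<kappa> / l j) * (\<kappa> / l j) powr (1 + 1/\<beta>))
        = weighted_shrink_sum \<beta> (\<kappa> / l j) * \<kappa> powr (1 + 1/\<beta>)" for j
      proof -
        have "l j powr ((\<beta> + 1)/\<beta>) = l j powr (1 + 1/\<beta>)"
          using assms(1) by (simp add: add_divide_distrib)
        moreover have "(\<kappa> / l j) powr (1 + 1/\<beta>) * l j powr (1 + 1/\<beta>) = \<kappa> powr (1 + 1/\<beta>)"
          using assms(2)[of j] elim by (simp flip: powr_mult)
        ultimately show ?thesis by (metis (no_types, lifting) mult.assoc mult.commute)
      qed
      then show ?case unfolding total_weighted_shrink_def sum_distrib_right by (rule sum.cong[OF refl])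
    qed
  qed
qed

lemma total_weighted_shrink_antimono:
  fixes l :: "'p::finite \<Rightarrow> real"
  assumes "\<beta> > 0" "\<And>j. l j > 0" "0 < \<kappa>" "\<kappa> \<le> \<kappa>'"
  shows "total_weighted_shrink \<beta> l \<kappa>' \<le> total_weighted_shrink \<beta> l \<kappa>"
  unfolding total_weighted_shrink_def
  using assms by (intro sum_mono weighted_shrink_sum_antimono divide_right_mono) (auto intro: less_imp_le)

lemma total_weighted_shrink_nonneg:
  fixes l :: "'p::finite \<Rightarrow> real"
  assumes "\<beta> > 0" "\<And>j. l j > 0" "0 < \<kappa>"
  shows "total_weighted_shrink \<beta> l \<kappa> \<ge> 0"
  unfolding total_weighted_shrink_def
  using assms by (intro sum_nonneg weighted_shrink_sum_nonneg) auto

lemma sum_powr_pos: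
  fixes l :: "'p::finite \<Rightarrow> real"
  assumes "\<And>j. l j > 0"
  shows "(\<Sum>j\<in>UNIV. l j powr r) > 0"
proof (rule sum_pos)
  show "0 < l j powr r" for j using assms[of j] by simp
qed auto

lemma total_weighted_shrink_over_kappa_at_top:
  fixes l :: "'p::finite \<Rightarrow> real"
  assumes "\<beta> > 0" "\<And>j. l j > 0"
  shows "filterlim (\<lambda>\<kappa>. total_weighted_shrink \<beta> l \<kappa> / \<kappa>) at_top (at_right 0)"
proof -
  let ?c = "\<beta> / ((\<beta> + 1) * (2 * \<beta> + 1)) * (\<Sum>j\<in>UNIV. l j powr ((\<beta> + 1)/\<beta>))"
  have c: "?c > 0" using assms sum_powr_pos[of l] by (intro mult_pos_pos) auto
  have "2 + 1/\<beta> > 0" using assms(1) by (simp add: add_pos_pos)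
  then have "filterlim (\<lambda>\<kappa>::real. \<kappa> powr (-(2 + 1/\<beta>))) at_top (at_right 0)"
    by real_asymp
  from filterlim_tendsto_pos_mult_at_top[OF total_weighted_shrink_asymptotics[OF assms] c this]
  show ?thesis
  proof (rule filterlim_mono_eventually)
    show "eventually (\<lambda>\<kappa>. total_weighted_shrink \<beta> l \<kappa> * \<kappa> powr (1 + 1/\<beta>) * \<kappa> powr - (2 + 1/\<beta>) =
      total_weighted_shrink \<beta> l \<kappa> / \<kappa>) (at_right 0)"
      using eventually_at_right_less[of 0]
    proof eventually_elim
      case (elim \<kappa>)
      have "\<kappa> powr (1 + 1/\<beta>) * \<kappa> powr - (2 + 1/\<beta>) = 1 / \<kappa>"
        using elim by (simp add: powr_minus_divide flip: powr_add)
      then show ?case by (simp add: mult.assoc)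
    qed
  qed auto
qed

text \<open>
  The function \<open>total_weighted_shrink \<beta> l \<kappa> / \<kappa>\<close> is continuous, tends to infinity at \<open>0\<close> and vanishes
  for large \<open>\<kappa>\<close>, so it takes the value \<open>1 / e\<close>. Uniqueness holds because the numerator is
  nonincreasing in \<open>\<kappa>\<close>, whereas a solution makes it equal to the increasing function \<open>\<kappa> / e\<close>.
\<close>
lemma ex1_kappa:
  fixes l :: "'p::finite \<Rightarrow> real"
  assumes "\<beta> > 0" "\<And>j. l j > 0" "e > 0"
  shows "\<exists>!\<kappa>. \<kappa> > 0 \<and> e * inverse \<kappa> * total_weighted_shrink \<beta> l \<kappa> = 1"
proof (rule ex_ex1I)
  let ?H = "\<lambda>\<kappa>. total_weighted_shrink \<beta> l \<kappa> / \<kappa>"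
  have "eventually (\<lambda>\<kappa>. \<kappa> > 0 \<and> ?H \<kappa> \<ge> 1 / e) (at_right 0)"
    using total_weighted_shrink_over_kappa_at_top[of \<beta> l] assms unfolding filterlim_at_top
    by (intro eventually_conj eventually_at_right_less) auto
  then obtain a where a: "a > 0" "?H a \<ge> 1 / e"
    using eventually_happens'[OF trivial_limit_at_right_real] by blast
  \<comment> \<open>For \<open>\<kappa> \<ge> l j\<close> every frequency with nonzero coefficient has weight zero, because \<open>a\<^sub>2 \<ge> 1\<close>.\<close>
  define b where "b = max a (Max (range l))"
  have b: "b \<ge> a" by (simp add: b_def)
  have lb: "l j \<le> b" for j by (auto simp: b_def intro!: max.coboundedI2)
  have "total_weighted_shrink \<beta> l b = 0"
    unfolding total_weighted_shrink_def
    by (intro sum.neutral ballI weighted_shrink_sum_eq_0) (use assms lb in \<open>auto simp: divide_simps\<close>)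
  then have "?H b = 0" by simp
  moreover have "isCont ?H x" if "a \<le> x" for x
    using that a assms unfolding total_weighted_shrink_def
    by (intro continuous_intros isCont_o2[OF _ isCont_weighted_shrink_sum]) (auto simp: less_imp_neq[symmetric])
  ultimately have "\<exists>x. a \<le> x \<and> x \<le> b \<and> ?H x = 1 / e"
    using a b assms by (intro IVT2) auto
  then obtain x where "a \<le> x" "?H x = 1 / e" by blast
  then show "\<exists>\<kappa>. \<kappa> > 0 \<and> e * inverse \<kappa> * total_weighted_shrink \<beta> l \<kappa> = 1"
    using a assms by (intro exI[of _ x]) (auto simp: field_simps)
next
  have *: False if "0 < x" "x < y" "e * inverse x * total_weighted_shrink \<beta> l x = 1"
    "e * inverse y * total_weighted_shrink \<beta> l y = 1" for x y
  proof -
    have "total_weighted_shrink \<beta> l x = x / e" "total_weighted_shrink \<beta> l y = y / e"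
      using that assms by (auto simp: field_simps)
    moreover have "total_weighted_shrink \<beta> l y \<le> total_weighted_shrink \<beta> l x"
      using that assms by (intro total_weighted_shrink_antimono) auto
    ultimately show False using that assms by (simp add: divide_le_cancel)
  qed
  show "x = y" if "x > 0 \<and> e * inverse x * total_weighted_shrink \<beta> l x = 1"
    "y > 0 \<and> e * inverse y * total_weighted_shrink \<beta> l y = 1" for x y
    using *[of x y] *[of y x] that by (meson linorder_neqE_linordered_idom)
qed

text \<open>
  If \<open>\<kappa>\<close> stayed above some \<open>k > 0\<close>, monotonicity would bound \<open>1\<close> by \<open>\<epsilon>\<^sup>2\<close> times a constant
  depending on \<open>k\<close>.
\<close>
lemma kappa_tendsto_0:
  fixes l :: "'p::finite \<Rightarrow> real"
  assumes "\<beta> > 0" "\<And>j. l j > 0"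
    and K: "\<And>\<epsilon>. \<epsilon> > 0 \<Longrightarrow> K \<epsilon> > 0 \<and> \<epsilon>\<^sup>2 * inverse (K \<epsilon>) * total_weighted_shrink \<beta> l (K \<epsilon>) = 1"
  shows "filterlim K (at_right 0) (at_right 0)"
  unfolding filterlim_at
proof
  show "eventually (\<lambda>\<epsilon>. K \<epsilon> \<in> {0<..} \<and> K \<epsilon> \<noteq> 0) (at_right 0)"
    using eventually_at_right_less[of 0] by eventually_elim (use K in force)
  show "(K \<longlongrightarrow> 0) (at_right 0)"
  proof (rule order_tendstoI)
    show "eventually (\<lambda>\<epsilon>. a < K \<epsilon>) (at_right 0)" if "a < 0" for a
      using eventually_at_right_less[of 0] by eventually_elim (use K that in \<open>force intro: less_trans\<close>)
    fix k :: real assume k: "k > 0"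
    have "((\<lambda>\<epsilon>. \<epsilon>\<^sup>2 * inverse k * total_weighted_shrink \<beta> l k) \<longlongrightarrow> 0\<^sup>2 * inverse k * total_weighted_shrink \<beta> l k) (at_right 0)"
      by (intro tendsto_intros)
    then have "eventually (\<lambda>\<epsilon>. \<epsilon>\<^sup>2 * inverse k * total_weighted_shrink \<beta> l k < 1) (at_right 0)"
      by (rule order_tendstoD) simp
    then show "eventually (\<lambda>\<epsilon>. K \<epsilon> < k) (at_right 0)"
      using eventually_at_right_less[of 0]
    proof eventually_elim
      case (elim \<epsilon>)
      show ?case
      proof (rule ccontr)
        assume "\<not> K \<epsilon> < k"
        then have "inverse (K \<epsilon>) \<le> inverse k" "total_weighted_shrink \<beta> l (K \<epsilon>) \<le> total_weighted_shrink \<beta> l k"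
          using k assms by (auto intro!: le_imp_inverse_le total_weighted_shrink_antimono)
        then have "\<epsilon>\<^sup>2 * inverse (K \<epsilon>) * total_weighted_shrink \<beta> l (K \<epsilon>) \<le> \<epsilon>\<^sup>2 * inverse k * total_weighted_shrink \<beta> l k"
          using k K[of \<epsilon>] elim assms by (intro mult_mono total_weighted_shrink_nonneg) auto
        then show False using K[of \<epsilon>] elim by simp
      qed
    qed
  qed
qed

text \<open>
  The equation for \<open>\<kappa>\<close> gives \<open>\<epsilon>\<^sup>2 \<sim> ((2 \<beta> + 1) / A) \<kappa> powr (2 + 1 / \<beta>)\<close> with
  \<open>A = \<beta> T / (\<beta> + 1)\<close>, while \<open>total_shrink \<beta> l \<kappa> \<sim> A \<kappa> powr (- 1 / \<beta>)\<close>. In the product of the second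
  function with the power \<open>1 / (2 \<beta> + 1)\<close> of \<open>\<epsilon>\<^sup>2\<close> the powers of \<open>\<kappa>\<close> cancel.
\<close>
lemma pinsker_rates:
  fixes l :: "'p::finite \<Rightarrow> real"
  assumes b: "\<beta> > 0" and l: "\<And>j. l j > 0"
    and K: "\<And>\<epsilon>. \<epsilon> > 0 \<Longrightarrow> K \<epsilon> > 0 \<and> \<epsilon>\<^sup>2 * inverse (K \<epsilon>) * total_weighted_shrink \<beta> l (K \<epsilon>) = 1"
  defines "T \<equiv> (\<Sum>j\<in>UNIV. l j powr ((\<beta> + 1)/\<beta>))"
  shows "((\<lambda>\<epsilon>. \<epsilon>\<^sup>2 * total_shrink \<beta> l (K \<epsilon>) / \<epsilon> powr (4 * \<beta> / (2 * \<beta> + 1))) \<longlongrightarrow>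
      (2 * \<beta> + 1) powr (1 / (2 * \<beta> + 1)) * (\<beta> * T / (\<beta> + 1)) powr (2 * \<beta> / (2 * \<beta> + 1))) (at_right 0)"
    and "((\<lambda>\<epsilon>. \<epsilon>\<^sup>2 / (K \<epsilon>)\<^sup>2) \<longlongrightarrow> 0) (at_right 0)"
    and "filterlim (\<lambda>\<epsilon>. total_shrink \<beta> l (K \<epsilon>)) at_top (at_right 0)"
proof -
  let ?D = "\<lambda>\<epsilon>. total_shrink \<beta> l (K \<epsilon>)" and ?W = "\<lambda>\<epsilon>. total_weighted_shrink \<beta> l (K \<epsilon>)"
  have K0: "filterlim K (at_right 0) (at_right 0)" using kappa_tendsto_0[OF b l K] .
  have T: "T > 0" unfolding T_def by (rule sum_powr_pos[OF l])
  define A where "A = \<beta> * T / (\<beta> + 1)"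
  have A: "A > 0" using b T by (simp add: A_def)
  have D: "((\<lambda>\<epsilon>. ?D \<epsilon> * K \<epsilon> powr (1/\<beta>)) \<longlongrightarrow> A) (at_right 0)"
    using filterlim_compose[OF total_shrink_asymptotics[of \<beta> l, OF b l] K0] by (simp add: A_def T_def)
  have "((\<lambda>\<epsilon>. ?W \<epsilon> * K \<epsilon> powr (1 + 1/\<beta>)) \<longlongrightarrow> A / (2 * \<beta> + 1)) (at_right 0)"
    using filterlim_compose[OF total_weighted_shrink_asymptotics[of \<beta> l, OF b l] K0] by (simp add: A_def T_def)
  then have "((\<lambda>\<epsilon>. inverse (?W \<epsilon> * K \<epsilon> powr (1 + 1/\<beta>))) \<longlongrightarrow> inverse (A / (2 * \<beta> + 1))) (at_right 0)"
    using A b by (intro tendsto_inverse) auto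
  then have E: "((\<lambda>\<epsilon>. \<epsilon>\<^sup>2 * K \<epsilon> powr (-(2 + 1/\<beta>))) \<longlongrightarrow> (2 * \<beta> + 1) / A) (at_right 0)"
    unfolding inverse_divide
  proof (rule Lim_transform_eventually)
    show "eventually (\<lambda>\<epsilon>. inverse (?W \<epsilon> * K \<epsilon> powr (1 + 1/\<beta>)) = \<epsilon>\<^sup>2 * K \<epsilon> powr (-(2 + 1/\<beta>))) (at_right 0)"
      using eventually_at_right_less[of 0]
    proof eventually_elim
      case (elim \<epsilon>)
      note k = K[OF elim]
      have "\<epsilon>\<^sup>2 = K \<epsilon> * inverse (?W \<epsilon>)"
      proof -
        have "?W \<epsilon> \<noteq> 0" using k by auto
        then show ?thesis using k by (simp add: field_simps)
      qed
      moreover have "K \<epsilon> * K \<epsilon> powr (-(2 + 1/\<beta>)) = inverse (K \<epsilon> powr (1 + 1/\<beta>))"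
      proof -
        have "K \<epsilon> * K \<epsilon> powr (-(2 + 1/\<beta>)) = K \<epsilon> powr (1 + -(2 + 1/\<beta>))"
          using k by (subst powr_add) simp
        also have "1 + -(2 + 1/\<beta>) = -(1 + 1/\<beta>)" by simp
        finally show ?thesis by (simp only: powr_minus)
      qed
      ultimately show ?case by (simp add: mult_ac)
    qed
  qed
  have K0': "((\<lambda>\<epsilon>. K \<epsilon> powr (1/\<beta>)) \<longlongrightarrow> 0) (at_right 0)"
  proof -
    have "((\<lambda>\<kappa>::real. \<kappa> powr (1/\<beta>)) \<longlongrightarrow> 0) (at_right 0)" using b by real_asymp
    from filterlim_compose[OF this K0] show ?thesis .
  qed
  show "((\<lambda>\<epsilon>. \<epsilon>\<^sup>2 / (K \<epsilon>)\<^sup>2) \<longlongrightarrow> 0) (at_right 0)"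
  proof (rule Lim_transform_eventually)
    show "((\<lambda>\<epsilon>. \<epsilon>\<^sup>2 * K \<epsilon> powr (-(2 + 1/\<beta>)) * K \<epsilon> powr (1/\<beta>)) \<longlongrightarrow> 0) (at_right 0)"
      using tendsto_mult[OF E K0'] by simp
    show "eventually (\<lambda>\<epsilon>. \<epsilon>\<^sup>2 * K \<epsilon> powr (-(2 + 1/\<beta>)) * K \<epsilon> powr (1/\<beta>) = \<epsilon>\<^sup>2 / (K \<epsilon>)\<^sup>2) (at_right 0)"
      using eventually_at_right_less[of 0]
    proof eventually_elim
      case (elim \<epsilon>)
      have "K \<epsilon> powr (-(2 + 1/\<beta>)) * K \<epsilon> powr (1/\<beta>) = K \<epsilon> powr (-2)"
        by (simp flip: powr_add)
      also have "\<dots> = 1 / (K \<epsilon>)\<^sup>2" using K[OF elim] by (simp add: powr_minus_divide)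
      finally show ?case by (simp add: mult.assoc)
    qed
  qed
  show "filterlim (\<lambda>\<epsilon>. ?D \<epsilon>) at_top (at_right 0)"
  proof -
    have "filterlim (\<lambda>\<kappa>::real. \<kappa> powr (-1/\<beta>)) at_top (at_right 0)" using b by real_asymp
    from filterlim_compose[OF this K0]
    have "filterlim (\<lambda>\<epsilon>. ?D \<epsilon> * K \<epsilon> powr (1/\<beta>) * K \<epsilon> powr (-1/\<beta>)) at_top (at_right 0)"
      using D A by (intro filterlim_tendsto_pos_mult_at_top)
    then show ?thesis
    proof (rule filterlim_mono_eventually)
      show "eventually (\<lambda>\<epsilon>. ?D \<epsilon> * K \<epsilon> powr (1/\<beta>) * K \<epsilon> powr (-1/\<beta>) = ?D \<epsilon>) (at_right 0)"
        using eventually_at_right_less[of 0]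
      proof eventually_elim
        case (elim \<epsilon>)
        have "K \<epsilon> powr (1/\<beta>) * K \<epsilon> powr (-1/\<beta>) = 1"
          using K[OF elim] by (simp flip: powr_add)
        then show ?case by (simp add: mult.assoc)
      qed
    qed auto
  qed
  have "((\<lambda>\<epsilon>. (\<epsilon>\<^sup>2 * K \<epsilon> powr (-(2 + 1/\<beta>))) powr (1/(2 * \<beta> + 1)) * (?D \<epsilon> * K \<epsilon> powr (1/\<beta>))) \<longlongrightarrow>
     ((2 * \<beta> + 1) / A) powr (1/(2 * \<beta> + 1)) * A) (at_right 0)"
    using A b by (intro tendsto_mult tendsto_powr E D tendsto_const) auto
  also have "((2 * \<beta> + 1) / A) powr (1/(2 * \<beta> + 1)) * A
      = (2 * \<beta> + 1) powr (1 / (2 * \<beta> + 1)) * A powr (2 * \<beta> / (2 * \<beta> + 1))"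
  proof -
    have "2 * \<beta> / (2 * \<beta> + 1) = 1 - 1 / (2 * \<beta> + 1)" using b by (simp add: field_simps)
    then have "A powr (2 * \<beta> / (2 * \<beta> + 1)) = A / A powr (1 / (2 * \<beta> + 1))"
      using A by (simp add: powr_diff)
    then show ?thesis using A b by (simp add: powr_divide)
  qed
  finally show "((\<lambda>\<epsilon>. \<epsilon>\<^sup>2 * ?D \<epsilon> / \<epsilon> powr (4 * \<beta> / (2 * \<beta> + 1))) \<longlongrightarrow>
      (2 * \<beta> + 1) powr (1 / (2 * \<beta> + 1)) * (\<beta> * T / (\<beta> + 1)) powr (2 * \<beta> / (2 * \<beta> + 1))) (at_right 0)"
    unfolding A_def[symmetric]
  proof (rule Lim_transform_eventually)
    show "eventually (\<lambda>\<epsilon>. (\<epsilon>\<^sup>2 * K \<epsilon> powr (-(2 + 1/\<beta>))) powr (1/(2 * \<beta> + 1)) * (?D \<epsilon> * K \<epsilon> powr (1/\<beta>))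
       = \<epsilon>\<^sup>2 * ?D \<epsilon> / \<epsilon> powr (4 * \<beta> / (2 * \<beta> + 1))) (at_right 0)"
      using eventually_at_right_less[of 0]
    proof eventually_elim
      case (elim \<epsilon>)
      have "(K \<epsilon> powr (-(2 + 1/\<beta>))) powr (1/(2 * \<beta> + 1)) = K \<epsilon> powr (-(1/\<beta>))"
        using b by (simp add: powr_powr field_simps)
      moreover have "(\<epsilon>\<^sup>2) powr (1/(2 * \<beta> + 1)) = \<epsilon>\<^sup>2 / \<epsilon> powr (4 * \<beta> / (2 * \<beta> + 1))"
      proof -
        have "\<epsilon>\<^sup>2 = \<epsilon> powr 2" using elim by simp
        moreover have "2 * (1/(2 * \<beta> + 1)) = 2 - 4 * \<beta> / (2 * \<beta> + 1)" using b by (simp add: field_simps)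
        ultimately show ?thesis by (simp only: powr_powr powr_diff)
      qed
      moreover have "K \<epsilon> powr (-(1/\<beta>)) * K \<epsilon> powr (1/\<beta>) = 1"
        using K[OF elim] by (simp flip: powr_add)
      ultimately show ?case by (simp add: powr_mult)
    qed
  qed
qed

section \<open>Mean squared error under a truncated Gaussian prior\<close>

definition gauss :: "real \<Rightarrow> real measure" where
  "gauss s = density lborel (\<lambda>x. ennreal (normal_density 0 s x))"

lemma sets_gauss [simp, measurable_cong]: "sets (gauss s) = sets borel"
  and space_gauss [simp]: "space (gauss s) = UNIV"
  by (simp_all add: gauss_def)

lemma prob_space_gauss: "s > 0 \<Longrightarrow> prob_space (gauss s)"
  unfolding gauss_def by (rule prob_space_normal_density)

lemma nn_integral_gauss:
  assumes [measurable]: "f \<in> borel_measurable borel"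
  shows "(\<integral>\<^sup>+x. f x \<partial>gauss s) = (\<integral>\<^sup>+x. ennreal (normal_density 0 s x) * f x \<partial>lborel)"
  unfolding gauss_def by (subst nn_integral_density) simp_all

lemma nn_integral_gauss_affine:
  assumes [measurable]: "f \<in> borel_measurable borel" and "\<sigma> > 0"
  shows "(\<integral>\<^sup>+z. f (x + \<sigma> * z) \<partial>gauss 1) = (\<integral>\<^sup>+y. ennreal (normal_density x \<sigma> y) * f y \<partial>lborel)"
proof -
  have *: "\<sigma> * normal_density x \<sigma> (x + \<sigma> * z) = normal_density 0 1 z" for z
    using assms(2) by (simp add: normal_density_def real_sqrt_mult power_mult_distrib)
  have "(\<integral>\<^sup>+y. ennreal (normal_density x \<sigma> y) * f y \<partial>lborel) =
      \<bar>\<sigma>\<bar> * (\<integral>\<^sup>+z. ennreal (normal_density x \<sigma> (x + \<sigma> * z)) * f (x + \<sigma> * z) \<partial>lborel)"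
    using assms(2) by (intro nn_integral_real_affine) auto
  also have "\<dots> = (\<integral>\<^sup>+z. ennreal \<sigma> * (ennreal (normal_density x \<sigma> (x + \<sigma> * z)) * f (x + \<sigma> * z)) \<partial>lborel)"
    using assms(2) by (subst nn_integral_cmult) auto
  also have "\<dots> = (\<integral>\<^sup>+z. ennreal (normal_density 0 1 z) * f (x + \<sigma> * z) \<partial>lborel)"
    using assms(2) by (simp add: mult.assoc[symmetric] ennreal_mult[symmetric] *)
  also have "\<dots> = (\<integral>\<^sup>+z. f (x + \<sigma> * z) \<partial>gauss 1)"
    by (subst nn_integral_gauss) auto
  finally show ?thesis ..
qed

lemma nn_integral_normal_density:
  assumes "\<sigma> > 0"
  shows "(\<integral>\<^sup>+x. ennreal (normal_density m \<sigma> x) \<partial>lborel) = 1"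
  using assms by (subst nn_integral_eq_integral) auto

text \<open>
  Let \<open>X\<close> be normal with mean \<open>m\<close> and variance \<open>\<sigma>\<^sup>2\<close>, and let \<open>B = (u - m)\<^sup>2 + \<sigma>\<^sup>2\<close> be the second
  moment of \<open>u - X\<close>. Its fourth moment is at most \<open>3 B\<^sup>2\<close>. Hence the part of the second moment that is
  lost on the complement of \<open>A\<close> is at most a small multiple of \<open>B\<close> itself, however far \<open>u\<close> is from
  \<open>m\<close>; this is why the bound is uniform in \<open>u\<close>. The parameter \<open>g\<close> is the weight in the
  arithmetic-geometric mean inequality that replaces Cauchy-Schwarz, which keeps the bound linear in
  the probability of the complement.
\<close>
lemma truncated_square_normal_bound:
  assumes s: "\<sigma> > 0" and g: "g > 0" and A: "A \<in> sets borel"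
  shows "ennreal (\<sigma>\<^sup>2 * (1 - 3 * g / 2)) \<le>
    (\<integral>\<^sup>+x. ennreal (normal_density m \<sigma> x) *
       (indicator A x * ennreal ((u - x)\<^sup>2) + ennreal (\<sigma>\<^sup>2 / (2 * g)) * indicator (- A) x) \<partial>lborel)"
proof -
  let ?d = "normal_density m \<sigma>"
  define a where "a = u - m"
  define B where "B = a\<^sup>2 + \<sigma>\<^sup>2"
  have B: "B > 0" "\<sigma>\<^sup>2 \<le> B" using s by (auto simp: B_def add_nonneg_pos)
  note [measurable] = A
  note linear = Bochner_Integration.integral_add Bochner_Integration.integral_diff
    Bochner_Integration.integrable_add Bochner_Integration.integrable_diff
    integrable_mult_right integral_mult_right_zero
  have i: "integrable lborel (\<lambda>x. ?d x * (x - m) ^ k)" for k using s by (rule integrable_normal_moment)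
  have e2: "(\<lambda>x. ?d x * (u - x)\<^sup>2) = (\<lambda>x. a\<^sup>2 * (?d x * (x - m)^0) - 2 * a * (?d x * (x - m)^1) + ?d x * (x - m)^2)"
    by (auto simp: a_def power2_eq_square algebra_simps fun_eq_iff)
  have e4: "(\<lambda>x. ?d x * (u - x)^4) = (\<lambda>x. a^4 * (?d x * (x - m)^0) - 4 * a^3 * (?d x * (x - m)^1)
      + 6 * a\<^sup>2 * (?d x * (x - m)^2) - 4 * a * (?d x * (x - m)^3) + ?d x * (x - m)^4)"
  proof
    fix x
    have "(u - x)^4 = (a - (x - m))^4" by (simp add: a_def)
    also have "\<dots> = a^4 - 4 * a^3 * (x - m) + 6 * a\<^sup>2 * (x - m)^2 - 4 * a * (x - m)^3 + (x - m)^4"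
      by algebra
    finally show "?d x * (u - x)^4 = a^4 * (?d x * (x - m)^0) - 4 * a^3 * (?d x * (x - m)^1)
      + 6 * a\<^sup>2 * (?d x * (x - m)^2) - 4 * a * (?d x * (x - m)^3) + ?d x * (x - m)^4"
      by (simp only:) (simp add: algebra_simps)
  qed
  have m0: "(LBINT x. ?d x * (x - m)^0) = 1" using s by simp
  have m1: "(LBINT x. ?d x * (x - m)^1) = 0" using integral_normal_moment_odd[OF s, of m 0] by simp
  have m2: "(LBINT x. ?d x * (x - m)^2) = \<sigma>\<^sup>2"
    using integral_normal_moment_even[OF s, of m 1] s by simp
  have m3: "(LBINT x. ?d x * (x - m)^3) = 0" using integral_normal_moment_odd[OF s, of m 1] by (simp add: eval_nat_numeral)
  have m4: "(LBINT x. ?d x * (x - m)^4) = 3 * \<sigma>^4"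
    using integral_normal_moment_even[OF s, of m 2] s
    by (simp add: fact_numeral power_divide eval_nat_numeral field_simps)
  have i2: "integrable lborel (\<lambda>x. ?d x * (u - x)\<^sup>2)" and i4: "integrable lborel (\<lambda>x. ?d x * (u - x)^4)"
    unfolding e2 e4 by (intro Bochner_Integration.integrable_add Bochner_Integration.integrable_diff
        integrable_mult_right i)+
  have v2: "(LBINT x. ?d x * (u - x)\<^sup>2) = B"
    unfolding e2 by (simp only: linear i m0 m1 m2) (simp add: B_def)
  have "(LBINT x. ?d x * (u - x)^4) = a^4 + 6 * a\<^sup>2 * \<sigma>\<^sup>2 + 3 * \<sigma>^4"
    unfolding e4 by (simp only: linear i m0 m1 m2 m3 m4)
  also have "\<dots> \<le> 3 * B\<^sup>2"
  proof -
    have "3 * B\<^sup>2 = a^4 + 6 * a\<^sup>2 * \<sigma>\<^sup>2 + 3 * \<sigma>^4 + 2 * (a\<^sup>2)\<^sup>2"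
      unfolding B_def by algebra
    then show ?thesis by simp
  qed
  finally have v4: "(LBINT x. ?d x * (u - x)^4) \<le> 3 * B\<^sup>2" .
  have iA: "integrable lborel (\<lambda>x. ?d x * (indicator A x * (u - x)\<^sup>2))"
    using integrable_mult_indicator[OF _ i2, of A] by (simp add: mult_ac)
  have iC: "integrable lborel (\<lambda>x. ?d x * indicator (- A) x)"
    using integrable_mult_indicator[OF _ integrable_normal_density[OF s], of "- A" m] by (simp add: mult_ac)
  define q where "q = (LBINT x. ?d x * indicator (- A) x)"
  define I where "I = (LBINT x. ?d x * (indicator A x * (u - x)\<^sup>2))"
  have q0: "q \<ge> 0" and I0: "I \<ge> 0" unfolding q_def I_def
    by (intro integral_nonneg_AE AE_I2; simp)+
  \<comment> \<open>Off \<open>A\<close>, use \<open>y\<^sup>2 \<le> g y\<^sup>4 / (2 B) + B / (2 g)\<close> with \<open>y = u - x\<close>.\<close>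
  have pw: "?d x * (u - x)\<^sup>2 \<le> ?d x * (indicator A x * (u - x)\<^sup>2) + g / (2 * B) * (?d x * (u - x)^4)
      + B / (2 * g) * (?d x * indicator (- A) x)" for x
  proof -
    have "(u - x)\<^sup>2 \<le> g / (2 * B) * (u - x)^4 + B / (2 * g)"
    proof -
      have "0 \<le> (g * (u - x)\<^sup>2 - B)\<^sup>2 / (2 * g * B)" using B g by simp
      also have "\<dots> = g / (2 * B) * (u - x)^4 + B / (2 * g) - (u - x)\<^sup>2"
        using B(1) g by (simp add: field_simps power2_eq_square eval_nat_numeral)
      finally show ?thesis by simp
    qed
    moreover have "0 \<le> g / (2 * B) * (u - x)^4" using B g by simp
    ultimately have "(u - x)\<^sup>2 \<le> indicator A x * (u - x)\<^sup>2 + g / (2 * B) * (u - x)^4 + B / (2 * g) * indicator (- A) x"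
      by (auto simp: indicator_def)
    from mult_left_mono[OF this, of "?d x"] show ?thesis
      by (simp add: distrib_left mult_ac)
  qed
  have "B \<le> I + g / (2 * B) * (LBINT x. ?d x * (u - x)^4) + B / (2 * g) * q"
  proof -
    have "B \<le> (LBINT x. ?d x * (indicator A x * (u - x)\<^sup>2) + g / (2 * B) * (?d x * (u - x)^4)
      + B / (2 * g) * (?d x * indicator (- A) x))"
      by (subst v2[symmetric], intro integral_mono i2 Bochner_Integration.integrable_add integrable_mult_right iA i4 iC pw)
    also have "\<dots> = I + g / (2 * B) * (LBINT x. ?d x * (u - x)^4) + B / (2 * g) * q"
      by (simp only: linear iA i4 iC I_def q_def)
    finally show ?thesis .
  qed
  also have "g / (2 * B) * (LBINT x. ?d x * (u - x)^4) \<le> g / (2 * B) * (3 * B\<^sup>2)"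
    using v4 B g by (intro mult_left_mono) auto
  also have "g / (2 * B) * (3 * B\<^sup>2) = B * (3 * g / 2)" using B by (simp add: power2_eq_square)
  finally have main: "B * (1 - 3 * g / 2 - q / (2 * g)) \<le> I" by (simp add: algebra_simps)
  \<comment> \<open>Replacing \<open>B\<close> by the smaller \<open>\<sigma>\<^sup>2\<close> needs a nonnegative bracket; otherwise the claim is trivial.\<close>
  have "\<sigma>\<^sup>2 * (1 - 3 * g / 2) \<le> I + \<sigma>\<^sup>2 / (2 * g) * q"
  proof (cases "1 - 3 * g / 2 - q / (2 * g) \<ge> 0")
    case True
    then have "\<sigma>\<^sup>2 * (1 - 3 * g / 2 - q / (2 * g)) \<le> I"
      using main B by (meson mult_right_mono order_trans)
    then show ?thesis by (simp add: algebra_simps)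
  next
    case False
    then have "\<sigma>\<^sup>2 * (1 - 3 * g / 2 - q / (2 * g)) \<le> 0" by (simp add: mult_le_0_iff)
    then show ?thesis using I0 by (simp add: algebra_simps)
  qed
  also have "I + \<sigma>\<^sup>2 / (2 * g) * q = (LBINT x. ?d x * (indicator A x * (u - x)\<^sup>2 + \<sigma>\<^sup>2 / (2 * g) * indicator (- A) x))"
  proof -
    have "(\<lambda>x. ?d x * (indicator A x * (u - x)\<^sup>2 + \<sigma>\<^sup>2 / (2 * g) * indicator (- A) x)) =
      (\<lambda>x. ?d x * (indicator A x * (u - x)\<^sup>2) + \<sigma>\<^sup>2 / (2 * g) * (?d x * indicator (- A) x))"
      by (simp add: fun_eq_iff distrib_left mult_ac)
    then show ?thesis unfolding I_def q_def
      by (simp only: linear iA iC)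
  qed
  finally have "ennreal (\<sigma>\<^sup>2 * (1 - 3 * g / 2)) \<le>
      ennreal (LBINT x. ?d x * (indicator A x * (u - x)\<^sup>2 + \<sigma>\<^sup>2 / (2 * g) * indicator (- A) x))"
    by (rule ennreal_leI)
  also have "\<dots> = (\<integral>\<^sup>+x. ennreal (?d x * (indicator A x * (u - x)\<^sup>2 + \<sigma>\<^sup>2 / (2 * g) * indicator (- A) x)) \<partial>lborel)"
  proof (rule nn_integral_eq_integral[symmetric])
    show "integrable lborel (\<lambda>x. ?d x * (indicator A x * (u - x)\<^sup>2 + \<sigma>\<^sup>2 / (2 * g) * indicator (- A) x))"
      using Bochner_Integration.integrable_add[OF iA integrable_mult_right[OF iC, of "\<sigma>\<^sup>2 / (2 * g)"]]
      by (simp add: distrib_left mult_ac)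
  qed (use g in auto)
  also have "\<dots> = (\<integral>\<^sup>+x. ennreal (?d x) *
       (indicator A x * ennreal ((u - x)\<^sup>2) + ennreal (\<sigma>\<^sup>2 / (2 * g)) * indicator (- A) x) \<partial>lborel)"
    using g by (intro nn_integral_cong) (auto simp: ennreal_mult indicator_def)
  finally show ?thesis .
qed

text \<open>
  Bayes' formula for the Gaussian location model: prior times likelihood is marginal times posterior.
\<close>
lemma normal_density_bayes:
  assumes "s > 0" "\<sigma> > 0"
  shows "normal_density 0 s x * normal_density x \<sigma> y =
    normal_density 0 (sqrt (s\<^sup>2 + \<sigma>\<^sup>2)) y *
    normal_density (s\<^sup>2 / (s\<^sup>2 + \<sigma>\<^sup>2) * y) (sqrt (s\<^sup>2 * \<sigma>\<^sup>2 / (s\<^sup>2 + \<sigma>\<^sup>2))) x"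
proof -
  define S where "S = s\<^sup>2 + \<sigma>\<^sup>2"
  have S: "S > 0" using assms by (simp add: S_def add_pos_pos)
  have v: "s\<^sup>2 * \<sigma>\<^sup>2 / S > 0" using assms S by simp
  have c: "sqrt (2 * pi * s\<^sup>2) * sqrt (2 * pi * \<sigma>\<^sup>2) = sqrt (2 * pi * S) * sqrt (2 * pi * (s\<^sup>2 * \<sigma>\<^sup>2 / S))"
    using S by (simp add: real_sqrt_mult[symmetric] field_simps)
  have e: "- (x - 0)\<^sup>2 / (2 * s\<^sup>2) + - (y - x)\<^sup>2 / (2 * \<sigma>\<^sup>2)
     = - (y - 0)\<^sup>2 / (2 * S) + - (x - s\<^sup>2 / S * y)\<^sup>2 / (2 * (s\<^sup>2 * \<sigma>\<^sup>2 / S))"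
  proof -
    have "(x - s\<^sup>2 / S * y)\<^sup>2 / (2 * (s\<^sup>2 * \<sigma>\<^sup>2 / S)) = (S * x - s\<^sup>2 * y)\<^sup>2 / (2 * S * s\<^sup>2 * \<sigma>\<^sup>2)"
    proof -
      have "x - s\<^sup>2 / S * y = (S * x - s\<^sup>2 * y) / S" using S by (simp add: field_simps)
      then show ?thesis using S assms by (simp add: power_divide power2_eq_square)
    qed
    moreover have "x\<^sup>2 / (2 * s\<^sup>2) + (y - x)\<^sup>2 / (2 * \<sigma>\<^sup>2) = y\<^sup>2 / (2 * S) + (S * x - s\<^sup>2 * y)\<^sup>2 / (2 * S * s\<^sup>2 * \<sigma>\<^sup>2)"
    proof -
      have "S * (x\<^sup>2 * \<sigma>\<^sup>2 + (y - x)\<^sup>2 * s\<^sup>2) = y\<^sup>2 * s\<^sup>2 * \<sigma>\<^sup>2 + (S * x - s\<^sup>2 * y)\<^sup>2"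
        unfolding S_def by algebra
      then have "(x\<^sup>2 * \<sigma>\<^sup>2 + (y - x)\<^sup>2 * s\<^sup>2) / (2 * s\<^sup>2 * \<sigma>\<^sup>2) = (y\<^sup>2 * s\<^sup>2 * \<sigma>\<^sup>2 + (S * x - s\<^sup>2 * y)\<^sup>2) / (2 * S * s\<^sup>2 * \<sigma>\<^sup>2)"
        using S assms by (simp add: divide_simps) algebra
      then show ?thesis using S assms by (simp add: add_divide_distrib)
    qed
    ultimately show ?thesis by simp
  qed
  show ?thesis
    unfolding S_def[symmetric] normal_density_def real_sqrt_pow2[OF less_imp_le[OF S]] real_sqrt_pow2[OF less_imp_le[OF v]]
    using arg_cong[OF e, of exp] c by (simp only: exp_add) (simp add: field_simps)
qed

text \<open>
  Conditionally on the observation \<open>y = x + \<sigma> z\<close> the value \<open>T y\<close> is a constant and \<open>x\<close> is normal with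
  variance \<open>v\<close>, so the preceding bound applies for each \<open>y\<close>. The integral over \<open>y\<close> is then trivial,
  because the error term is linear in the posterior probability of the complement of \<open>A\<close>.
\<close>
lemma truncated_gaussian_bayes_risk:
  assumes s: "s > 0" and \<sigma>: "\<sigma> > 0" and g: "g > 0"
    and A[measurable]: "A \<in> sets borel" and T[measurable]: "T \<in> borel_measurable borel"
  defines "v \<equiv> s\<^sup>2 * \<sigma>\<^sup>2 / (s\<^sup>2 + \<sigma>\<^sup>2)"
  shows "ennreal (v * (1 - 3 * g / 2)) \<le>
    (\<integral>\<^sup>+x. (\<integral>\<^sup>+z. indicator A x * ennreal ((T (x + \<sigma> * z) - x)\<^sup>2) \<partial>gauss 1) \<partial>gauss s)
    + ennreal (v / (2 * g)) * emeasure (gauss s) (- A)"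
proof -
  have S: "s\<^sup>2 + \<sigma>\<^sup>2 > 0" using s by (simp add: add_pos_nonneg)
  have v: "v > 0" using s \<sigma> S by (simp add: v_def)
  define G where "G = (\<lambda>x y. indicator A x * ennreal ((T y - x)\<^sup>2) + ennreal (v / (2 * g)) * indicator (- A) x)"
  have [measurable]: "case_prod G \<in> borel_measurable (borel \<Otimes>\<^sub>M borel)"
    unfolding G_def by measurable
  let ?t = "sqrt (s\<^sup>2 + \<sigma>\<^sup>2)" and ?m = "\<lambda>y. s\<^sup>2 / (s\<^sup>2 + \<sigma>\<^sup>2) * y"
  have "ennreal (v * (1 - 3 * g / 2)) = (\<integral>\<^sup>+y. ennreal (v * (1 - 3 * g / 2)) * ennreal (normal_density 0 ?t y) \<partial>lborel)"
    using S by (subst nn_integral_cmult) (auto simp: nn_integral_normal_density)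
  also have "\<dots> \<le> (\<integral>\<^sup>+y. (\<integral>\<^sup>+x. ennreal (normal_density (?m y) (sqrt v) x) * G x y \<partial>lborel) * ennreal (normal_density 0 ?t y) \<partial>lborel)"
    using truncated_square_normal_bound[of "sqrt v" g A] v g
    by (intro nn_integral_mono mult_right_mono) (auto simp: G_def)
  also have "\<dots> = (\<integral>\<^sup>+y. (\<integral>\<^sup>+x. ennreal (normal_density 0 s x) * (ennreal (normal_density x \<sigma> y) * G x y) \<partial>lborel) \<partial>lborel)"
  proof (intro nn_integral_cong)
    fix y
    have "(\<integral>\<^sup>+x. ennreal (normal_density (?m y) (sqrt v) x) * G x y \<partial>lborel) * ennreal (normal_density 0 ?t y)
      = (\<integral>\<^sup>+x. ennreal (normal_density (?m y) (sqrt v) x) * G x y * ennreal (normal_density 0 ?t y) \<partial>lborel)"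
      by (subst nn_integral_multc) auto
    also have "\<dots> = (\<integral>\<^sup>+x. ennreal (normal_density 0 s x) * (ennreal (normal_density x \<sigma> y) * G x y) \<partial>lborel)"
    proof (intro nn_integral_cong)
      fix x
      have "ennreal (normal_density (?m y) (sqrt v) x) * ennreal (normal_density 0 ?t y)
         = ennreal (normal_density 0 s x) * ennreal (normal_density x \<sigma> y)"
        using normal_density_bayes[OF s \<sigma>, of x y] by (simp add: ennreal_mult[symmetric] v_def mult.commute)
      then show "ennreal (normal_density (?m y) (sqrt v) x) * G x y * ennreal (normal_density 0 ?t y)
          = ennreal (normal_density 0 s x) * (ennreal (normal_density x \<sigma> y) * G x y)"
        by (metis mult.assoc mult.commute)
    qed
    finally show "(\<integral>\<^sup>+x. ennreal (normal_density (?m y) (sqrt v) x) * G x y \<partial>lborel) * ennreal (normal_density 0 ?t y)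
      = (\<integral>\<^sup>+x. ennreal (normal_density 0 s x) * (ennreal (normal_density x \<sigma> y) * G x y) \<partial>lborel)" .
  qed
  also have "\<dots> = (\<integral>\<^sup>+x. (\<integral>\<^sup>+y. ennreal (normal_density 0 s x) * (ennreal (normal_density x \<sigma> y) * G x y) \<partial>lborel) \<partial>lborel)"
    unfolding normal_density_def by (rule lborel_pair.Fubini') measurable
  also have "\<dots> = (\<integral>\<^sup>+x. ennreal (normal_density 0 s x) * (\<integral>\<^sup>+y. ennreal (normal_density x \<sigma> y) * G x y \<partial>lborel) \<partial>lborel)"
    by (intro nn_integral_cong nn_integral_cmult) measurable
  also have "\<dots> = (\<integral>\<^sup>+x. (\<integral>\<^sup>+y. ennreal (normal_density x \<sigma> y) * G x y \<partial>lborel) \<partial>gauss s)"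
    unfolding normal_density_def[of _ \<sigma>] by (subst nn_integral_gauss) measurable
  also have "\<dots> = (\<integral>\<^sup>+x. (\<integral>\<^sup>+z. G x (x + \<sigma> * z) \<partial>gauss 1) \<partial>gauss s)"
    by (intro nn_integral_cong nn_integral_gauss_affine[symmetric] \<sigma>) measurable
  also have "\<dots> = (\<integral>\<^sup>+x. (\<integral>\<^sup>+z. indicator A x * ennreal ((T (x + \<sigma> * z) - x)\<^sup>2) \<partial>gauss 1)
      + ennreal (v / (2 * g)) * indicator (- A) x \<partial>gauss s)"
  proof (intro nn_integral_cong)
    fix x
    interpret prob_space "gauss 1" by (rule prob_space_gauss) simp
    show "(\<integral>\<^sup>+z. G x (x + \<sigma> * z) \<partial>gauss 1) = (\<integral>\<^sup>+z. indicator A x * ennreal ((T (x + \<sigma> * z) - x)\<^sup>2) \<partial>gauss 1)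
      + ennreal (v / (2 * g)) * indicator (- A) x"
      unfolding G_def by (subst nn_integral_add) (auto simp: emeasure_space_1[simplified])
  qed
  also have "\<dots> = (\<integral>\<^sup>+x. (\<integral>\<^sup>+z. indicator A x * ennreal ((T (x + \<sigma> * z) - x)\<^sup>2) \<partial>gauss 1) \<partial>gauss s)
    + ennreal (v / (2 * g)) * emeasure (gauss s) (- A)"
  proof -
    interpret prob_space "gauss 1" by (rule prob_space_gauss) simp
    show ?thesis
      by (subst nn_integral_add) (auto simp: nn_integral_cmult)
  qed
  finally show ?thesis .
qed

section \<open>Resampling one direction of a Gaussian vector\<close>

lemma mvn_std_density_shift:
  fixes u x :: "real^'p"
  assumes "norm u = 1"
  shows "mvn_std_density (x - z *\<^sub>R u) * normal_density 0 1 (u \<bullet> x) = mvn_std_density x * normal_density (u \<bullet> x) 1 z"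
proof -
  have "u \<bullet> u = 1" using assms by (simp add: norm_eq_1)
  then have "- ((x - z *\<^sub>R u) \<bullet> (x - z *\<^sub>R u)) / 2 + - (u \<bullet> x - 0)\<^sup>2 / (2 * 1\<^sup>2) = - (x \<bullet> x) / 2 + - (z - u \<bullet> x)\<^sup>2 / (2 * 1\<^sup>2)"
    by (simp add: inner_diff_left inner_diff_right inner_commute power2_eq_square field_simps)
  then have "exp (- ((x - z *\<^sub>R u) \<bullet> (x - z *\<^sub>R u)) / 2) * exp (- (u \<bullet> x - 0)\<^sup>2 / (2 * 1\<^sup>2)) = exp (- (x \<bullet> x) / 2) * exp (- (z - u \<bullet> x)\<^sup>2 / (2 * 1\<^sup>2))"
    by (simp only: exp_add[symmetric])
  then show ?thesis
    unfolding mvn_std_density_def normal_density_def by (simp only: mult_ac)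
qed

lemma mvn_std_density_nonneg [simp]: "mvn_std_density x \<ge> 0"
  by (simp add: mvn_std_density_def)

lemma borel_measurable_mvn_std_density [measurable]: "mvn_std_density \<in> borel_measurable borel"
  unfolding mvn_std_density_def by measurable

definition mvn_std :: "(real^'p) measure" where
  "mvn_std = density lborel (\<lambda>x. ennreal (mvn_std_density x))"

lemma sets_mvn_std [simp, measurable_cong]: "sets mvn_std = sets borel"
  and space_mvn_std [simp]: "space mvn_std = UNIV"
  by (simp_all add: mvn_std_def)

lemma nn_integral_mvn_std:
  assumes [measurable]: "f \<in> borel_measurable borel"
  shows "(\<integral>\<^sup>+x. f x \<partial>mvn_std) = (\<integral>\<^sup>+x. ennreal (mvn_std_density x) * f x \<partial>lborel)"
  unfolding mvn_std_def by (subst nn_integral_density) simp_all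

lemma nn_integral_lborel_translate:
  fixes f :: "'b::euclidean_space \<Rightarrow> ennreal"
  assumes [measurable]: "f \<in> borel_measurable borel"
  shows "(\<integral>\<^sup>+x. f (c + x) \<partial>lborel) = (\<integral>\<^sup>+x. f x \<partial>lborel)"
  by (subst (2) lborel_distr_plus[of c, symmetric]) (simp add: nn_integral_distr)

text \<open>
  Replacing the component of a standard Gaussian vector along a unit vector \<open>u\<close> by a fresh standard
  normal variable does not change its law. After the translations \<open>z \<mapsto> z + u \<bullet> x\<close> and then
  \<open>x \<mapsto> x - z u\<close> the function \<open>f\<close> is evaluated at \<open>x\<close> alone, and the remaining integral over \<open>z\<close> is that
  of a normal density, by \<open>mvn_std_density_shift\<close>.
\<close>
lemma mvn_std_resample_direction:
  fixes u :: "real^'p" and f :: "real^'p \<Rightarrow> ennreal"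
  assumes u: "norm u = 1" and f[measurable]: "f \<in> borel_measurable borel"
  shows "(\<integral>\<^sup>+x. (\<integral>\<^sup>+z. f (x + (z - u \<bullet> x) *\<^sub>R u) \<partial>gauss 1) \<partial>mvn_std) = (\<integral>\<^sup>+x. f x \<partial>mvn_std)"
proof -
  let ?p = "\<lambda>x. ennreal (mvn_std_density x)" and ?n = "\<lambda>z. ennreal (normal_density 0 1 z)"
  have psf: "pair_sigma_finite (lborel :: real measure) (lborel :: (real^'p) measure)" ..
  have psf': "pair_sigma_finite (lborel :: (real^'p) measure) (lborel :: real measure)" ..
  have "(\<integral>\<^sup>+z. f (x + (z - u \<bullet> x) *\<^sub>R u) \<partial>gauss 1) = (\<integral>\<^sup>+z. ?n (u \<bullet> x + z) * f (x + z *\<^sub>R u) \<partial>lborel)" for x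
    using nn_integral_lborel_translate[of "\<lambda>z. ?n z * f (x + (z - u \<bullet> x) *\<^sub>R u)" "u \<bullet> x"]
    by (subst nn_integral_gauss) simp_all
  then have "(\<integral>\<^sup>+x. (\<integral>\<^sup>+z. f (x + (z - u \<bullet> x) *\<^sub>R u) \<partial>gauss 1) \<partial>mvn_std)
    = (\<integral>\<^sup>+x. (\<integral>\<^sup>+z. ?n (u \<bullet> x + z) * f (x + z *\<^sub>R u) \<partial>lborel) \<partial>mvn_std)"
    by simp
  also have "\<dots> = (\<integral>\<^sup>+x. (\<integral>\<^sup>+z. ?p x * (?n (u \<bullet> x + z) * f (x + z *\<^sub>R u)) \<partial>lborel) \<partial>lborel)"
    by (subst nn_integral_mvn_std) (simp_all add: nn_integral_cmult)
  also have "\<dots> = (\<integral>\<^sup>+z. (\<integral>\<^sup>+x. ?p x * (?n (u \<bullet> x + z) * f (x + z *\<^sub>R u)) \<partial>lborel) \<partial>lborel)"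
    by (rule pair_sigma_finite.Fubini'[OF psf]) measurable
  also have "\<dots> = (\<integral>\<^sup>+z. (\<integral>\<^sup>+x. ?p (x - z *\<^sub>R u) * (?n (u \<bullet> x) * f x) \<partial>lborel) \<partial>lborel)"
  proof (rule nn_integral_cong)
    fix z
    have "u \<bullet> u = 1" using u by (simp add: norm_eq_1)
    then show "(\<integral>\<^sup>+x. ?p x * (?n (u \<bullet> x + z) * f (x + z *\<^sub>R u)) \<partial>lborel) = (\<integral>\<^sup>+x. ?p (x - z *\<^sub>R u) * (?n (u \<bullet> x) * f x) \<partial>lborel)"
      using nn_integral_lborel_translate[of "\<lambda>x. ?p x * (?n (u \<bullet> x + z) * f (x + z *\<^sub>R u))" "- z *\<^sub>R u"]
      by (simp add: inner_diff_right)
  qed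
  also have "\<dots> = (\<integral>\<^sup>+x. (\<integral>\<^sup>+z. ?p (x - z *\<^sub>R u) * (?n (u \<bullet> x) * f x) \<partial>lborel) \<partial>lborel)"
    by (rule pair_sigma_finite.Fubini'[OF psf']) measurable
  also have "\<dots> = (\<integral>\<^sup>+x. (\<integral>\<^sup>+z. ?p x * f x * ennreal (normal_density (u \<bullet> x) 1 z) \<partial>lborel) \<partial>lborel)"
  proof (intro nn_integral_cong)
    fix x z
    have "?p (x - z *\<^sub>R u) * ?n (u \<bullet> x) = ?p x * ennreal (normal_density (u \<bullet> x) 1 z)"
      using mvn_std_density_shift[OF u, of x z] by (simp add: ennreal_mult[symmetric])
    then show "?p (x - z *\<^sub>R u) * (?n (u \<bullet> x) * f x) = ?p x * f x * ennreal (normal_density (u \<bullet> x) 1 z)"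
      by (metis mult.assoc mult.commute)
  qed
  also have "\<dots> = (\<integral>\<^sup>+x. ?p x * f x \<partial>lborel)"
    by (intro nn_integral_cong) (simp add: nn_integral_cmult nn_integral_normal_density)
  also have "\<dots> = (\<integral>\<^sup>+x. f x \<partial>mvn_std)"
    by (simp add: nn_integral_mvn_std)
  finally show ?thesis .
qed

lemma mvn_std_marginal:
  fixes u :: "real^'p" and f :: "real \<Rightarrow> ennreal"
  assumes p: "prob_space (mvn_std :: (real^'p) measure)" and u: "norm u = 1" and f[measurable]: "f \<in> borel_measurable borel"
  shows "(\<integral>\<^sup>+x. f (u \<bullet> x) \<partial>mvn_std) = (\<integral>\<^sup>+z. f z \<partial>gauss 1)"
proof -
  interpret prob_space "mvn_std :: (real^'p) measure" by fact
  have "u \<bullet> u = 1" using u by (simp add: norm_eq_1)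
  then have "(\<integral>\<^sup>+x. f (u \<bullet> x) \<partial>mvn_std) = integral\<^sup>N mvn_std (\<lambda>x::real^'p. \<integral>\<^sup>+z. f z \<partial>gauss 1)"
    by (subst mvn_std_resample_direction[OF u, symmetric]) (simp_all add: inner_add_right)
  also have "\<dots> = (\<integral>\<^sup>+z. f z \<partial>gauss 1)" by (simp add: emeasure_space_1[simplified])
  finally show ?thesis .
qed

lemma nn_integral_gauss_square_affine:
  "(\<integral>\<^sup>+z. ennreal ((a * z + b)\<^sup>2) \<partial>gauss 1) = ennreal (a\<^sup>2 + b\<^sup>2)"
proof -
  let ?d = "normal_density 0 1"
  have i: "integrable lborel (\<lambda>x. ?d x * (x - 0) ^ k)" for k by (rule integrable_normal_moment) simp
  have e: "(\<lambda>x. ?d x * (a * x + b)\<^sup>2) = (\<lambda>x. a\<^sup>2 * (?d x * (x - 0)^2) + 2 * a * b * (?d x * (x - 0)^1) + b\<^sup>2 * (?d x * (x - 0)^0))"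
    by (auto simp: power2_eq_square algebra_simps fun_eq_iff)
  have m: "(LBINT x. ?d x * (x - 0)^0) = 1" "(LBINT x. ?d x * (x - 0)^1) = 0" "(LBINT x. ?d x * (x - 0)^2) = 1"
    using integral_normal_moment_odd[of 1 0 0] integral_normal_moment_even[of 1 0 1] by simp_all
  have "(\<integral>\<^sup>+z. ennreal ((a * z + b)\<^sup>2) \<partial>gauss 1) = (\<integral>\<^sup>+z. ennreal (?d z * (a * z + b)\<^sup>2) \<partial>lborel)"
    by (subst nn_integral_gauss) (simp_all add: ennreal_mult)
  also have "\<dots> = ennreal (LBINT z. ?d z * (a * z + b)\<^sup>2)"
  proof (rule nn_integral_eq_integral)
    show "integrable lborel (\<lambda>z. ?d z * (a * z + b)\<^sup>2)"
      unfolding e by (intro Bochner_Integration.integrable_add integrable_mult_right i)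
  qed simp
  also have "(LBINT z. ?d z * (a * z + b)\<^sup>2) = a\<^sup>2 + b\<^sup>2"
    unfolding e by (simp only: Bochner_Integration.integral_add Bochner_Integration.integrable_add
        integrable_mult_right i integral_mult_right_zero m)
  finally show ?thesis .
qed

section \<open>Tails of Gaussian quadratic forms\<close>

text \<open>
  The integrand is a multiple of the centred normal density with variance \<open>s\<^sup>2 / (1 - 2 t s\<^sup>2)\<close>.
\<close>
lemma nn_integral_gauss_exp_square:
  assumes s: "s > 0" and t: "2 * t * s\<^sup>2 < 1"
  shows "(\<integral>\<^sup>+x. ennreal (exp (t * x\<^sup>2)) \<partial>gauss s) = ennreal (1 / sqrt (1 - 2 * t * s\<^sup>2))"
proof -
  define r where "r = 1 - 2 * t * s\<^sup>2"
  have r: "r > 0" using t by (simp add: r_def)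
  have "normal_density 0 s x * exp (t * x\<^sup>2) = 1 / sqrt r * normal_density 0 (s / sqrt r) x" for x
  proof -
    have "- (x - 0)\<^sup>2 / (2 * s\<^sup>2) + t * x\<^sup>2 = - (x - 0)\<^sup>2 / (2 * (s / sqrt r)\<^sup>2)"
    proof -
      have "- (x - 0)\<^sup>2 / (2 * (s / sqrt r)\<^sup>2) = - (x\<^sup>2 * r) / (2 * s\<^sup>2)"
        using r by (simp add: power_divide)
      also have "\<dots> = - (x - 0)\<^sup>2 / (2 * s\<^sup>2) + t * x\<^sup>2"
        using s by (simp add: r_def right_diff_distrib diff_divide_distrib add_divide_distrib)
      finally show ?thesis ..
    qed
    then have "exp (- (x - 0)\<^sup>2 / (2 * s\<^sup>2)) * exp (t * x\<^sup>2) = exp (- (x - 0)\<^sup>2 / (2 * (s / sqrt r)\<^sup>2))"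
      by (simp only: exp_add[symmetric])
    moreover have "sqrt (2 * pi * (s / sqrt r)\<^sup>2) = sqrt (2 * pi * s\<^sup>2) / sqrt r"
      using s r by (simp add: real_sqrt_mult real_sqrt_divide power_divide)
    ultimately show ?thesis using r
      unfolding normal_density_def by (simp add: mult.assoc)
  qed
  then have "(\<integral>\<^sup>+x. ennreal (exp (t * x\<^sup>2)) \<partial>gauss s) = (\<integral>\<^sup>+x. ennreal (1 / sqrt r) * ennreal (normal_density 0 (s / sqrt r) x) \<partial>lborel)"
    using r by (subst nn_integral_gauss) (simp_all add: ennreal_mult[symmetric])
  also have "\<dots> = ennreal (1 / sqrt r)"
    using s r by (simp add: nn_integral_cmult nn_integral_normal_density)
  finally show ?thesis by (simp add: r_def)
qed

lemma inverse_sqrt_le_exp: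
  fixes a :: real
  assumes "0 \<le> a" "a \<le> 1/4"
  shows "1 / sqrt (1 - 2 * a) \<le> exp (a + 4 * a\<^sup>2)"
proof -
  have "- (2 * a) - 2 * (2 * a)\<^sup>2 \<le> ln (1 - 2 * a)"
    using assms by (intro ln_one_minus_pos_lower_bound) auto
  then have "exp (- (2 * a) - 2 * (2 * a)\<^sup>2) \<le> 1 - 2 * a"
    using assms by (subst ln_ge_iff[symmetric]) auto
  moreover have "(exp (- (a + 4 * a\<^sup>2)))\<^sup>2 = exp (- (2 * a) - 2 * (2 * a)\<^sup>2)"
    by (simp add: power2_eq_square flip: exp_add)
  ultimately have "exp (- (a + 4 * a\<^sup>2)) \<le> sqrt (1 - 2 * a)"
    by (intro real_le_rsqrt) simp
  moreover have "sqrt (1 - 2 * a) > 0" using assms by simp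
  ultimately have "1 / sqrt (1 - 2 * a) \<le> 1 / exp (- (a + 4 * a\<^sup>2))"
    by (intro divide_left_mono) auto
  then show ?thesis by (simp add: exp_minus inverse_eq_divide[symmetric] del: minus_add_distrib)
qed

text \<open>
  Chernoff's bound with exponent \<open>r\<close>: the logarithm of the exponential moment is at most
  \<open>r (1 - \<delta>) + 4 r\<^sup>2 m\<close>, since the squares \<open>(w k * (s k)\<^sup>2)\<^sup>2\<close> sum to at most \<open>m\<close>.
\<close>
lemma gaussian_quadratic_form_tail:
  assumes J: "finite J" and s: "\<And>k. s k > 0" and w: "\<And>k. k \<in> J \<Longrightarrow> w k \<ge> 0"
    and d: "0 < \<delta>" "\<delta> \<le> 1" and m: "m > 0" "\<And>k. k \<in> J \<Longrightarrow> w k * (s k)\<^sup>2 \<le> m"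
    and mean: "(\<Sum>k\<in>J. w k * (s k)\<^sup>2) \<le> 1 - \<delta>"
  shows "emeasure (\<Pi>\<^sub>M k\<in>J. gauss (s k)) {\<tau> \<in> space (\<Pi>\<^sub>M k\<in>J. gauss (s k)). \<not> (\<Sum>k\<in>J. w k * (\<tau> k)\<^sup>2) \<le> 1}
    \<le> ennreal (exp (- \<delta>\<^sup>2 / (16 * m)))"
proof -
  let ?P = "\<Pi>\<^sub>M k\<in>J. gauss (s k)"
  interpret product_prob_space "\<lambda>k. gauss (s k)" J
    using prob_space_gauss[OF s] by (simp add: product_prob_space_def product_prob_space_axioms_def product_sigma_finite_def prob_space_imp_sigma_finite)
  \<comment> \<open>Minimizes \<open>- r \<delta> + 4 r\<^sup>2 m\<close>, and is small enough for the bound on the exponential moments.\<close>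
  define r where "r = \<delta> / (8 * m)"
  have r: "r > 0" using d m by (simp add: r_def)
  define a where "a k = r * (w k * (s k)\<^sup>2)" for k
  have a: "0 \<le> a k" "a k \<le> 1/4" "a k \<le> r * m" if "k \<in> J" for k
  proof -
    show "0 \<le> a k" using r w[OF that] by (simp add: a_def)
    show "a k \<le> r * m" using r m(2)[OF that] by (simp add: a_def)
    also have "r * m \<le> 1/4" using d m by (simp add: r_def)
    finally show "a k \<le> 1/4" .
  qed
  have [measurable]: "Measurable.pred ?P (\<lambda>\<tau>. (\<Sum>k\<in>J. w k * (\<tau> k)\<^sup>2) \<le> 1)"
    by measurable
  have "emeasure ?P {\<tau> \<in> space ?P. \<not> (\<Sum>k\<in>J. w k * (\<tau> k)\<^sup>2) \<le> 1}
     = (\<integral>\<^sup>+\<tau>. indicator {\<tau> \<in> space ?P. \<not> (\<Sum>k\<in>J. w k * (\<tau> k)\<^sup>2) \<le> 1} \<tau> \<partial>?P)"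
    by (rule nn_integral_indicator[symmetric]) measurable
  also have "\<dots> \<le> (\<integral>\<^sup>+\<tau>. ennreal (exp (- r)) * (\<Prod>k\<in>J. ennreal (exp (r * w k * (\<tau> k)\<^sup>2))) \<partial>?P)"
  proof (intro nn_integral_mono)
    fix \<tau>
    have "indicator {\<tau> \<in> space ?P. \<not> (\<Sum>k\<in>J. w k * (\<tau> k)\<^sup>2) \<le> 1} \<tau> \<le> ennreal (exp (r * (\<Sum>k\<in>J. w k * (\<tau> k)\<^sup>2) - r))"
      using r by (auto simp: indicator_def one_le_exp_iff ennreal_1[symmetric] simp del: ennreal_1 intro!: ennreal_leI)
    also have "exp (r * (\<Sum>k\<in>J. w k * (\<tau> k)\<^sup>2) - r) = exp (- r) * (\<Prod>k\<in>J. exp (r * w k * (\<tau> k)\<^sup>2))"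
      using J by (simp add: exp_sum[symmetric] sum_distrib_left mult.assoc flip: exp_add)
    finally show "indicator {\<tau> \<in> space ?P. \<not> (\<Sum>k\<in>J. w k * (\<tau> k)\<^sup>2) \<le> 1} \<tau> \<le> ennreal (exp (- r)) * (\<Prod>k\<in>J. ennreal (exp (r * w k * (\<tau> k)\<^sup>2)))"
      by (simp add: ennreal_mult prod_ennreal prod_nonneg)
  qed
  also have "\<dots> = ennreal (exp (- r)) * (\<integral>\<^sup>+\<tau>. (\<Prod>k\<in>J. ennreal (exp (r * w k * (\<tau> k)\<^sup>2))) \<partial>?P)"
    by (rule nn_integral_cmult) measurable
  also have "(\<integral>\<^sup>+\<tau>. (\<Prod>k\<in>J. ennreal (exp (r * w k * (\<tau> k)\<^sup>2))) \<partial>?P)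
      = (\<Prod>k\<in>J. \<integral>\<^sup>+x. ennreal (exp (r * w k * x\<^sup>2)) \<partial>gauss (s k))"
    by (rule product_nn_integral_prod[OF J]) measurable
  also have "\<dots> \<le> (\<Prod>k\<in>J. ennreal (exp (a k + 4 * (a k)\<^sup>2)))"
  proof (intro prod_mono_ennreal)
    fix k assume k: "k \<in> J"
    have "2 * (r * w k) * (s k)\<^sup>2 = 2 * a k" by (simp add: a_def)
    with nn_integral_gauss_exp_square[OF s, of "r * w k" k] inverse_sqrt_le_exp[OF a(1,2)[OF k]] a(2)[OF k]
    show "(\<integral>\<^sup>+x. ennreal (exp (r * w k * x\<^sup>2)) \<partial>gauss (s k)) \<le> ennreal (exp (a k + 4 * (a k)\<^sup>2))"
      by (simp add: ennreal_leI)
  qed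
  also have "\<dots> = ennreal (exp (\<Sum>k\<in>J. a k + 4 * (a k)\<^sup>2))"
    using J by (simp add: prod_ennreal exp_sum)
  also have "\<dots> \<le> ennreal (exp (r * (1 - \<delta>) + 4 * (r * m) * (r * (1 - \<delta>))))"
  proof (intro ennreal_leI, subst exp_le_cancel_iff)
    have sa: "(\<Sum>k\<in>J. a k) \<le> r * (1 - \<delta>)"
      unfolding a_def sum_distrib_left[symmetric] using mean r by simp
    have "(\<Sum>k\<in>J. (a k)\<^sup>2) \<le> (\<Sum>k\<in>J. (r * m) * a k)"
      unfolding power2_eq_square using a by (intro sum_mono mult_right_mono) auto
    also have "\<dots> = (r * m) * (\<Sum>k\<in>J. a k)" by (simp add: sum_distrib_left)
    also have "\<dots> \<le> (r * m) * (r * (1 - \<delta>))" using sa r m by (intro mult_left_mono) auto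
    finally show "(\<Sum>k\<in>J. a k + 4 * (a k)\<^sup>2) \<le> r * (1 - \<delta>) + 4 * (r * m) * (r * (1 - \<delta>))"
      using sa by (simp add: sum.distrib sum_distrib_left[symmetric])
  qed
  also have "ennreal (exp (- r)) * \<dots> = ennreal (exp (- r + (r * (1 - \<delta>) + 4 * (r * m) * (r * (1 - \<delta>)))))"
    by (subst exp_add) (rule ennreal_mult[symmetric]; simp)
  also have "\<dots> \<le> ennreal (exp (- \<delta>\<^sup>2 / (16 * m)))"
  proof (intro ennreal_leI, subst exp_le_cancel_iff)
    have "4 * (r * m) = \<delta> / 2" using m by (simp add: r_def)
    then have "- r + (r * (1 - \<delta>) + 4 * (r * m) * (r * (1 - \<delta>))) = - r + (r * (1 - \<delta>) + \<delta> / 2 * (r * (1 - \<delta>)))"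
      by (simp only:)
    also have "\<dots> = - r * \<delta> / 2 - r * \<delta>\<^sup>2 / 2"
      by (simp add: power2_eq_square field_simps)
    also have "\<dots> \<le> - r * \<delta> / 2" using r by simp
    also have "\<dots> = - \<delta>\<^sup>2 / (16 * m)" using m by (simp add: r_def power2_eq_square)
    finally show "- r + (r * (1 - \<delta>) + 4 * (r * m) * (r * (1 - \<delta>))) \<le> - \<delta>\<^sup>2 / (16 * m)" .
  qed
  finally show ?thesis by (simp add: mult_left_mono)
qed

section \<open>The model in an eigenbasis\<close>

text \<open>
  An eigenbasis of \<open>Q\<close> is fixed once: its vectors are the rows of \<open>U\<close>, its eigenvalues are \<open>l\<close>.
\<close>
locale diagonalized_model =
  fixes Q U :: "real^'p^'p" and l :: "'p \<Rightarrow> real" and \<beta> :: real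
  assumes orth: "orthogonal_matrix U"
    and Q_eq: "Q = transpose U ** diag_mat (\<chi> j. l j) ** U"
    and l_pos: "\<And>j. l j > 0"
    and \<beta>_pos: "\<beta> > 0"
begin

abbreviation u :: "'p \<Rightarrow> real^'p" where "u j \<equiv> row j U"

lemma norm_u [simp]: "norm (u j) = 1"
  using orthogonal_rows_inner[OF orth, of j j] by (simp add: norm_eq_1)

lemma inner_u: "u i \<bullet> u j = (if i = j then 1 else 0)"
  by (rule orthogonal_rows_inner[OF orth])

lemma quadratic_form_Q: "x \<bullet> (Q *v x) = (\<Sum>j\<in>UNIV. l j * (u j \<bullet> x)\<^sup>2)"
  by (simp add: Q_eq inner_transpose_diag_mat power2_eq_square mult.assoc)

lemma matrix_inv_Q: "matrix_inv Q = transpose U ** diag_mat (\<chi> j. 1 / l j) ** U"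
proof -
  have "l j \<noteq> 0" for j using l_pos[of j] by simp
  then show ?thesis
    using matrix_inv_transpose_diag_mat[OF orth, of "\<chi> j. l j"] by (simp add: Q_eq)
qed

lemma quadratic_form_matrix_inv_Q: "x \<bullet> (matrix_inv Q *v x) = (\<Sum>j\<in>UNIV. (u j \<bullet> x)\<^sup>2 / l j)"
  by (simp add: matrix_inv_Q inner_transpose_diag_mat power2_eq_square mult.assoc)

lemma pinsker_weight_eq:
  "pinsker_weight \<beta> Q \<kappa> i = transpose U ** diag_mat (\<chi> j. shrink \<beta> (\<kappa> / l j) i) ** U"
proof -
  have "mat 1 - (sob_coeff \<beta> i * \<kappa>) *\<^sub>R matrix_inv Q
      = transpose U ** diag_mat (\<chi> j. 1 - sob_coeff \<beta> i * (\<kappa> / l j)) ** U"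
    by (simp add: matrix_inv_Q mat_1_minus_transpose_diag_mat[OF orth])
  from spectral_map_eq[OF orth this] show ?thesis
    by (simp add: pinsker_weight_def psd_part_def shrink_def)
qed

lemma inner_pinsker_weight:
  "u j \<bullet> (pinsker_weight \<beta> Q \<kappa> i *v y) = shrink \<beta> (\<kappa> / l j) i * (u j \<bullet> y)"
  by (simp add: pinsker_weight_eq row_inner_transpose_diag_mat[OF orth])

lemma trace_pinsker_weight: "trace (pinsker_weight \<beta> Q \<kappa> i) = (\<Sum>j\<in>UNIV. shrink \<beta> (\<kappa> / l j) i)"
  by (simp add: pinsker_weight_eq trace_transpose_diag_mat[OF orth])

lemma trace_mat_powr: "trace (mat_powr Q r) = (\<Sum>j\<in>UNIV. l j powr r)"
  unfolding mat_powr_def by (simp add: spectral_map_eq[OF orth Q_eq] trace_transpose_diag_mat[OF orth])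

lemma shrink_summable:
  assumes "\<kappa> > 0"
  shows "summable (\<lambda>i. g i * shrink \<beta> (\<kappa> / l j) (Suc i))"
  using assms by (intro sums_summable[OF shrink_sums] \<beta>_pos divide_pos_pos l_pos) auto

lemma pinsker_eq_iff:
  assumes "\<kappa> > 0"
  shows "pinsker_eq \<beta> Q \<epsilon> \<kappa> \<longleftrightarrow> \<epsilon>\<^sup>2 * inverse \<kappa> * total_weighted_shrink \<beta> l \<kappa> = 1"
  using shrink_summable[OF assms]
  by (simp add: pinsker_eq_def trace_pinsker_weight sum_distrib_left summable_sum suminf_sum
      total_weighted_shrink_def weighted_shrink_sum_def)

lemma mem_sob_ellipsoid_iff:
  "\<theta> \<in> sob_ellipsoid \<beta> Q \<longleftrightarrow>
    summable (\<lambda>i. \<Sum>j\<in>UNIV. (sob_coeff \<beta> (Suc i))\<^sup>2 / l j * (u j \<bullet> \<theta> (Suc i))\<^sup>2) \<and>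
    (\<Sum>i. \<Sum>j\<in>UNIV. (sob_coeff \<beta> (Suc i))\<^sup>2 / l j * (u j \<bullet> \<theta> (Suc i))\<^sup>2) \<le> 1"
  by (simp add: sob_ellipsoid_def quadratic_form_matrix_inv_Q sum_distrib_left)

lemma loss_eq: "loss Q \<theta> t = (\<Sum>i. \<Sum>j\<in>UNIV. ennreal (l j * (u j \<bullet> (t (Suc i) - \<theta> (Suc i)))\<^sup>2))"
  unfolding loss_def quadratic_form_Q
  by (subst sum_ennreal[symmetric]) (auto intro!: mult_nonneg_nonneg less_imp_le[OF l_pos])

end

locale gaussian_noise_model = diagonalized_model Q U l \<beta>
  for Q U :: "real^'p^'p" and l :: "'p \<Rightarrow> real" and \<beta> :: real +
  fixes M :: "'a measure" and \<xi> :: "nat \<Rightarrow> 'a \<Rightarrow> real^'p"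
  assumes noise: "standard_gaussian_noise M \<xi>"
begin

lemma prob_space_M: "prob_space M" using noise by (simp add: standard_gaussian_noise_def)

lemma measurable_noise [measurable]: "i \<ge> 1 \<Longrightarrow> \<xi> i \<in> borel_measurable M"
proof -
  assume "i \<ge> 1"
  then have "distributed M lborel (\<xi> i) (\<lambda>x. ennreal (mvn_std_density x))"
    using noise by (simp add: standard_gaussian_noise_def)
  then have "\<xi> i \<in> measurable M lborel" by (simp only: distributed_def)
  then show ?thesis by simp
qed

lemma distr_noise: "i \<ge> 1 \<Longrightarrow> distr M borel (\<xi> i) = mvn_std"
proof -
  assume "i \<ge> 1"
  then have "distributed M lborel (\<xi> i) (\<lambda>x. ennreal (mvn_std_density x))"
    using noise by (simp add: standard_gaussian_noise_def)
  then have "distr M lborel (\<xi> i) = mvn_std"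
    by (simp add: mvn_std_def distributed_distr_eq_density)
  moreover have "distr M lborel (\<xi> i) = distr M borel (\<xi> i)" by (rule distr_cong) auto
  ultimately show ?thesis by simp
qed

lemma prob_space_mvn_std: "prob_space (mvn_std :: (real^'p) measure)"
  using prob_space.prob_space_distr[OF prob_space_M measurable_noise[of 1]] distr_noise[of 1] by simp

lemma nn_integral_noise_direction:
  assumes "i \<ge> 1" and [measurable]: "f \<in> borel_measurable borel"
  shows "(\<integral>\<^sup>+\<omega>. f (u j \<bullet> \<xi> i \<omega>) \<partial>M) = (\<integral>\<^sup>+z. f z \<partial>gauss 1)"
proof -
  have "(\<integral>\<^sup>+\<omega>. f (u j \<bullet> \<xi> i \<omega>) \<partial>M) = (\<integral>\<^sup>+x. f (u j \<bullet> x) \<partial>distr M borel (\<xi> i))"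
    using assms by (subst nn_integral_distr) auto
  also have "\<dots> = (\<integral>\<^sup>+z. f z \<partial>gauss 1)"
    using assms by (simp add: distr_noise mvn_std_marginal[OF prob_space_mvn_std])
  finally show ?thesis .
qed

end

section \<open>The risk of the Pinsker estimator\<close>

context gaussian_noise_model
begin

text \<open>
  Variance plus squared bias, coordinate by coordinate.
\<close>
lemma linear_estimator_risk:
  fixes c :: "nat \<Rightarrow> 'p \<Rightarrow> real"
  assumes t: "\<And>y i j. i \<ge> 1 \<Longrightarrow> u j \<bullet> t y i = c i j * (u j \<bullet> y i)"
  shows "risk M \<xi> \<epsilon> Q \<theta> t = (\<Sum>i. ennreal (\<Sum>j\<in>UNIV. l j * ((c (Suc i) j * \<epsilon>)\<^sup>2 + ((c (Suc i) j - 1) * (u j \<bullet> \<theta> (Suc i)))\<^sup>2)))"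
proof -
  let ?e = "\<lambda>i j z. (c i j * \<epsilon>) * z + (c i j - 1) * (u j \<bullet> \<theta> i)"
  have "u j \<bullet> (t (observation \<xi> \<epsilon> \<theta> \<omega>) (Suc i) - \<theta> (Suc i)) = ?e (Suc i) j (u j \<bullet> \<xi> (Suc i) \<omega>)" for i j \<omega>
    by (simp add: t observation_def inner_diff_right inner_add_right algebra_simps)
  then have "risk M \<xi> \<epsilon> Q \<theta> t = (\<integral>\<^sup>+\<omega>. (\<Sum>i. \<Sum>j\<in>UNIV. ennreal (l j) * ennreal ((?e (Suc i) j (u j \<bullet> \<xi> (Suc i) \<omega>))\<^sup>2)) \<partial>M)"
    by (simp add: risk_def loss_eq ennreal_mult less_imp_le[OF l_pos])
  also have "\<dots> = (\<Sum>i. \<integral>\<^sup>+\<omega>. (\<Sum>j\<in>UNIV. ennreal (l j) * ennreal ((?e (Suc i) j (u j \<bullet> \<xi> (Suc i) \<omega>))\<^sup>2)) \<partial>M)"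
    by (rule nn_integral_suminf) measurable
  also have "\<dots> = (\<Sum>i. \<Sum>j\<in>UNIV. ennreal (l j) * (\<integral>\<^sup>+\<omega>. ennreal ((?e (Suc i) j (u j \<bullet> \<xi> (Suc i) \<omega>))\<^sup>2) \<partial>M))"
  proof (intro suminf_cong)
    fix i
    show "(\<integral>\<^sup>+\<omega>. (\<Sum>j\<in>UNIV. ennreal (l j) * ennreal ((?e (Suc i) j (u j \<bullet> \<xi> (Suc i) \<omega>))\<^sup>2)) \<partial>M) = 
      (\<Sum>j\<in>UNIV. ennreal (l j) * (\<integral>\<^sup>+\<omega>. ennreal ((?e (Suc i) j (u j \<bullet> \<xi> (Suc i) \<omega>))\<^sup>2) \<partial>M))"
      by (subst nn_integral_sum) (simp_all add: nn_integral_cmult)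
  qed
  also have "\<dots> = (\<Sum>i. \<Sum>j\<in>UNIV. ennreal (l j) * ennreal ((c (Suc i) j * \<epsilon>)\<^sup>2 + ((c (Suc i) j - 1) * (u j \<bullet> \<theta> (Suc i)))\<^sup>2))"
    by (simp add: nn_integral_noise_direction[where f="\<lambda>z. ennreal ((_ * z + _)\<^sup>2)"] nn_integral_gauss_square_affine)
  also have "\<dots> = (\<Sum>i. ennreal (\<Sum>j\<in>UNIV. l j * ((c (Suc i) j * \<epsilon>)\<^sup>2 + ((c (Suc i) j - 1) * (u j \<bullet> \<theta> (Suc i)))\<^sup>2)))"
    by (subst sum_ennreal[symmetric]) (auto simp: ennreal_mult less_imp_le[OF l_pos])
  finally show ?thesis .
qed

text \<open>
  From \<open>l\<^sub>j c\<^sub>i\<^sub>j\<^sup>2 = l\<^sub>j c\<^sub>i\<^sub>j - \<kappa> a\<^sub>i c\<^sub>i\<^sub>j\<close> the variance sums to \<open>r(\<epsilon>) - \<epsilon>\<^sup>2 \<kappa> \<Sum> a\<^sub>i c\<^sub>i\<^sub>j\<close>, where the last term is \<open>\<kappa>\<^sup>2\<close> by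
  the equation for \<open>\<kappa>\<close>. It cancels against the bound \<open>\<kappa>\<^sup>2\<close> for the squared bias, which holds because
  \<open>1 - c\<^sub>i\<^sub>j \<le> \<kappa> a\<^sub>i / l\<^sub>j\<close> and because of the definition of the ellipsoid.
\<close>
lemma pinsker_risk_le:
  assumes \<epsilon>: "\<epsilon> > 0" and \<kappa>: "\<kappa> > 0" and eq: "pinsker_eq \<beta> Q \<epsilon> \<kappa>" and \<theta>: "\<theta> \<in> sob_ellipsoid \<beta> Q"
  shows "risk M \<xi> \<epsilon> Q \<theta> (\<lambda>y. \<lambda>i\<in>{1..}. pinsker_weight \<beta> Q \<kappa> i *v y i) \<le> ennreal (\<epsilon>\<^sup>2 * total_shrink \<beta> l \<kappa>)"
proof -
  let ?a = "\<lambda>i. sob_coeff \<beta> (Suc i)" and ?c = "\<lambda>i j. shrink \<beta> (\<kappa> / l j) (Suc i)"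
  let ?f = "\<lambda>i. \<epsilon>\<^sup>2 * (\<Sum>j\<in>UNIV. l j * ?c i j - \<kappa> * (?a i * ?c i j))"
  let ?h = "\<lambda>i. \<Sum>j\<in>UNIV. (?a i)\<^sup>2 / l j * (u j \<bullet> \<theta> (Suc i))\<^sup>2"
  let ?g = "\<lambda>i. \<Sum>j\<in>UNIV. l j * ((?c i j * \<epsilon>)\<^sup>2 + ((?c i j - 1) * (u j \<bullet> \<theta> (Suc i)))\<^sup>2)"
  have le: "?g i \<le> ?f i + \<kappa>\<^sup>2 * ?h i" for i
  proof -
    have "l j * ((?c i j * \<epsilon>)\<^sup>2 + ((?c i j - 1) * (u j \<bullet> \<theta> (Suc i)))\<^sup>2) \<le>
      \<epsilon>\<^sup>2 * (l j * ?c i j - \<kappa> * (?a i * ?c i j)) + \<kappa>\<^sup>2 * ((?a i)\<^sup>2 / l j * (u j \<bullet> \<theta> (Suc i))\<^sup>2)" for j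
    proof -
      have l: "l j > 0" by (rule l_pos)
      have c2: "l j * (?c i j)\<^sup>2 = l j * ?c i j - \<kappa> * (?a i * ?c i j)"
      proof (cases "?c i j = 0")
        case False
        then have "?c i j = 1 - ?a i * (\<kappa> / l j)" by (auto simp: shrink_def max_def split: if_splits)
        then have "l j * ?c i j = l j - \<kappa> * ?a i" using l by (simp add: field_simps)
        then have "l j * ?c i j * ?c i j = (l j - \<kappa> * ?a i) * ?c i j" by simp
        then show ?thesis by (simp add: power2_eq_square algebra_simps)
      qed simp
      have "l j * (?c i j - 1)\<^sup>2 \<le> \<kappa>\<^sup>2 * ((?a i)\<^sup>2 / l j)"
      proof -
        have "0 \<le> ?a i * (\<kappa> / l j)" using l \<kappa> sob_coeff_nonneg by simp
        moreover have "\<bar>max 0 (1 - x) - 1\<bar> \<le> \<bar>x\<bar>" if "0 \<le> x" for x :: real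
          using that by (simp add: max_def)
        ultimately have "\<bar>?c i j - 1\<bar> \<le> \<bar>?a i * (\<kappa> / l j)\<bar>" unfolding shrink_def by blast
        then have "(?c i j - 1)\<^sup>2 \<le> (?a i * (\<kappa> / l j))\<^sup>2" by (simp only: abs_le_square_iff)
        then have "l j * (?c i j - 1)\<^sup>2 \<le> l j * (?a i * (\<kappa> / l j))\<^sup>2" using l by simp
        also have "\<dots> = \<kappa>\<^sup>2 * ((?a i)\<^sup>2 / l j)" using l by (simp add: power2_eq_square)
        finally show ?thesis .
      qed
      then have "l j * (?c i j - 1)\<^sup>2 * (u j \<bullet> \<theta> (Suc i))\<^sup>2 \<le> \<kappa>\<^sup>2 * ((?a i)\<^sup>2 / l j) * (u j \<bullet> \<theta> (Suc i))\<^sup>2"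
        by (rule mult_right_mono) simp
      moreover have "l j * (?c i j * \<epsilon>)\<^sup>2 = \<epsilon>\<^sup>2 * (l j * ?c i j - \<kappa> * (?a i * ?c i j))"
        unfolding c2[symmetric] by (simp add: power_mult_distrib)
      moreover have "l j * ((?c i j - 1) * (u j \<bullet> \<theta> (Suc i)))\<^sup>2 = l j * (?c i j - 1)\<^sup>2 * (u j \<bullet> \<theta> (Suc i))\<^sup>2"
        by (simp add: power_mult_distrib)
      ultimately show ?thesis
        unfolding distrib_left by (simp only: mult.assoc add_left_mono)
    qed
    then have "?g i \<le>
       (\<Sum>j\<in>UNIV. \<epsilon>\<^sup>2 * (l j * ?c i j - \<kappa> * (?a i * ?c i j)) + \<kappa>\<^sup>2 * ((?a i)\<^sup>2 / l j * (u j \<bullet> \<theta> (Suc i))\<^sup>2))"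
      by (intro sum_mono)
    then show ?thesis by (simp only: sum.distrib sum_distrib_left)
  qed
  have nn: "0 \<le> ?g i" for i
    by (intro sum_nonneg mult_nonneg_nonneg less_imp_le[OF l_pos]) auto
  have hs: "summable ?h" "suminf ?h \<le> 1" using \<theta> by (auto simp: mem_sob_ellipsoid_iff)
  have fs: "?f sums (\<epsilon>\<^sup>2 * (total_shrink \<beta> l \<kappa> - \<kappa> * total_weighted_shrink \<beta> l \<kappa>))"
  proof -
    have "(\<lambda>i. l j * ?c i j - \<kappa> * (?a i * ?c i j)) sums (l j * shrink_sum \<beta> (\<kappa> / l j) - \<kappa> * weighted_shrink_sum \<beta> (\<kappa> / l j))" for j
      unfolding shrink_sum_def weighted_shrink_sum_def
      using shrink_summable[OF \<kappa>, of "\<lambda>_. 1" j] shrink_summable[OF \<kappa>, of "\<lambda>i. ?a i" j]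
      by (intro sums_diff sums_mult summable_sums) auto
    then have "(\<lambda>i. \<Sum>j\<in>UNIV. l j * ?c i j - \<kappa> * (?a i * ?c i j)) sums
      (\<Sum>j\<in>UNIV. l j * shrink_sum \<beta> (\<kappa> / l j) - \<kappa> * weighted_shrink_sum \<beta> (\<kappa> / l j))"
      by (rule sums_sum)
    from sums_mult[OF this, of "\<epsilon>\<^sup>2"] show ?thesis
      by (simp add: total_shrink_def total_weighted_shrink_def sum_subtractf sum_distrib_left)
  qed
  have "risk M \<xi> \<epsilon> Q \<theta> (\<lambda>y. \<lambda>i\<in>{1..}. pinsker_weight \<beta> Q \<kappa> i *v y i)
    = (\<Sum>i. ennreal (?g i))"
    by (rule linear_estimator_risk) (simp add: inner_pinsker_weight)
  also have "\<dots> \<le> (\<Sum>i. ennreal (?f i + \<kappa>\<^sup>2 * ?h i))"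
    by (intro suminf_le ennreal_leI le) auto
  also have "\<dots> = ennreal (\<Sum>i. ?f i + \<kappa>\<^sup>2 * ?h i)"
    by (intro suminf_ennreal2 order_trans[OF nn le]
        summable_add[OF sums_summable[OF fs] summable_mult[OF hs(1)]])
  finally have r: "risk M \<xi> \<epsilon> Q \<theta> (\<lambda>y. \<lambda>i\<in>{1..}. pinsker_weight \<beta> Q \<kappa> i *v y i) \<le> ennreal (\<Sum>i. ?f i + \<kappa>\<^sup>2 * ?h i)" .
  have "(\<Sum>i. ?f i + \<kappa>\<^sup>2 * ?h i) = \<epsilon>\<^sup>2 * (total_shrink \<beta> l \<kappa> - \<kappa> * total_weighted_shrink \<beta> l \<kappa>) + \<kappa>\<^sup>2 * suminf ?h"
    by (rule sums_unique[symmetric, OF sums_add[OF fs sums_mult[OF summable_sums[OF hs(1)]]]])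
  also have "\<dots> \<le> \<epsilon>\<^sup>2 * (total_shrink \<beta> l \<kappa> - \<kappa> * total_weighted_shrink \<beta> l \<kappa>) + \<kappa>\<^sup>2"
    using hs mult_left_mono[of "suminf ?h" 1 "\<kappa>\<^sup>2"] by simp
  also have "\<dots> = \<epsilon>\<^sup>2 * total_shrink \<beta> l \<kappa>"
  proof -
    have "\<epsilon>\<^sup>2 * total_weighted_shrink \<beta> l \<kappa> = \<kappa>"
      using eq \<kappa> unfolding pinsker_eq_iff[OF \<kappa>] by (simp add: field_simps)
    then have "\<kappa> * (\<epsilon>\<^sup>2 * total_weighted_shrink \<beta> l \<kappa>) = \<kappa>\<^sup>2" by (simp add: power2_eq_square)
    then show ?thesis by (simp add: algebra_simps)
  qed
  finally show ?thesis by (rule order_trans[OF r ennreal_leI])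
qed

end

lemma pinsker_weight_estimator:
  "(\<lambda>y. \<lambda>i\<in>{1..}. pinsker_weight \<beta> Q \<kappa> i *v y i) \<in> estimators"
  unfolding estimators_def
proof (rule measurable_restrict)
  fix i :: nat assume "i \<in> {1..}"
  then have [measurable]: "(\<lambda>y. y i) \<in> measurable (Pi\<^sub>M {1..} (\<lambda>_. borel)) borel"
    by (rule measurable_component_singleton)
  have [measurable]: "(\<lambda>x. pinsker_weight \<beta> Q \<kappa> i *v x) \<in> borel_measurable borel"
    by (intro borel_measurable_continuous_onI linear_continuous_on) (simp add: linear_linear)
  show "(\<lambda>y. pinsker_weight \<beta> Q \<kappa> i *v y i) \<in> measurable (Pi\<^sub>M {1..} (\<lambda>_. borel)) borel"
    by measurable
qed

section \<open>Gaussian priors on finitely many coordinates\<close>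

text \<open>
  Fubini for one coordinate of a possibly infinite product of probability spaces.
\<close>
lemma nn_integral_PiM_insert:
  assumes M: "\<And>k. prob_space (M k)" and f[measurable]: "f \<in> borel_measurable (Pi\<^sub>M (insert i I) M)"
  shows "(\<integral>\<^sup>+X. f X \<partial>Pi\<^sub>M (insert i I) M) = (\<integral>\<^sup>+X. (\<integral>\<^sup>+x. f (X(i := x)) \<partial>M i) \<partial>Pi\<^sub>M I M)"
proof -
  interpret rest: prob_space "Pi\<^sub>M I M" by (rule prob_space_PiM[OF M])
  interpret new: prob_space "M i" by (rule M)
  interpret joint: pair_sigma_finite "M i" "Pi\<^sub>M I M" ..
  have [measurable]: "(\<lambda>(x, X). X(i := x)) \<in> measurable (M i \<Otimes>\<^sub>M Pi\<^sub>M I M) (Pi\<^sub>M (insert i I) M)"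
    by measurable
  have "(\<integral>\<^sup>+X. f X \<partial>Pi\<^sub>M (insert i I) M) = (\<integral>\<^sup>+X. f X \<partial>distr (M i \<Otimes>\<^sub>M Pi\<^sub>M I M) (Pi\<^sub>M (insert i I) M) (\<lambda>(x, X). X(i := x)))"
    by (subst distr_pair_PiM_eq_PiM) (auto intro: M)
  also have "\<dots> = (\<integral>\<^sup>+p. f ((snd p)(i := fst p)) \<partial>(M i \<Otimes>\<^sub>M Pi\<^sub>M I M))"
    by (subst nn_integral_distr) (auto simp: split_beta')
  also have "\<dots> = (\<integral>\<^sup>+X. (\<integral>\<^sup>+x. f (X(i := x)) \<partial>M i) \<partial>Pi\<^sub>M I M)"
    by (subst joint.nn_integral_snd[symmetric]) auto
  finally show ?thesis .
qed

abbreviation noise_law :: "(nat \<Rightarrow> real^'p) measure" where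
  "noise_law \<equiv> Pi\<^sub>M {1..} (\<lambda>_. mvn_std)"

lemma noise_resample_direction:
  fixes w :: "real^'p" and F :: "(nat \<Rightarrow> real^'p) \<Rightarrow> ennreal"
  assumes p: "prob_space (mvn_std :: (real^'p) measure)" and w: "norm w = 1" and i: "i \<ge> 1"
    and F[measurable]: "F \<in> borel_measurable noise_law"
  shows "(\<integral>\<^sup>+X. F X \<partial>noise_law) = (\<integral>\<^sup>+X. (\<integral>\<^sup>+z. F (X(i := X i + (z - w \<bullet> X i) *\<^sub>R w)) \<partial>gauss 1) \<partial>noise_law)"
proof -
  let ?I = "{1..} - {i}"
  interpret g: prob_space "gauss 1" by (rule prob_space_gauss) simp
  have I: "insert i ?I = {1..}" using i by auto
  have [measurable]: "F \<in> borel_measurable (Pi\<^sub>M (insert i ?I) (\<lambda>_. mvn_std))" using F I by simp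
  have [measurable]: "(\<lambda>X. X i) \<in> measurable noise_law borel"
    using i by (subst measurable_cong_sets[OF refl sets_mvn_std[symmetric]]) (rule measurable_component_singleton, simp)
  have upd: "(\<lambda>(X, z). X(i := X i + (z - w \<bullet> X i) *\<^sub>R w)) \<in> measurable (noise_law \<Otimes>\<^sub>M gauss 1) noise_law"
    unfolding split_beta'
    by (rule measurable_fun_upd[where J = "{1..}"]) (use i in auto)
  have [measurable]: "(\<lambda>p. F ((fst p)(i := fst p i + (snd p - w \<bullet> fst p i) *\<^sub>R w))) \<in> borel_measurable (noise_law \<Otimes>\<^sub>M gauss 1)"
    using measurable_compose[OF upd F] by (simp add: split_beta')
  have res [measurable]: "(\<lambda>X. \<integral>\<^sup>+z. F (X(i := X i + (z - w \<bullet> X i) *\<^sub>R w)) \<partial>gauss 1) \<in> borel_measurable noise_law"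
    by (rule g.borel_measurable_nn_integral) (simp only: split_beta', measurable)
  have "(\<integral>\<^sup>+X. F X \<partial>noise_law) = (\<integral>\<^sup>+X. (\<integral>\<^sup>+x. F (X(i := x)) \<partial>mvn_std) \<partial>Pi\<^sub>M ?I (\<lambda>_. mvn_std))"
    by (rule nn_integral_PiM_insert[where M = "\<lambda>_. mvn_std" and i = i and I = ?I, unfolded I, OF p F])
  also have "\<dots> = (\<integral>\<^sup>+X. (\<integral>\<^sup>+x. (\<integral>\<^sup>+z. F (X(i := x + (z - w \<bullet> x) *\<^sub>R w)) \<partial>gauss 1) \<partial>mvn_std) \<partial>Pi\<^sub>M ?I (\<lambda>_. mvn_std))"
  proof (rule nn_integral_cong)
    fix X :: "nat \<Rightarrow> real^'p" assume X: "X \<in> space (Pi\<^sub>M ?I (\<lambda>_. mvn_std))"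
    then have [measurable]: "(\<lambda>x. X(i := x)) \<in> measurable borel (Pi\<^sub>M (insert i ?I) (\<lambda>_. mvn_std))"
      by (intro measurable_fun_upd[where J = ?I]) auto
    show "(\<integral>\<^sup>+x. F (X(i := x)) \<partial>mvn_std) = (\<integral>\<^sup>+x. (\<integral>\<^sup>+z. F (X(i := x + (z - w \<bullet> x) *\<^sub>R w)) \<partial>gauss 1) \<partial>mvn_std)"
      by (rule mvn_std_resample_direction[OF w, symmetric]) measurable
  qed
  also have "\<dots> = (\<integral>\<^sup>+X. (\<integral>\<^sup>+z. F (X(i := X i + (z - w \<bullet> X i) *\<^sub>R w)) \<partial>gauss 1) \<partial>noise_law)"
    using nn_integral_PiM_insert[where M = "\<lambda>_. mvn_std" and i = i and I = ?I, unfolded I,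
        OF p res]
    by (simp del: One_nat_def)
  finally show ?thesis .
qed

context diagonalized_model
begin

text \<open>
  The sequence of vectors whose coordinates in the eigenbasis are \<open>\<tau>\<close> on \<open>J\<close> and zero elsewhere; a prior on
  \<open>\<tau>\<close> induces a prior on signals.
\<close>
definition signal :: "(nat \<times> 'p) set \<Rightarrow> (nat \<times> 'p \<Rightarrow> real) \<Rightarrow> nat \<Rightarrow> real^'p" where
  "signal J \<tau> i = (\<Sum>j\<in>UNIV. (if (i, j) \<in> J then \<tau> (i, j) else 0) *\<^sub>R u j)"

lemma inner_signal: "u j \<bullet> signal J \<tau> i = (if (i, j) \<in> J then \<tau> (i, j) else 0)"
  by (simp add: signal_def inner_sum_right inner_u if_distrib [where f = "\<lambda>x. _ * x"] cong: if_cong)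

lemma signal_upd:
  assumes "(i0, j0) \<in> J"
  shows "signal J (\<tau>((i0, j0) := x)) i = signal J (\<tau>((i0, j0) := 0)) i + (if i = i0 then x *\<^sub>R u j0 else 0)"
proof -
  have "signal J (\<tau>((i0, j0) := x)) i = (\<Sum>j\<in>UNIV. (if (i, j) \<in> J then (\<tau>((i0, j0) := 0)) (i, j) else 0) *\<^sub>R u j
     + (if j = j0 then (if i = i0 then x *\<^sub>R u j0 else 0) else 0))"
    unfolding signal_def using assms by (intro sum.cong) auto
  also have "\<dots> = signal J (\<tau>((i0, j0) := 0)) i + (if i = i0 then x *\<^sub>R u j0 else 0)"
    unfolding sum.distrib signal_def by (simp only: sum.delta finite UNIV_I if_True)
  finally show ?thesis .
qed

lemma sum_pairs:
  fixes f :: "nat \<times> 'p \<Rightarrow> 'c::comm_monoid_add"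
  assumes "J \<subseteq> {1..} \<times> UNIV" "finite J"
  shows "(\<Sum>k\<in>J. f k) = (\<Sum>i\<in>{i. Suc i \<in> fst ` J}. \<Sum>j\<in>UNIV. if (Suc i, j) \<in> J then f (Suc i, j) else 0)"
    and "finite {i. Suc i \<in> fst ` J}"
proof -
  let ?I = "{i. Suc i \<in> fst ` J}"
  show fin: "finite ?I"
    using assms(2) finite_vimageI[of "fst ` J" Suc] by (simp add: vimage_def)
  have "(\<Sum>i\<in>?I. \<Sum>j\<in>UNIV. if (Suc i, j) \<in> J then f (Suc i, j) else 0)
    = (\<Sum>p\<in>?I \<times> UNIV. if (Suc (fst p), snd p) \<in> J then f (Suc (fst p), snd p) else 0)"
    using fin by (simp add: sum.cartesian_product split_beta')
  also have "\<dots> = (\<Sum>p\<in>{p \<in> ?I \<times> UNIV. (Suc (fst p), snd p) \<in> J}. f (Suc (fst p), snd p))"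
    using fin by (intro sum.inter_filter[symmetric]) auto
  also have "\<dots> = (\<Sum>k\<in>J. f k)"
    using assms(1)
    by (intro sum.reindex_bij_witness[where i = "\<lambda>k. (fst k - 1, snd k)" and j = "\<lambda>p. (Suc (fst p), snd p)"]) force+
  finally show "(\<Sum>k\<in>J. f k) = (\<Sum>i\<in>?I. \<Sum>j\<in>UNIV. if (Suc i, j) \<in> J then f (Suc i, j) else 0)" ..
qed

lemma signal_mem_ellipsoid:
  assumes J: "J \<subseteq> {1..} \<times> UNIV" "finite J"
    and \<tau>: "(\<Sum>k\<in>J. (sob_coeff \<beta> (fst k))\<^sup>2 / l (snd k) * (\<tau> k)\<^sup>2) \<le> 1"
  shows "signal J \<tau> \<in> sob_ellipsoid \<beta> Q"
proof -
  let ?f = "\<lambda>i. \<Sum>j\<in>UNIV. (sob_coeff \<beta> (Suc i))\<^sup>2 / l j * (u j \<bullet> signal J \<tau> (Suc i))\<^sup>2"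
  let ?I = "{i. Suc i \<in> fst ` J}"
  have "?f sums (\<Sum>i\<in>?I. ?f i)"
  proof (rule sums_finite[OF sum_pairs(2)[OF J]])
    fix i assume "i \<notin> ?I"
    then have "(Suc i, j) \<notin> J" for j by force
    then show "?f i = 0" by (simp add: inner_signal)
  qed
  moreover have "(\<Sum>i\<in>?I. ?f i) \<le> 1"
  proof -
    have "(\<Sum>i\<in>?I. ?f i) = (\<Sum>k\<in>J. (sob_coeff \<beta> (fst k))\<^sup>2 / l (snd k) * (\<tau> k)\<^sup>2)"
      unfolding sum_pairs(1)[OF J] by (intro sum.cong) (auto simp: inner_signal)
    then show ?thesis using \<tau> by simp
  qed
  ultimately show ?thesis by (simp add: mem_sob_ellipsoid_iff sums_iff)
qed

lemma loss_ge:
  assumes J: "J \<subseteq> {1..} \<times> UNIV" "finite J"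
  shows "(\<Sum>k\<in>J. ennreal (l (snd k) * (u (snd k) \<bullet> (x (fst k) - \<theta> (fst k)))\<^sup>2)) \<le> loss Q \<theta> x"
proof -
  have "(\<Sum>k\<in>J. ennreal (l (snd k) * (u (snd k) \<bullet> (x (fst k) - \<theta> (fst k)))\<^sup>2))
    \<le> (\<Sum>i\<in>{i. Suc i \<in> fst ` J}. \<Sum>j\<in>UNIV. ennreal (l j * (u j \<bullet> (x (Suc i) - \<theta> (Suc i)))\<^sup>2))"
    unfolding sum_pairs(1)[OF J] by (intro sum_mono) simp
  also have "\<dots> \<le> loss Q \<theta> x"
    unfolding loss_eq by (intro sum_le_suminf sum_pairs(2)[OF J]) auto
  finally show ?thesis .
qed

end

context gaussian_noise_model
begin

lemma distr_noise_sequence: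
  "distr M (Pi\<^sub>M {1..} (\<lambda>_. borel)) (\<lambda>\<omega>. \<lambda>i\<in>{1..}. \<xi> i \<omega>) = noise_law"
proof -
  interpret prob_space M by (rule prob_space_M)
  have "distr M (Pi\<^sub>M {1..} (\<lambda>_. borel)) (\<lambda>\<omega>. \<lambda>i\<in>{1..}. \<xi> i \<omega>) = Pi\<^sub>M {1..} (\<lambda>i. distr M borel (\<xi> i))"
    using noise by (subst indep_vars_iff_distr_eq_PiM'[symmetric]) (auto simp: standard_gaussian_noise_def)
  also have "\<dots> = noise_law" by (intro PiM_cong) (auto simp: distr_noise)
  finally show ?thesis .
qed

text \<open>
  The observation as a function of the noise sequence itself, so that the noise can be integrated with
  respect to its law.
\<close>
definition observe :: "real \<Rightarrow> (nat \<Rightarrow> real^'p) \<Rightarrow> (nat \<Rightarrow> real^'p) \<Rightarrow> nat \<Rightarrow> real^'p" where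
  "observe \<epsilon> \<theta> X = (\<lambda>i\<in>{1..}. \<theta> i + \<epsilon> *\<^sub>R X i)"

lemma measurable_estimator_component:
  assumes "t \<in> estimators" "i \<ge> 1"
  shows "(\<lambda>y. t y i) \<in> borel_measurable (Pi\<^sub>M {1..} (\<lambda>_. borel))"
  using measurable_compose[OF assms(1)[unfolded estimators_def] measurable_component_singleton[of i]] assms(2)
  by simp

lemma measurable_observe:
  "observe \<epsilon> \<theta> \<in> measurable (Pi\<^sub>M {1..} (\<lambda>_. borel)) (Pi\<^sub>M {1..} (\<lambda>_. borel))"
  unfolding observe_def
proof (rule measurable_restrict)
  fix i :: nat assume "i \<in> {1..}"
  then have [measurable]: "(\<lambda>X. X i) \<in> borel_measurable (Pi\<^sub>M {1..} (\<lambda>_. borel))"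
    by (rule measurable_component_singleton)
  show "(\<lambda>X. \<theta> i + \<epsilon> *\<^sub>R X i) \<in> borel_measurable (Pi\<^sub>M {1..} (\<lambda>_. borel))" by measurable
qed

lemma measurable_signal [measurable]:
  "(\<lambda>\<tau>. signal J \<tau> i) \<in> borel_measurable (Pi\<^sub>M J (\<lambda>k. gauss (s k)))"
proof -
  have [measurable]: "(\<lambda>\<tau>. if (i, j) \<in> J then \<tau> (i, j) else 0) \<in> borel_measurable (Pi\<^sub>M J (\<lambda>k. gauss (s k)))" for j
  proof (cases "(i, j) \<in> J")
    case True
    then have "(\<lambda>\<tau>. \<tau> (i, j)) \<in> measurable (Pi\<^sub>M J (\<lambda>k. gauss (s k))) (gauss (s (i, j)))"
      by (rule measurable_component_singleton)
    with True show ?thesis by (simp add: measurable_cong_sets[OF refl sets_gauss])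
  qed simp
  show ?thesis unfolding signal_def by measurable
qed

lemma measurable_noise_component: "i \<ge> 1 \<Longrightarrow> (\<lambda>X. X i) \<in> borel_measurable (noise_law :: (nat \<Rightarrow> real^'p) measure)"
  using measurable_component_singleton[of i "{1..}" "\<lambda>_. mvn_std"]
  by (simp add: measurable_cong_sets[OF refl sets_mvn_std])

lemma measurable_observe_signal:
  "(\<lambda>p. observe \<epsilon> (signal J (fst p)) (snd p)) \<in>
    measurable (Pi\<^sub>M J (\<lambda>k. gauss (s k)) \<Otimes>\<^sub>M noise_law) (Pi\<^sub>M {1..} (\<lambda>_. borel))"
  unfolding observe_def
proof (rule measurable_restrict)
  fix i :: nat assume "i \<in> {1..}"
  then have [measurable]: "(\<lambda>X. X i) \<in> borel_measurable (noise_law :: (nat \<Rightarrow> real^'p) measure)"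
    by (intro measurable_noise_component) simp
  show "(\<lambda>p. signal J (fst p) i + \<epsilon> *\<^sub>R snd p i) \<in> borel_measurable (Pi\<^sub>M J (\<lambda>k. gauss (s k)) \<Otimes>\<^sub>M noise_law)"
    by measurable
qed

lemma risk_eq_noise_law:
  assumes t: "t \<in> estimators"
  shows "risk M \<xi> \<epsilon> Q \<theta> t = (\<integral>\<^sup>+X. loss Q \<theta> (t (observe \<epsilon> \<theta> X)) \<partial>noise_law)"
proof -
  have [measurable]: "(\<lambda>X. t (observe \<epsilon> \<theta> X) (Suc i)) \<in> borel_measurable (Pi\<^sub>M {1..} (\<lambda>_. borel))" for i
    by (rule measurable_compose[OF measurable_observe measurable_estimator_component[OF t]]) simp
  have "(\<integral>\<^sup>+X. loss Q \<theta> (t (observe \<epsilon> \<theta> X)) \<partial>noise_law) = (\<integral>\<^sup>+\<omega>. loss Q \<theta> (t (observe \<epsilon> \<theta> (\<lambda>i\<in>{1..}. \<xi> i \<omega>))) \<partial>M)"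
    unfolding distr_noise_sequence[symmetric]
  proof (rule nn_integral_distr)
    show "(\<lambda>\<omega>. \<lambda>i\<in>{1..}. \<xi> i \<omega>) \<in> measurable M (Pi\<^sub>M {1..} (\<lambda>_. borel))"
      by (rule measurable_restrict) simp
    show "(\<lambda>X. loss Q \<theta> (t (observe \<epsilon> \<theta> X))) \<in>
        borel_measurable (distr M (Pi\<^sub>M {1..} (\<lambda>_. borel)) (\<lambda>\<omega>. \<lambda>i\<in>{1..}. \<xi> i \<omega>))"
      unfolding loss_eq measurable_distr_eq1 by measurable
  qed
  also have "\<dots> = risk M \<xi> \<epsilon> Q \<theta> t"
    unfolding risk_def observation_def observe_def by (intro nn_integral_cong arg_cong2[where f="loss Q"] arg_cong[where f=t]) auto
  finally show ?thesis ..
qed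

lemma measurable_coordinate_error:
  assumes k: "(i0, j0) \<in> J" and i0: "i0 \<ge> 1" and t: "t \<in> estimators"
  shows "(\<lambda>p. ennreal ((u j0 \<bullet> t (observe \<epsilon> (signal J (fst p)) (snd p)) i0 - fst p (i0, j0))\<^sup>2))
    \<in> borel_measurable (Pi\<^sub>M J (\<lambda>k. gauss (s k)) \<Otimes>\<^sub>M noise_law)"
proof -
  note [measurable] = measurable_observe_signal[of \<epsilon> J s] measurable_estimator_component[OF t i0]
  have [measurable]: "(\<lambda>\<tau>. \<tau> (i0, j0)) \<in> borel_measurable (Pi\<^sub>M J (\<lambda>k. gauss (s k)))"
    using measurable_component_singleton[OF k, of "\<lambda>k. gauss (s k)"]
    by (simp add: measurable_cong_sets[OF refl sets_gauss])
  have "(\<lambda>p. t (observe \<epsilon> (signal J (fst p)) (snd p)) i0) \<in> borel_measurable (Pi\<^sub>M J (\<lambda>k. gauss (s k)) \<Otimes>\<^sub>M noise_law)"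
    by measurable
  then show ?thesis by measurable
qed

text \<open>
  All coordinates of the prior other than \<open>k = (i0, j0)\<close>, and the whole noise except its component along
  \<open>u j0\<close> at frequency \<open>i0\<close>, are frozen. After this component is resampled as \<open>z\<close>, the
  observation depends on the parameter \<open>x\<close> and on \<open>z\<close> only through \<open>x + \<epsilon> z\<close>: the estimate of the
  coordinate is a function \<open>T\<close> of this sum, and \<open>truncated_gaussian_bayes_risk\<close> applies.
\<close>
lemma coordinate_bayes_risk:
  assumes J: "J \<subseteq> {1..} \<times> UNIV" "finite J" and k: "(i0, j0) \<in> J" and s: "\<And>k. s k > 0"
    and t: "t \<in> estimators" and \<epsilon>: "\<epsilon> > 0" and g: "g > 0"
  defines "prior \<equiv> Pi\<^sub>M J (\<lambda>k. gauss (s k))"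
  defines "v \<equiv> (s (i0, j0))\<^sup>2 * \<epsilon>\<^sup>2 / ((s (i0, j0))\<^sup>2 + \<epsilon>\<^sup>2)"
  assumes E[measurable]: "Measurable.pred prior E"
  shows "ennreal (v * (1 - 3 * g / 2)) \<le>
    (\<integral>\<^sup>+\<tau>. (\<integral>\<^sup>+X. indicator {\<tau>. E \<tau>} \<tau> *
        ennreal ((u j0 \<bullet> t (observe \<epsilon> (signal J \<tau>) X) i0 - \<tau> (i0, j0))\<^sup>2) \<partial>noise_law) \<partial>prior)
    + ennreal (v / (2 * g)) * emeasure prior {\<tau> \<in> space prior. \<not> E \<tau>}"
proof -
  let ?k = "(i0, j0)"
  define J' where "J' = J - {?k}"
  have J_eq: "insert ?k J' = J" using k by (auto simp: J'_def)
  have i0: "i0 \<ge> 1" using J k by auto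
  interpret N: prob_space "noise_law :: (nat \<Rightarrow> real^'p) measure"
    by (rule prob_space_PiM[OF prob_space_mvn_std])
  interpret g1: prob_space "gauss 1" by (rule prob_space_gauss) simp
  interpret gk: prob_space "gauss (s ?k)" by (rule prob_space_gauss[OF s])
  interpret rest: prob_space "Pi\<^sub>M J' (\<lambda>k. gauss (s k))" by (rule prob_space_PiM[OF prob_space_gauss[OF s]])
  note [measurable] = measurable_estimator_component[OF t i0]
  define G where "G \<tau> X = indicator {\<tau>. E \<tau>} \<tau> *
        ennreal ((u j0 \<bullet> t (observe \<epsilon> (signal J \<tau>) X) i0 - \<tau> (i0, j0))\<^sup>2)" for \<tau> X
  have ind[measurable]: "(\<lambda>\<tau>. indicator {\<tau>. P \<tau>} \<tau> :: ennreal) \<in> borel_measurable prior"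
    if "Measurable.pred prior P" for P
    using that unfolding indicator_def by measurable
  have G: "(\<lambda>p. G (fst p) (snd p)) \<in> borel_measurable (prior \<Otimes>\<^sub>M noise_law)"
    unfolding G_def
    by (intro borel_measurable_times_ennreal measurable_compose[OF measurable_fst ind[OF E]]
        measurable_coordinate_error[OF k i0 t, of \<epsilon> s, folded prior_def])
  define H where "H \<tau> = (\<integral>\<^sup>+X. G \<tau> X \<partial>noise_law)" for \<tau>
  have H[measurable]: "H \<in> borel_measurable prior"
    unfolding H_def by (rule N.borel_measurable_nn_integral) (simp only: split_beta' G)
  define \<Phi> where "\<Phi> \<tau> = H \<tau> + ennreal (v / (2 * g)) * indicator {\<tau>. \<not> E \<tau>} \<tau>" for \<tau>
  have \<Phi>[measurable]: "\<Phi> \<in> borel_measurable prior" unfolding \<Phi>_def by measurable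
  have inner: "ennreal (v * (1 - 3 * g / 2)) \<le> (\<integral>\<^sup>+x. \<Phi> (\<tau>'(?k := x)) \<partial>gauss (s ?k))"
    if \<tau>': "\<tau>' \<in> space (Pi\<^sub>M J' (\<lambda>k. gauss (s k)))" for \<tau>'
  proof -
    have upd[measurable]: "(\<lambda>x. \<tau>'(?k := x)) \<in> measurable borel prior"
    proof -
      have "(\<lambda>x. \<tau>'(?k := x)) \<in> measurable (gauss (s ?k)) (Pi\<^sub>M (insert ?k J') (\<lambda>k. gauss (s k)))"
        using \<tau>' by (intro measurable_fun_upd[where J = J']) auto
      then show ?thesis by (simp add: J_eq prior_def measurable_cong_sets[OF sets_gauss refl])
    qed
    define A where "A = {x. E (\<tau>'(?k := x))}"
    have A: "A \<in> sets borel"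
      using measurable_compose[OF upd E] by (simp add: A_def pred_def)
    \<comment> \<open>The observation when the frozen data are \<open>\<tau>'\<close> and \<open>X\<close> and the coordinate \<open>(i0, j0)\<close> is observed as \<open>y\<close>.\<close>
    define base where "base X y = (\<lambda>i\<in>{1..}. signal J (\<tau>'(?k := 0)) i + \<epsilon> *\<^sub>R X i
      + (if i = i0 then (y - \<epsilon> * (u j0 \<bullet> X i0)) *\<^sub>R u j0 else 0))" for X y
    define T where "T X y = u j0 \<bullet> t (base X y) i0" for X y
    have base[measurable]: "(\<lambda>p. base (fst p) (snd p)) \<in> measurable (noise_law \<Otimes>\<^sub>M borel) (Pi\<^sub>M {1..} (\<lambda>_. borel))"
      unfolding base_def
    proof (rule measurable_restrict)
      fix i :: nat assume "i \<in> {1..}"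
      then have [measurable]: "(\<lambda>X. X i) \<in> borel_measurable (noise_law :: (nat \<Rightarrow> real^'p) measure)"
        "(\<lambda>X. X i0) \<in> borel_measurable (noise_law :: (nat \<Rightarrow> real^'p) measure)"
        using i0 by (auto intro!: measurable_noise_component)
      show "(\<lambda>p. signal J (\<tau>'(?k := 0)) i + \<epsilon> *\<^sub>R fst p i + (if i = i0 then (snd p - \<epsilon> * (u j0 \<bullet> fst p i0)) *\<^sub>R u j0 else 0))
         \<in> borel_measurable (noise_law \<Otimes>\<^sub>M borel)"
        by measurable
    qed
    have T[measurable]: "(\<lambda>p. T (fst p) (snd p)) \<in> borel_measurable (noise_law \<Otimes>\<^sub>M borel)"
      unfolding T_def by measurable
    have TX: "T X \<in> borel_measurable borel" if "X \<in> space noise_law" for X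
      using measurable_compose[OF measurable_Pair1'[OF that] T] by simp
    have obs: "observe \<epsilon> (signal J (\<tau>'(?k := x))) (X(i0 := X i0 + (z - u j0 \<bullet> X i0) *\<^sub>R u j0)) = base X (x + \<epsilon> * z)" for x X z
      unfolding observe_def base_def
      by (rule restrict_ext) (subst signal_upd[OF k], simp add: algebra_simps)
    have G_eq: "G (\<tau>'(?k := x)) (X(i0 := X i0 + (z - u j0 \<bullet> X i0) *\<^sub>R u j0)) =
      indicator A x * ennreal ((T X (x + \<epsilon> * z) - x)\<^sup>2)" for x X z
      unfolding G_def obs T_def A_def by (simp add: indicator_def)
    have mA: "(\<lambda>p. indicator A (fst p) * ennreal ((T (snd (snd p)) (fst p + \<epsilon> * fst (snd p)) - fst p)\<^sup>2)) \<in> borel_measurable (borel \<Otimes>\<^sub>M (borel \<Otimes>\<^sub>M noise_law))"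
    proof -
      have "(\<lambda>p. T (fst (snd (snd p), fst p + \<epsilon> * fst (snd p))) (snd (snd (snd p), fst p + \<epsilon> * fst (snd p)))) \<in> borel_measurable (borel \<Otimes>\<^sub>M (borel \<Otimes>\<^sub>M noise_law))"
        by (rule measurable_compose[OF _ T]) measurable
      then have [measurable]: "(\<lambda>p. T (snd (snd p)) (fst p + \<epsilon> * fst (snd p))) \<in> borel_measurable (borel \<Otimes>\<^sub>M (borel \<Otimes>\<^sub>M noise_law))"
        by simp
      note [measurable] = A
      show ?thesis by measurable
    qed
    let ?mse = "\<lambda>X x. \<integral>\<^sup>+z. indicator A x * ennreal ((T X (x + \<epsilon> * z) - x)\<^sup>2) \<partial>gauss 1"
    have mI: "(\<lambda>(X, x). ?mse X x) \<in> borel_measurable (noise_law \<Otimes>\<^sub>M gauss (s ?k))"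
      unfolding split_beta'
    proof (rule g1.borel_measurable_nn_integral)
      have "(\<lambda>r. (snd (fst r), snd r, fst (fst r))) \<in> measurable (((noise_law :: (nat \<Rightarrow> real^'p) measure) \<Otimes>\<^sub>M gauss (s ?k)) \<Otimes>\<^sub>M gauss 1) (borel \<Otimes>\<^sub>M (borel \<Otimes>\<^sub>M noise_law))"
        by measurable
      from measurable_compose[OF this mA]
      show "(\<lambda>(q, z). indicator A (snd q) * ennreal ((T (fst q) (snd q + \<epsilon> * z) - snd q)\<^sup>2)) \<in> borel_measurable ((noise_law \<Otimes>\<^sub>M gauss (s ?k)) \<Otimes>\<^sub>M gauss 1)"
        by (simp add: split_beta')
    qed
    have H_eq: "H (\<tau>'(?k := x)) = (\<integral>\<^sup>+X. ?mse X x \<partial>noise_law)" for x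
    proof -
      have "\<tau>'(?k := x) \<in> space prior" using measurable_space[OF upd, of x] by simp
      from measurable_compose[OF measurable_Pair1'[OF this] G]
      have "G (\<tau>'(?k := x)) \<in> borel_measurable noise_law" by simp
      from noise_resample_direction[OF prob_space_mvn_std norm_u[of j0] i0 this]
      show ?thesis unfolding H_def G_eq .
    qed
    have fubini: "(\<integral>\<^sup>+x. H (\<tau>'(?k := x)) \<partial>gauss (s ?k)) =
      (\<integral>\<^sup>+X. (\<integral>\<^sup>+x. ?mse X x \<partial>gauss (s ?k)) \<partial>noise_law)"
      unfolding H_eq
    proof (rule pair_sigma_finite.Fubini')
      show "pair_sigma_finite (noise_law :: (nat \<Rightarrow> real^'p) measure) (gauss (s ?k))" ..
      show "(\<lambda>(X, x). ?mse X x) \<in> borel_measurable (noise_law \<Otimes>\<^sub>M gauss (s ?k))"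
        by (rule mI)
    qed
    have "ennreal (v * (1 - 3 * g / 2)) = integral\<^sup>N (noise_law :: (nat \<Rightarrow> real^'p) measure) (\<lambda>X. ennreal (v * (1 - 3 * g / 2)))"
      by (simp add: N.emeasure_space_1 del: One_nat_def)
    also have "\<dots> \<le> (\<integral>\<^sup>+X. (\<integral>\<^sup>+x. ?mse X x \<partial>gauss (s ?k))
      + ennreal (v / (2 * g)) * emeasure (gauss (s ?k)) (- A) \<partial>noise_law)"
      unfolding v_def by (intro nn_integral_mono truncated_gaussian_bayes_risk s \<epsilon> g A TX)
    also have "\<dots> = (\<integral>\<^sup>+X. (\<integral>\<^sup>+x. ?mse X x \<partial>gauss (s ?k)) \<partial>noise_law)
      + ennreal (v / (2 * g)) * emeasure (gauss (s ?k)) (- A)"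
    proof (subst nn_integral_add)
      show "(\<lambda>X. \<integral>\<^sup>+x. ?mse X x \<partial>gauss (s ?k)) \<in> borel_measurable noise_law"
        by (rule gk.borel_measurable_nn_integral[OF mI])
    qed (simp_all add: N.emeasure_space_1 del: One_nat_def)
    also note fubini[symmetric]
    also have "(\<integral>\<^sup>+x. H (\<tau>'(?k := x)) \<partial>gauss (s ?k)) + ennreal (v / (2 * g)) * emeasure (gauss (s ?k)) (- A) = (\<integral>\<^sup>+x. \<Phi> (\<tau>'(?k := x)) \<partial>gauss (s ?k))"
    proof -
      have \<Phi>_upd: "\<Phi> (\<tau>'(?k := x)) = H (\<tau>'(?k := x)) + ennreal (v / (2 * g)) * indicator (- A) x" for x
        by (simp add: \<Phi>_def A_def indicator_def)
      have mH: "(\<lambda>x. H (\<tau>'(?k := x))) \<in> borel_measurable (gauss (s ?k))"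
        using measurable_compose[OF upd H] by (simp only: measurable_cong_sets[OF sets_gauss refl])
      have Ac: "- A \<in> sets (gauss (s ?k))" using A by (simp add: borel_comp)
      then have "(\<lambda>x. ennreal (v / (2 * g)) * indicator (- A) x) \<in> borel_measurable (gauss (s ?k))"
        by (intro borel_measurable_times_ennreal measurable_const borel_measurable_indicator) auto
      from nn_integral_add[OF mH this] show ?thesis
        unfolding \<Phi>_upd nn_integral_cmult_indicator[OF Ac] by simp
    qed
    finally show ?thesis .
  qed
  have "ennreal (v * (1 - 3 * g / 2)) = (\<integral>\<^sup>+\<tau>'. ennreal (v * (1 - 3 * g / 2)) \<partial>Pi\<^sub>M J' (\<lambda>k. gauss (s k)))"
    by (simp add: rest.emeasure_space_1)
  also have "\<dots> \<le> (\<integral>\<^sup>+\<tau>'. (\<integral>\<^sup>+x. \<Phi> (\<tau>'(?k := x)) \<partial>gauss (s ?k)) \<partial>Pi\<^sub>M J' (\<lambda>k. gauss (s k)))"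
    by (intro nn_integral_mono inner)
  also have "\<dots> = (\<integral>\<^sup>+\<tau>. \<Phi> \<tau> \<partial>prior)"
    using nn_integral_PiM_insert[where M = "\<lambda>k. gauss (s k)" and i = ?k and I = J', unfolded J_eq, folded prior_def, OF prob_space_gauss[OF s] \<Phi>]
    by simp
  also have "\<dots> = (\<integral>\<^sup>+\<tau>. H \<tau> \<partial>prior) + ennreal (v / (2 * g)) * (\<integral>\<^sup>+\<tau>. indicator {\<tau>. \<not> E \<tau>} \<tau> \<partial>prior)"
    unfolding \<Phi>_def by (simp add: nn_integral_add nn_integral_cmult)
  also have "(\<integral>\<^sup>+\<tau>. indicator {\<tau>. \<not> E \<tau>} \<tau> \<partial>prior) = (\<integral>\<^sup>+\<tau>. indicator {\<tau> \<in> space prior. \<not> E \<tau>} \<tau> \<partial>prior)"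
    by (intro nn_integral_cong) (simp add: indicator_def)
  also have "\<dots> = emeasure prior {\<tau> \<in> space prior. \<not> E \<tau>}"
    by (rule nn_integral_indicator) measurable
  finally show ?thesis unfolding H_def G_def .
qed

text \<open>
  Where \<open>E\<close> holds the signal belongs to the ellipsoid, so its risk is at most the supremum; the prior
  has total mass one.
\<close>
lemma sum_coordinate_errors_le:
  assumes J: "J \<subseteq> {1..} \<times> UNIV" "finite J" and t: "t \<in> estimators" and s: "\<And>k. s k > 0"
  defines "prior \<equiv> Pi\<^sub>M J (\<lambda>k. gauss (s k))"
  assumes E[measurable]: "Measurable.pred prior E"
    and E_mem: "\<And>\<tau>. E \<tau> \<Longrightarrow> signal J \<tau> \<in> sob_ellipsoid \<beta> Q"
  shows "(\<Sum>k\<in>J. ennreal (l (snd k)) * (\<integral>\<^sup>+\<tau>. (\<integral>\<^sup>+X. indicator {\<tau>. E \<tau>} \<tau> *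
      ennreal ((u (snd k) \<bullet> t (observe \<epsilon> (signal J \<tau>) X) (fst k) - \<tau> k)\<^sup>2) \<partial>noise_law) \<partial>prior))
    \<le> (SUP \<theta>\<in>sob_ellipsoid \<beta> Q. risk M \<xi> \<epsilon> Q \<theta> t)"
proof -
  interpret N: prob_space "noise_law :: (nat \<Rightarrow> real^'p) measure"
    by (rule prob_space_PiM[OF prob_space_mvn_std])
  interpret prior: prob_space prior unfolding prior_def by (rule prob_space_PiM[OF prob_space_gauss[OF s]])
  let ?Z = "\<lambda>k \<tau> X. ennreal ((u (snd k) \<bullet> t (observe \<epsilon> (signal J \<tau>) X) (fst k) - \<tau> k)\<^sup>2)"
  let ?S = "SUP \<theta>\<in>sob_ellipsoid \<beta> Q. risk M \<xi> \<epsilon> Q \<theta> t"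
  have Z: "(\<lambda>p. ?Z k (fst p) (snd p)) \<in> borel_measurable (prior \<Otimes>\<^sub>M noise_law)" if "k \<in> J" for k
    using measurable_coordinate_error[of "fst k" "snd k" J t] that J t by (auto simp: prior_def)
  have ind: "(\<lambda>\<tau>. indicator {\<tau>. E \<tau>} \<tau> :: ennreal) \<in> borel_measurable prior"
    unfolding indicator_def by measurable
  have G: "(\<lambda>p. indicator {\<tau>. E \<tau>} (fst p) * ?Z k (fst p) (snd p)) \<in> borel_measurable (prior \<Otimes>\<^sub>M noise_law)" if "k \<in> J" for k
    by (rule borel_measurable_times_ennreal[OF measurable_compose[OF measurable_fst ind] Z[OF that]])
  have G1: "(\<lambda>X. indicator {\<tau>. E \<tau>} \<tau> * ?Z k \<tau> X) \<in> borel_measurable noise_law" if "k \<in> J" "\<tau> \<in> space prior" for k \<tau>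
    using measurable_compose[OF measurable_Pair1'[OF that(2)] G[OF that(1)]] by simp
  have G2: "(\<lambda>\<tau>. \<integral>\<^sup>+X. indicator {\<tau>. E \<tau>} \<tau> * ?Z k \<tau> X \<partial>noise_law) \<in> borel_measurable prior" if "k \<in> J" for k
    by (rule N.borel_measurable_nn_integral) (simp only: split_beta' G[OF that])
  have "(\<Sum>k\<in>J. ennreal (l (snd k)) * (\<integral>\<^sup>+\<tau>. (\<integral>\<^sup>+X. indicator {\<tau>. E \<tau>} \<tau> * ?Z k \<tau> X \<partial>noise_law) \<partial>prior))
    = (\<integral>\<^sup>+\<tau>. (\<Sum>k\<in>J. ennreal (l (snd k)) * (\<integral>\<^sup>+X. indicator {\<tau>. E \<tau>} \<tau> * ?Z k \<tau> X \<partial>noise_law)) \<partial>prior)"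
    using G2 by (subst nn_integral_sum) (auto simp: nn_integral_cmult intro!: borel_measurable_times_ennreal)
  also have "\<dots> \<le> (\<integral>\<^sup>+\<tau>. ?S \<partial>prior)"
  proof (rule nn_integral_mono)
    fix \<tau> assume \<tau>: "\<tau> \<in> space prior"
    show "(\<Sum>k\<in>J. ennreal (l (snd k)) * (\<integral>\<^sup>+X. indicator {\<tau>. E \<tau>} \<tau> * ?Z k \<tau> X \<partial>noise_law)) \<le> ?S"
    proof (cases "E \<tau>")
      case True
      have "(\<Sum>k\<in>J. ennreal (l (snd k)) * (\<integral>\<^sup>+X. indicator {\<tau>. E \<tau>} \<tau> * ?Z k \<tau> X \<partial>noise_law))
        = (\<integral>\<^sup>+X. (\<Sum>k\<in>J. ennreal (l (snd k)) * (indicator {\<tau>. E \<tau>} \<tau> * ?Z k \<tau> X)) \<partial>noise_law)"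
        using G1[OF _ \<tau>] by (subst nn_integral_sum) (auto simp: nn_integral_cmult intro!: borel_measurable_times_ennreal)
      also have "\<dots> \<le> (\<integral>\<^sup>+X. loss Q (signal J \<tau>) (t (observe \<epsilon> (signal J \<tau>) X)) \<partial>noise_law)"
      proof (rule nn_integral_mono)
        fix X
        have "(\<Sum>k\<in>J. ennreal (l (snd k)) * (indicator {\<tau>. E \<tau>} \<tau> * ?Z k \<tau> X))
          = (\<Sum>k\<in>J. ennreal (l (snd k) * (u (snd k) \<bullet> (t (observe \<epsilon> (signal J \<tau>) X) (fst k) - signal J \<tau> (fst k)))\<^sup>2))"
          using True by (intro sum.cong) (auto simp: inner_diff_right inner_signal ennreal_mult less_imp_le[OF l_pos])
        also have "\<dots> \<le> loss Q (signal J \<tau>) (t (observe \<epsilon> (signal J \<tau>) X))"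
          by (rule loss_ge[OF J])
        finally show "(\<Sum>k\<in>J. ennreal (l (snd k)) * (indicator {\<tau>. E \<tau>} \<tau> * ?Z k \<tau> X)) \<le> loss Q (signal J \<tau>) (t (observe \<epsilon> (signal J \<tau>) X))" .
      qed
      also have "\<dots> = risk M \<xi> \<epsilon> Q (signal J \<tau>) t" by (rule risk_eq_noise_law[OF t, symmetric])
      also have "\<dots> \<le> ?S" by (rule SUP_upper[OF E_mem[OF True]])
      finally show ?thesis .
    qed simp
  qed
  also have "\<dots> = ?S" by (simp add: prior.emeasure_space_1)
  finally show ?thesis .
qed

text \<open>
  The sum of the coordinate bounds, with the Chernoff bound for the event that the prior leaves the
  ellipsoid. The weight \<open>g\<close> of \<open>coordinate_bayes_risk\<close> is taken to be \<open>\<delta>\<close>.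
\<close>
lemma bayes_lower_bound:
  assumes J: "J \<subseteq> {1..} \<times> UNIV" "finite J" and s: "\<And>k. s k > 0"
    and t: "t \<in> estimators" and \<epsilon>: "\<epsilon> > 0" and \<delta>: "0 < \<delta>" "\<delta> \<le> 1" and m: "m > 0"
    and le_m: "\<And>k. k \<in> J \<Longrightarrow> (sob_coeff \<beta> (fst k))\<^sup>2 / l (snd k) * (s k)\<^sup>2 \<le> m"
    and mean: "(\<Sum>k\<in>J. (sob_coeff \<beta> (fst k))\<^sup>2 / l (snd k) * (s k)\<^sup>2) \<le> 1 - \<delta>"
  shows "ennreal ((\<Sum>k\<in>J. l (snd k) * ((s k)\<^sup>2 * \<epsilon>\<^sup>2 / ((s k)\<^sup>2 + \<epsilon>\<^sup>2))) * (1 - 3 * \<delta> / 2 - exp (- \<delta>\<^sup>2 / (16 * m)) / (2 * \<delta>)))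
     \<le> (SUP \<theta>\<in>sob_ellipsoid \<beta> Q. risk M \<xi> \<epsilon> Q \<theta> t)"
    (is "_ \<le> ?S")
proof -
  define prior where "prior = Pi\<^sub>M J (\<lambda>k. gauss (s k))"
  define E where "E \<tau> \<longleftrightarrow> (\<Sum>k\<in>J. (sob_coeff \<beta> (fst k))\<^sup>2 / l (snd k) * (\<tau> k)\<^sup>2) \<le> 1" for \<tau>
  define v where "v k = (s k)\<^sup>2 * \<epsilon>\<^sup>2 / ((s k)\<^sup>2 + \<epsilon>\<^sup>2)" for k
  define p where "p = exp (- \<delta>\<^sup>2 / (16 * m))"
  define W where "W = (\<Sum>k\<in>J. l (snd k) * v k)"
  have v: "v k \<ge> 0" for k by (simp add: v_def)
  have l: "l j \<ge> 0" for j using l_pos[of j] by simp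
  have W: "W \<ge> 0" unfolding W_def by (intro sum_nonneg mult_nonneg_nonneg l v)
  have E: "Measurable.pred prior E"
    unfolding E_def prior_def by measurable
  let ?B = "\<lambda>k. \<integral>\<^sup>+\<tau>. (\<integral>\<^sup>+X. indicator {\<tau>. E \<tau>} \<tau> *
      ennreal ((u (snd k) \<bullet> t (observe \<epsilon> (signal J \<tau>) X) (fst k) - \<tau> k)\<^sup>2) \<partial>noise_law) \<partial>prior"
  have tail: "emeasure prior {\<tau> \<in> space prior. \<not> E \<tau>} \<le> ennreal p"
    unfolding prior_def E_def p_def
    by (rule gaussian_quadratic_form_tail[OF J(2) s _ \<delta> m le_m mean]) (simp add: l)
  have coord: "ennreal (l (snd k) * (v k * (1 - 3 * \<delta> / 2))) \<le> ennreal (l (snd k)) * ?B k + ennreal (l (snd k) * (v k / (2 * \<delta>)) * p)"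
    if "k \<in> J" for k
  proof -
    have "ennreal (v k * (1 - 3 * \<delta> / 2)) \<le> ?B k + ennreal (v k / (2 * \<delta>)) * emeasure prior {\<tau> \<in> space prior. \<not> E \<tau>}"
      using coordinate_bayes_risk[OF J, of "fst k" "snd k" s t \<epsilon> \<delta> E] that s t \<epsilon> \<delta> E
      by (simp add: prior_def v_def)
    also have "\<dots> \<le> ?B k + ennreal (v k / (2 * \<delta>)) * ennreal p"
      by (intro add_left_mono mult_left_mono tail) simp
    finally have "ennreal (l (snd k)) * ennreal (v k * (1 - 3 * \<delta> / 2)) \<le> ennreal (l (snd k)) * (?B k + ennreal (v k / (2 * \<delta>)) * ennreal p)"
      by (rule mult_left_mono) simp
    moreover have "ennreal (l (snd k)) * (ennreal (v k / (2 * \<delta>)) * ennreal p) = ennreal (l (snd k) * (v k / (2 * \<delta>)) * p)"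
    proof -
      have "ennreal a * (ennreal b * ennreal c) = ennreal (a * b * c)" if "0 \<le> a" "0 \<le> b" "0 \<le> c" for a b c
        using that by (simp add: ennreal_mult mult.assoc)
      then show ?thesis using \<delta> v[of k] l by (simp add: p_def)
    qed
    ultimately show ?thesis
      using l[of "snd k"] by (simp add: ennreal_mult' distrib_left)
  qed
  have S: "ennreal (W * (1 - 3 * \<delta> / 2)) \<le> ?S + ennreal (W / (2 * \<delta>) * p)"
  proof (cases "1 - 3 * \<delta> / 2 \<ge> 0")
    case True
    have "ennreal (W * (1 - 3 * \<delta> / 2)) = (\<Sum>k\<in>J. ennreal (l (snd k) * (v k * (1 - 3 * \<delta> / 2))))"
      unfolding W_def sum_distrib_right using True by (subst sum_ennreal) (simp_all add: l v mult.assoc)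
    also have "\<dots> \<le> (\<Sum>k\<in>J. ennreal (l (snd k)) * ?B k + ennreal (l (snd k) * (v k / (2 * \<delta>)) * p))"
      by (intro sum_mono coord)
    also have "\<dots> = (\<Sum>k\<in>J. ennreal (l (snd k)) * ?B k) + ennreal (W / (2 * \<delta>) * p)"
    proof -
      have "(\<Sum>k\<in>J. ennreal (l (snd k) * (v k / (2 * \<delta>)) * p)) = ennreal (\<Sum>k\<in>J. l (snd k) * (v k / (2 * \<delta>)) * p)"
        using \<delta> l v by (intro sum_ennreal) (simp add: p_def)
      also have "(\<Sum>k\<in>J. l (snd k) * (v k / (2 * \<delta>)) * p) = W / (2 * \<delta>) * p"
        by (simp add: W_def sum_divide_distrib sum_distrib_right)
      finally show ?thesis by (simp add: sum.distrib)
    qed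
    also have "(\<Sum>k\<in>J. ennreal (l (snd k)) * ?B k) \<le> ?S"
      unfolding prior_def
      by (rule sum_coordinate_errors_le[OF J t s E[unfolded prior_def]])
        (rule signal_mem_ellipsoid[OF J], simp add: E_def)
    finally show ?thesis by (simp add: add_right_mono)
  next
    case False
    then have "W * (1 - 3 * \<delta> / 2) \<le> 0" using W by (simp add: mult_nonneg_nonpos)
    then show ?thesis by (simp add: ennreal_neg)
  qed
  have "ennreal (W * (1 - 3 * \<delta> / 2 - p / (2 * \<delta>))) \<le> ?S"
  proof (cases ?S)
    case (real r)
    have "ennreal (W * (1 - 3 * \<delta> / 2)) \<le> ennreal (r + W / (2 * \<delta>) * p)"
      using S real W \<delta> by (simp add: p_def)
    then have "W * (1 - 3 * \<delta> / 2) \<le> r + W / (2 * \<delta>) * p"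
      using real W \<delta> by (subst (asm) ennreal_le_iff) (auto simp: p_def)
    then have "W * (1 - 3 * \<delta> / 2 - p / (2 * \<delta>)) \<le> r" by (simp add: algebra_simps)
    then show ?thesis using real by (simp add: ennreal_leI)
  next
    case top
    then show ?thesis by (simp only: top_greatest)
  qed
  then show ?thesis by (simp add: W_def v_def p_def)
qed

text \<open>
  The prior variances \<open>q\<close> are \<open>1 - \<delta>\<close> times those of the least favourable prior \<open>\<epsilon>\<^sup>2 c / (1 - c)\<close>. For the
  latter the quadratic form of the ellipsoid has mean \<open>1\<close> by the equation for \<open>\<kappa>\<close>, and the posterior
  variance is \<open>\<epsilon>\<^sup>2 c\<close>; shrinking the prior variance by a factor shrinks the posterior variance by at most
  that factor. The frequency \<open>1\<close> has coefficient zero and is left out, which accounts for the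
  subtracted trace of \<open>Q\<close>.
\<close>
lemma pinsker_lower_bound:
  assumes \<epsilon>: "\<epsilon> > 0" and \<kappa>: "\<kappa> > 0" and eq: "pinsker_eq \<beta> Q \<epsilon> \<kappa>"
    and t: "t \<in> estimators" and \<delta>: "0 < \<delta>" "\<delta> < 1"
  defines "m \<equiv> \<epsilon>\<^sup>2 / \<kappa>\<^sup>2 * (\<Sum>j\<in>UNIV. l j)"
  assumes r: "1 - 3 * \<delta> / 2 - exp (- \<delta>\<^sup>2 / (16 * m)) / (2 * \<delta>) \<ge> 0"
  shows "ennreal ((1 - \<delta>) * (\<epsilon>\<^sup>2 * (total_shrink \<beta> l \<kappa> - (\<Sum>j\<in>UNIV. l j))) * (1 - 3 * \<delta> / 2 - exp (- \<delta>\<^sup>2 / (16 * m)) / (2 * \<delta>)))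
     \<le> (SUP \<theta>\<in>sob_ellipsoid \<beta> Q. risk M \<xi> \<epsilon> Q \<theta> t)"
proof -
  let ?a = "sob_coeff \<beta>" and ?c = "\<lambda>i j. shrink \<beta> (\<kappa> / l j) i"
  let ?A = "\<lambda>k. ?a (fst k)" and ?C = "\<lambda>k. ?c (fst k) (snd k)"
  have lk: "\<kappa> / l j > 0" for j using \<kappa> l_pos[of j] by simp
  define n where "n = Max (range (\<lambda>j. 2 * cutoff \<beta> (\<kappa> / l j) + 1))"
  have n: "2 * cutoff \<beta> (\<kappa> / l j) + 1 \<le> n" for j unfolding n_def by (rule Max_ge) auto
  have n1: "n \<ge> 1" using n by (metis add_leD2)
  have c0: "?c i j = 0" if "i > n" for i j
  proof -
    have "i = Suc (i - 1)" "i - 1 \<ge> n" using that by auto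
    then show ?thesis using shrink_eq_0[OF \<beta>_pos lk, of j "i - 1"] n[of j] by (metis le_trans)
  qed
  define J where "J = {k \<in> {2..n} \<times> UNIV. ?C k > 0}"
  have J: "J \<subseteq> {1..} \<times> UNIV" "finite J" by (auto simp: J_def)
  have sumJ: "(\<Sum>k\<in>J. f (fst k) (snd k) * ?C k) = (\<Sum>j\<in>UNIV. \<Sum>i=2..n. f i j * ?c i j)" for f :: "nat \<Rightarrow> 'p \<Rightarrow> real"
  proof -
    have "(\<Sum>k\<in>J. f (fst k) (snd k) * ?C k) = (\<Sum>k\<in>{2..n} \<times> UNIV. f (fst k) (snd k) * ?C k)"
      by (rule sum.mono_neutral_left) (auto simp: J_def not_less intro: antisym shrink_nonneg)
    also have "\<dots> = (\<Sum>i=2..n. \<Sum>j\<in>UNIV. f i j * ?c i j)"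
      by (simp add: sum.cartesian_product split_beta')
    finally show ?thesis by (subst sum.swap)
  qed
  \<comment> \<open>Separates the frequency \<open>1\<close>, on which no prior is put.\<close>
  have split: "(\<Sum>i<n. f (Suc i)) = f 1 + (\<Sum>i=2..n. f i)" for f :: "nat \<Rightarrow> real"
  proof -
    have "(\<Sum>i<n. f (Suc i)) = (\<Sum>i=1..n. f i)"
      by (rule sum.reindex_bij_witness[of _ "\<lambda>i. i - 1" Suc]) auto
    also have "\<dots> = f 1 + (\<Sum>i=2..n. f i)"
      using n1 by (simp add: sum.atLeast_Suc_atMost numeral_2_eq_2)
    finally show ?thesis .
  qed
  have a1: "?a 1 = 0" and c1: "?c 1 j = 1" for j by (simp_all add: shrink_def sob_coeff_def)
  have TS: "(\<Sum>k\<in>J. l (snd k) * ?C k) = total_shrink \<beta> l \<kappa> - (\<Sum>j\<in>UNIV. l j)"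
  proof -
    have "shrink_sum \<beta> (\<kappa> / l j) = 1 + (\<Sum>i=2..n. ?c i j)" for j
      using sums_unique[OF shrink_sums[OF \<beta>_pos lk n, of "\<lambda>_. 1"]] c1 split[of "\<lambda>i. ?c i j"]
      by (simp add: shrink_sum_def)
    then have "total_shrink \<beta> l \<kappa> = (\<Sum>j\<in>UNIV. l j) + (\<Sum>j\<in>UNIV. \<Sum>i=2..n. l j * ?c i j)"
      by (simp add: total_shrink_def distrib_left sum.distrib sum_distrib_left)
    then show ?thesis using sumJ[of "\<lambda>i j. l j"] by simp
  qed
  have TW: "(\<Sum>k\<in>J. ?A k * ?C k) = total_weighted_shrink \<beta> l \<kappa>"
  proof -
    have "weighted_shrink_sum \<beta> (\<kappa> / l j) = (\<Sum>i=2..n. ?a i * ?c i j)" for j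
      using sums_unique[OF shrink_sums[OF \<beta>_pos lk n, of "\<lambda>i. ?a (Suc i)" j]] a1 split[of "\<lambda>i. ?a i * ?c i j"]
      by (simp add: weighted_shrink_sum_def)
    then show ?thesis using sumJ[of "\<lambda>i j. ?a i"] by (simp add: total_weighted_shrink_def)
  qed
  have Jk: "?A k > 0" "?C k = 1 - ?A k * (\<kappa> / l (snd k))"
    "0 < ?C k" "?C k < 1" if "k \<in> J" for k
  proof -
    show a: "?A k > 0" using that by (auto simp: J_def intro: sob_coeff_pos)
    show c: "0 < ?C k" using that by (simp add: J_def)
    then show e: "?C k = 1 - ?A k * (\<kappa> / l (snd k))"
      by (auto simp: shrink_def max_def split: if_splits)
    show "?C k < 1" unfolding e using mult_pos_pos[OF a lk[of "snd k"]] by linarith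
  qed
  define q where "q k = (1 - \<delta>) * \<epsilon>\<^sup>2 * (?C k / (1 - ?C k))" for k
  define s where "s k = (if k \<in> J then sqrt (q k) else 1)" for k
  have q: "q k > 0" if "k \<in> J" for k
    unfolding q_def using Jk(3,4)[OF that] \<delta> \<epsilon> by (intro mult_pos_pos divide_pos_pos) auto
  have s: "s k > 0" for k using q[of k] by (simp add: s_def)
  have s2: "(s k)\<^sup>2 = q k" if "k \<in> J" for k using q[OF that] that by (simp add: s_def)
  have ws: "(?A k)\<^sup>2 / l (snd k) * (s k)\<^sup>2 = (1 - \<delta>) * (\<epsilon>\<^sup>2 / \<kappa> * (?A k * ?C k))" if "k \<in> J" for k
  proof -
    have l: "l (snd k) > 0" by (rule l_pos)
    have a: "?A k > 0" by (rule Jk[OF that])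
    have "(s k)\<^sup>2 = (1 - \<delta>) * \<epsilon>\<^sup>2 * (?C k / (?A k * (\<kappa> / l (snd k))))"
      using Jk(2)[OF that] by (simp add: s2[OF that] q_def)
    then show ?thesis using l a \<kappa> by (simp add: power2_eq_square)
  qed
  have L: "l j \<le> (\<Sum>j\<in>UNIV. l j)" for j
    by (rule member_le_sum) (auto intro: less_imp_le[OF l_pos])
  have m0: "m > 0"
  proof -
    have "(\<Sum>j\<in>UNIV. l j) > 0" using L l_pos by (meson less_le_trans)
    then show ?thesis using \<epsilon> \<kappa> by (simp add: m_def)
  qed
  have "ennreal ((\<Sum>k\<in>J. l (snd k) * ((s k)\<^sup>2 * \<epsilon>\<^sup>2 / ((s k)\<^sup>2 + \<epsilon>\<^sup>2))) * (1 - 3 * \<delta> / 2 - exp (- \<delta>\<^sup>2 / (16 * m)) / (2 * \<delta>)))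
     \<le> (SUP \<theta>\<in>sob_ellipsoid \<beta> Q. risk M \<xi> \<epsilon> Q \<theta> t)"
  proof (rule bayes_lower_bound[OF J s t \<epsilon> \<delta>(1) less_imp_le[OF \<delta>(2)] m0])
    fix k assume k: "k \<in> J"
    have l: "l (snd k) > 0" by (rule l_pos)
    have "?A k * (\<kappa> / l (snd k)) \<le> 1" using Jk(2,3)[OF k] by linarith
    then have a: "?A k \<le> l (snd k) / \<kappa>" using l \<kappa> by (simp add: field_simps)
    have "(?A k)\<^sup>2 / l (snd k) * (s k)\<^sup>2 = (1 - \<delta>) * (\<epsilon>\<^sup>2 / \<kappa> * (?A k * ?C k))" by (rule ws[OF k])
    also have "\<dots> \<le> 1 * (\<epsilon>\<^sup>2 / \<kappa> * (?A k * 1))"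
      using \<delta> \<kappa> Jk[OF k] by (intro mult_mono mult_nonneg_nonneg) auto
    also have "\<dots> \<le> \<epsilon>\<^sup>2 / \<kappa> * (l (snd k) / \<kappa>)" unfolding mult_1_left mult_1_right
      using a \<kappa> by (intro mult_left_mono) auto
    also have "\<dots> = \<epsilon>\<^sup>2 / \<kappa>\<^sup>2 * l (snd k)" by (simp add: power2_eq_square)
    also have "\<dots> \<le> m" unfolding m_def by (intro mult_left_mono L) simp
    finally show "(?A k)\<^sup>2 / l (snd k) * (s k)\<^sup>2 \<le> m" .
  next
    have "(\<Sum>k\<in>J. (?A k)\<^sup>2 / l (snd k) * (s k)\<^sup>2) = (\<Sum>k\<in>J. (1 - \<delta>) * (\<epsilon>\<^sup>2 / \<kappa> * (?A k * ?C k)))"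
      by (intro sum.cong refl ws)
    also have "\<dots> = (1 - \<delta>) * (\<epsilon>\<^sup>2 / \<kappa> * total_weighted_shrink \<beta> l \<kappa>)"
      unfolding sum_distrib_left[symmetric] TW ..
    also have "\<epsilon>\<^sup>2 / \<kappa> * total_weighted_shrink \<beta> l \<kappa> = 1"
      using eq unfolding pinsker_eq_iff[OF \<kappa>] by (simp add: divide_inverse)
    finally show "(\<Sum>k\<in>J. (?A k)\<^sup>2 / l (snd k) * (s k)\<^sup>2) \<le> 1 - \<delta>" by simp
  qed
  moreover have "(1 - \<delta>) * (\<epsilon>\<^sup>2 * (total_shrink \<beta> l \<kappa> - (\<Sum>j\<in>UNIV. l j))) \<le> (\<Sum>k\<in>J. l (snd k) * ((s k)\<^sup>2 * \<epsilon>\<^sup>2 / ((s k)\<^sup>2 + \<epsilon>\<^sup>2)))"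
  proof -
    have "(1 - \<delta>) * (\<epsilon>\<^sup>2 * (total_shrink \<beta> l \<kappa> - (\<Sum>j\<in>UNIV. l j))) = (\<Sum>k\<in>J. l (snd k) * ((1 - \<delta>) * \<epsilon>\<^sup>2 * ?C k))"
      unfolding TS[symmetric] sum_distrib_left by (intro sum.cong) (auto simp: mult_ac)
    also have "\<dots> \<le> (\<Sum>k\<in>J. l (snd k) * ((s k)\<^sup>2 * \<epsilon>\<^sup>2 / ((s k)\<^sup>2 + \<epsilon>\<^sup>2)))"
    proof (intro sum_mono mult_left_mono)
      fix k assume k: "k \<in> J"
      define c where "c = ?C k"
      have c: "0 < c" "c < 1" using Jk[OF k] by (auto simp: c_def)
      define d where "d = 1 - \<delta>"
      have d: "0 < d" "d \<le> 1" using \<delta> by (auto simp: d_def)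
      have pos: "d * c + (1 - c) > 0" using c d by (simp add: add_pos_pos)
      have le: "d * c + (1 - c) \<le> 1" using c d mult_right_mono[of d 1 c] by simp
      have "(s k)\<^sup>2 * \<epsilon>\<^sup>2 / ((s k)\<^sup>2 + \<epsilon>\<^sup>2) = d * \<epsilon>\<^sup>2 * c / (d * c + (1 - c))"
      proof -
        have s2': "(s k)\<^sup>2 = d * \<epsilon>\<^sup>2 * c / (1 - c)" by (simp add: s2[OF k] q_def c_def d_def)
        have "(s k)\<^sup>2 + \<epsilon>\<^sup>2 = \<epsilon>\<^sup>2 * (d * c + (1 - c)) / (1 - c)"
          unfolding s2' using c by (simp add: field_simps)
        then show ?thesis unfolding s2' using c \<epsilon> by simp
      qed
      moreover have "d * \<epsilon>\<^sup>2 * c \<le> d * \<epsilon>\<^sup>2 * c / (d * c + (1 - c))"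
        using pos le c d by (simp add: pos_le_divide_eq mult_left_le)
      ultimately show "(1 - \<delta>) * \<epsilon>\<^sup>2 * ?C k \<le> (s k)\<^sup>2 * \<epsilon>\<^sup>2 / ((s k)\<^sup>2 + \<epsilon>\<^sup>2)"
        by (simp add: c_def d_def)
    qed (rule less_imp_le[OF l_pos])
    finally show ?thesis .
  qed
  ultimately show ?thesis
    using r by (meson ennreal_leI mult_right_mono order_trans)
qed

end

section \<open>Asymptotic minimaxity\<close>

lemma pos_def_diagonalization:
  fixes Q :: "real^'p^'p"
  assumes "pos_def Q"
  obtains U l where "orthogonal_matrix U" "Q = transpose U ** diag_mat (\<chi> j. l j) ** U" "\<And>j. l j > (0::real)"
proof -
  obtain U L where U: "orthogonal_matrix U" and Q: "Q = transpose U ** diag_mat L ** U"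
    using symmetric_matrix_diagonalization[of Q] assms by (auto simp: pos_def_def)
  have "L $ j > 0" for j
  proof -
    have "row j U \<bullet> row j U = 1" using orthogonal_rows_inner[OF U, of j j] by simp
    then have "row j U \<noteq> 0" by auto
    then have "row j U \<bullet> (Q *v row j U) > 0" using assms by (simp add: pos_def_def)
    then show ?thesis
      using \<open>row j U \<bullet> row j U = 1\<close> by (simp add: Q row_inner_transpose_diag_mat[OF U])
  qed
  then show ?thesis using that[of U "\<lambda>j. L $ j"] U Q by simp
qed

lemma tendsto_1_if_eventually_ge:
  fixes f R :: "real \<Rightarrow> real"
  assumes upper: "eventually (\<lambda>x. f x \<le> R x) F" and pos: "eventually (\<lambda>x. R x > 0) F"
    and lower: "\<And>\<eta>. \<eta> > 0 \<Longrightarrow> eventually (\<lambda>x. (1 - \<eta>) * R x \<le> f x) F"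
  shows "((\<lambda>x. f x / R x) \<longlongrightarrow> 1) F"
proof (rule order_tendstoI)
  fix a :: real assume a: "a < 1"
  define \<eta> where "\<eta> = (1 - a) / 2"
  have \<eta>: "\<eta> > 0" "a < 1 - \<eta>" using a by (auto simp: \<eta>_def field_simps)
  show "eventually (\<lambda>x. a < f x / R x) F"
    using lower[OF \<eta>(1)] pos
  proof eventually_elim
    case (elim x)
    then have "1 - \<eta> \<le> f x / R x" by (simp add: pos_le_divide_eq)
    then show ?case using \<eta> by simp
  qed
next
  fix a :: real assume a: "1 < a"
  show "eventually (\<lambda>x. f x / R x < a) F"
    using upper pos
  proof eventually_elim
    case (elim x)
    then have "f x / R x \<le> 1" by simp
    then show ?case using a by simp
  qed
qed

context gaussian_noise_model
begin

lemma ex1_pinsker_kappa: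
  assumes "\<epsilon> > 0"
  shows "\<exists>!\<kappa>. \<kappa> > 0 \<and> pinsker_eq \<beta> Q \<epsilon> \<kappa>"
  using ex1_kappa[of \<beta> l "\<epsilon>\<^sup>2"] \<beta>_pos l_pos assms pinsker_eq_iff by (simp cong: conj_cong)

lemma pinsker_kappa:
  assumes "\<epsilon> > 0"
  shows "pinsker_kappa \<beta> Q \<epsilon> > 0" "pinsker_eq \<beta> Q \<epsilon> (pinsker_kappa \<beta> Q \<epsilon>)"
  using theI'[OF ex1_pinsker_kappa[OF assms]] by (simp_all add: pinsker_kappa_def)

text \<open>
  The common asymptotic value of both risks, called \<open>r(\<epsilon>)\<close> above.
\<close>
definition pinsker_bound :: "real \<Rightarrow> real" where
  "pinsker_bound \<epsilon> = \<epsilon>\<^sup>2 * total_shrink \<beta> l (pinsker_kappa \<beta> Q \<epsilon>)"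

definition pinsker_sup_risk :: "real \<Rightarrow> ennreal" where
  "pinsker_sup_risk \<epsilon> = (SUP \<theta>\<in>sob_ellipsoid \<beta> Q. risk M \<xi> \<epsilon> Q \<theta> (pinsker_estimator \<beta> Q \<epsilon>))"

lemma pinsker_sup_risk_le:
  assumes "\<epsilon> > 0"
  shows "pinsker_sup_risk \<epsilon> \<le> ennreal (pinsker_bound \<epsilon>)"
  unfolding pinsker_sup_risk_def pinsker_bound_def pinsker_estimator_def
  using assms by (intro SUP_least pinsker_risk_le pinsker_kappa)

lemma minimax_risk_le: "minimax_risk M \<xi> \<epsilon> Q (sob_ellipsoid \<beta> Q) \<le> pinsker_sup_risk \<epsilon>"
  unfolding minimax_risk_def pinsker_sup_risk_def pinsker_estimator_def
  by (rule INF_lower[OF pinsker_weight_estimator])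

lemma pinsker_asymptotics:
  "((\<lambda>\<epsilon>. pinsker_bound \<epsilon> / \<epsilon> powr (4 * \<beta> / (2 * \<beta> + 1))) \<longlongrightarrow> pinsker_const \<beta> Q) (at_right 0)"
  "((\<lambda>\<epsilon>. \<epsilon>\<^sup>2 / (pinsker_kappa \<beta> Q \<epsilon>)\<^sup>2) \<longlongrightarrow> 0) (at_right 0)"
  "filterlim (\<lambda>\<epsilon>. total_shrink \<beta> l (pinsker_kappa \<beta> Q \<epsilon>)) at_top (at_right 0)"
proof -
  have K: "pinsker_kappa \<beta> Q \<epsilon> > 0 \<and> \<epsilon>\<^sup>2 * inverse (pinsker_kappa \<beta> Q \<epsilon>) * total_weighted_shrink \<beta> l (pinsker_kappa \<beta> Q \<epsilon>) = 1"
    if "\<epsilon> > 0" for \<epsilon>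
    using pinsker_kappa[OF that] pinsker_eq_iff by blast
  note rates = pinsker_rates[OF \<beta>_pos, of l "pinsker_kappa \<beta> Q", OF l_pos K]
  show "((\<lambda>\<epsilon>. pinsker_bound \<epsilon> / \<epsilon> powr (4 * \<beta> / (2 * \<beta> + 1))) \<longlongrightarrow> pinsker_const \<beta> Q) (at_right 0)"
    unfolding pinsker_bound_def pinsker_const_def trace_mat_powr by (rule rates(1))
  show "((\<lambda>\<epsilon>. \<epsilon>\<^sup>2 / (pinsker_kappa \<beta> Q \<epsilon>)\<^sup>2) \<longlongrightarrow> 0) (at_right 0)" by (rule rates(2))
  show "filterlim (\<lambda>\<epsilon>. total_shrink \<beta> l (pinsker_kappa \<beta> Q \<epsilon>)) at_top (at_right 0)" by (rule rates(3))
qed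

lemma pinsker_bound_pos: "eventually (\<lambda>\<epsilon>. pinsker_bound \<epsilon> > 0) (at_right 0)"
proof -
  have "eventually (\<lambda>\<epsilon>. total_shrink \<beta> l (pinsker_kappa \<beta> Q \<epsilon>) > 0) (at_right 0)"
    using pinsker_asymptotics(3) by (simp add: filterlim_at_top_dense)
  then show ?thesis
    using eventually_at_right_less[of 0] by eventually_elim (simp add: pinsker_bound_def)
qed

text \<open>
  As \<open>\<epsilon>\<close> tends to \<open>0\<close>, the parameter \<open>m = \<epsilon>\<^sup>2 / \<kappa>\<^sup>2 tr Q\<close> of the Chernoff bound tends to \<open>0\<close>, and the
  subtracted trace becomes negligible against \<open>total_shrink\<close>. What is left of the lower bound are
  factors \<open>1 - O(\<delta>)\<close>.
\<close>
lemma minimax_risk_ge: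
  assumes \<delta>: "0 < \<delta>" "\<delta> < 1/5"
  shows "eventually (\<lambda>\<epsilon>. ennreal ((1 - 5 * \<delta>) * pinsker_bound \<epsilon>) \<le> minimax_risk M \<xi> \<epsilon> Q (sob_ellipsoid \<beta> Q)) (at_right 0)"
proof -
  let ?K = "pinsker_kappa \<beta> Q" and ?L = "\<Sum>j\<in>UNIV. l j"
  let ?m = "\<lambda>\<epsilon>. \<epsilon>\<^sup>2 / (?K \<epsilon>)\<^sup>2 * ?L"
  have L: "?L > 0" by (rule sum_pos) (auto intro: l_pos)
  have "((\<lambda>\<epsilon>. ?m \<epsilon>) \<longlongrightarrow> 0 * ?L) (at_right 0)"
    by (intro tendsto_mult pinsker_asymptotics tendsto_const)
  \<comment> \<open>Below this threshold \<open>exp (- \<delta>\<^sup>2 / (16 m)) \<le> 16 m / \<delta>\<^sup>2\<close> is at most \<open>2 \<delta>\<^sup>2\<close>.\<close>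
  then have "eventually (\<lambda>\<epsilon>. ?m \<epsilon> < \<delta>^4 / 8) (at_right 0)"
    by (rule order_tendstoD) (use \<delta> in simp)
  moreover have "eventually (\<lambda>\<epsilon>. total_shrink \<beta> l (?K \<epsilon>) > ?L / \<delta>) (at_right 0)"
    using pinsker_asymptotics(3) by (simp add: filterlim_at_top_dense)
  ultimately show ?thesis
    using eventually_at_right_less[of 0]
  proof eventually_elim
    case (elim \<epsilon>)
    define m where "m = ?m \<epsilon>"
    define TS where "TS = total_shrink \<beta> l (?K \<epsilon>)"
    have \<epsilon>: "\<epsilon> > 0" using elim by simp
    note \<kappa> = pinsker_kappa[OF \<epsilon>]
    have m: "m > 0" "m < \<delta>^4 / 8" using elim \<epsilon> \<kappa> L by (auto simp: m_def)
    have p: "exp (- \<delta>\<^sup>2 / (16 * m)) / (2 * \<delta>) \<le> \<delta>"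
    proof -
      have x: "\<delta>\<^sup>2 / (16 * m) > 0" using \<delta> m by simp
      have "\<delta>\<^sup>2 / (16 * m) \<le> exp (\<delta>\<^sup>2 / (16 * m))"
        using exp_ge_add_one_self[of "\<delta>\<^sup>2 / (16 * m)"] by linarith
      then have "1 / exp (\<delta>\<^sup>2 / (16 * m)) \<le> 1 / (\<delta>\<^sup>2 / (16 * m))"
        using x by (intro divide_left_mono mult_pos_pos exp_gt_zero) auto
      then have "exp (- \<delta>\<^sup>2 / (16 * m)) \<le> 16 * m / \<delta>\<^sup>2"
        by (simp add: exp_minus inverse_eq_divide)
      also have "\<dots> \<le> 16 * (\<delta>^4 / 8) / \<delta>\<^sup>2" using m \<delta> by (intro divide_right_mono) auto
      also have "\<dots> = \<delta> * (2 * \<delta>)" using \<delta> by (simp add: power2_eq_square eval_nat_numeral)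
      finally show ?thesis using \<delta> by (simp add: pos_divide_le_eq)
    qed
    define b where "b = 1 - 3 * \<delta> / 2 - exp (- \<delta>\<^sup>2 / (16 * m)) / (2 * \<delta>)"
    have b: "b \<ge> 1 - 5 * \<delta> / 2" using p by (simp add: b_def)
    have b0: "1 - 5 * \<delta> / 2 \<ge> 0" using \<delta> by simp
    have TS: "?L \<le> \<delta> * TS" "TS > 0"
    proof -
      have "?L / \<delta> < TS" using elim by (simp add: TS_def)
      then show "?L \<le> \<delta> * TS" using \<delta> by (simp add: field_simps)
      show "TS > 0" using \<open>?L / \<delta> < TS\<close> L \<delta> by (meson divide_pos_pos less_trans)
    qed
    have "(1 - 5 * \<delta>) * pinsker_bound \<epsilon> \<le> ((1 - \<delta>) * (1 - \<delta>) * (1 - 5 * \<delta> / 2)) * pinsker_bound \<epsilon>"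
    proof (rule mult_right_mono)
      have "(1 - \<delta>) * (1 - \<delta>) \<ge> 1 - 2 * \<delta>" using \<delta> by (simp add: algebra_simps)
      then have "(1 - \<delta>) * (1 - \<delta>) * (1 - 5 * \<delta> / 2) \<ge> (1 - 2 * \<delta>) * (1 - 5 * \<delta> / 2)"
        using b0 by (rule mult_right_mono)
      moreover have "(1 - 2 * \<delta>) * (1 - 5 * \<delta> / 2) = 1 - 9 / 2 * \<delta> + 5 * (\<delta> * \<delta>)" by (simp add: field_simps)
      moreover have "\<delta> * \<delta> \<ge> 0" by simp
      ultimately show "1 - 5 * \<delta> \<le> (1 - \<delta>) * (1 - \<delta>) * (1 - 5 * \<delta> / 2)" using \<delta> by linarith
    qed (use TS in \<open>simp add: pinsker_bound_def TS_def\<close>)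
    also have "\<dots> = (1 - \<delta>) * (\<epsilon>\<^sup>2 * (TS - \<delta> * TS)) * (1 - 5 * \<delta> / 2)"
      by (simp add: pinsker_bound_def TS_def algebra_simps)
    also have "\<dots> \<le> (1 - \<delta>) * (\<epsilon>\<^sup>2 * (TS - ?L)) * b"
    proof (rule mult_mono)
      have "\<delta> * TS \<le> 1 * TS" using TS \<delta> by (intro mult_right_mono) auto
      then have "?L \<le> TS" using TS(1) by linarith
      then show "0 \<le> (1 - \<delta>) * (\<epsilon>\<^sup>2 * (TS - ?L))"
        using \<delta> by (intro mult_nonneg_nonneg) auto
      show "(1 - \<delta>) * (\<epsilon>\<^sup>2 * (TS - \<delta> * TS)) \<le> (1 - \<delta>) * (\<epsilon>\<^sup>2 * (TS - ?L))"
        using \<delta> TS by (intro mult_left_mono) auto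
    qed (use b b0 in auto)
    finally have le: "ennreal ((1 - 5 * \<delta>) * pinsker_bound \<epsilon>) \<le> ennreal ((1 - \<delta>) * (\<epsilon>\<^sup>2 * (TS - ?L)) * b)"
      by (rule ennreal_leI)
    have "b \<ge> 0" using b b0 by linarith
    show ?case
      unfolding minimax_risk_def
    proof (rule INF_greatest)
      fix t :: "(nat \<Rightarrow> real^'p) \<Rightarrow> nat \<Rightarrow> real^'p" assume t: "t \<in> estimators"
      have "ennreal ((1 - \<delta>) * (\<epsilon>\<^sup>2 * (TS - ?L)) * b) \<le> (SUP \<theta>\<in>sob_ellipsoid \<beta> Q. risk M \<xi> \<epsilon> Q \<theta> t)"
        unfolding TS_def b_def m_def
        by (rule pinsker_lower_bound[OF \<epsilon> \<kappa> t]) (use \<delta> \<open>b \<ge> 0\<close> in \<open>auto simp: b_def m_def\<close>)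
      with le show "ennreal ((1 - 5 * \<delta>) * pinsker_bound \<epsilon>) \<le> (SUP \<theta>\<in>sob_ellipsoid \<beta> Q. risk M \<xi> \<epsilon> Q \<theta> t)"
        by (rule order_trans)
    qed
  qed
qed

lemma asymp_equiv_pinsker_bound:
  assumes upper: "\<And>\<epsilon>. \<epsilon> > 0 \<Longrightarrow> f \<epsilon> \<le> ennreal (pinsker_bound \<epsilon>)"
    and lower: "\<And>\<epsilon>. minimax_risk M \<xi> \<epsilon> Q (sob_ellipsoid \<beta> Q) \<le> f \<epsilon>"
  shows "(\<lambda>\<epsilon>. enn2real (f \<epsilon>)) \<sim>[at_right 0] pinsker_bound"
proof (rule asymp_equivI', rule tendsto_1_if_eventually_ge)
  show "eventually (\<lambda>\<epsilon>. pinsker_bound \<epsilon> > 0) (at_right 0)" by (rule pinsker_bound_pos)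
  then show "eventually (\<lambda>\<epsilon>. enn2real (f \<epsilon>) \<le> pinsker_bound \<epsilon>) (at_right 0)"
    using eventually_at_right_less[of 0]
  proof eventually_elim
    case (elim \<epsilon>)
    from enn2real_mono[OF upper[OF elim(2)]] elim(1) show ?case by simp
  qed
  fix \<eta> :: real assume \<eta>: "\<eta> > 0"
  define \<delta> where "\<delta> = min (1/6) (\<eta> / 5)"
  have \<delta>: "0 < \<delta>" "\<delta> < 1/5" "5 * \<delta> \<le> \<eta>" using \<eta> by (auto simp: \<delta>_def)
  show "eventually (\<lambda>\<epsilon>. (1 - \<eta>) * pinsker_bound \<epsilon> \<le> enn2real (f \<epsilon>)) (at_right 0)"
    using minimax_risk_ge[OF \<delta>(1,2)] pinsker_bound_pos eventually_at_right_less[of 0]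
  proof eventually_elim
    case (elim \<epsilon>)
    have "f \<epsilon> < top" using upper[OF elim(3)] by (rule le_less_trans) simp
    moreover have "ennreal ((1 - 5 * \<delta>) * pinsker_bound \<epsilon>) \<le> f \<epsilon>" using elim(1) lower order_trans by blast
    ultimately have "enn2real (ennreal ((1 - 5 * \<delta>) * pinsker_bound \<epsilon>)) \<le> enn2real (f \<epsilon>)"
      by (intro enn2real_mono) auto
    moreover have "(1 - \<eta>) * pinsker_bound \<epsilon> \<le> (1 - 5 * \<delta>) * pinsker_bound \<epsilon>"
      using \<delta> elim(2) by (intro mult_right_mono) auto
    moreover have "0 \<le> (1 - 5 * \<delta>) * pinsker_bound \<epsilon>" using \<delta> elim(2) by simp
    ultimately show ?case by simp
  qed
qed

lemma pinsker_const_pos: "pinsker_const \<beta> Q > 0"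
  unfolding pinsker_const_def trace_mat_powr
  using \<beta>_pos sum_powr_pos[of l "(\<beta> + 1) / \<beta>"] l_pos by simp

lemma pinsker_theorem:
  shows "\<forall>\<epsilon>>0. \<exists>!\<kappa>. \<kappa> > 0 \<and> pinsker_eq \<beta> Q \<epsilon> \<kappa>"
    and "(\<lambda>\<epsilon>. enn2real (pinsker_sup_risk \<epsilon>)) \<sim>[at_right 0] (\<lambda>\<epsilon>. enn2real (minimax_risk M \<xi> \<epsilon> Q (sob_ellipsoid \<beta> Q)))"
    and "(\<lambda>\<epsilon>. enn2real (minimax_risk M \<xi> \<epsilon> Q (sob_ellipsoid \<beta> Q)))
      \<sim>[at_right 0] (\<lambda>\<epsilon>. pinsker_const \<beta> Q * \<epsilon> powr (4 * \<beta> / (2 * \<beta> + 1)))"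
proof -
  show "\<forall>\<epsilon>>0. \<exists>!\<kappa>. \<kappa> > 0 \<and> pinsker_eq \<beta> Q \<epsilon> \<kappa>" using ex1_pinsker_kappa by blast
  have sup: "(\<lambda>\<epsilon>. enn2real (pinsker_sup_risk \<epsilon>)) \<sim>[at_right 0] pinsker_bound"
    by (rule asymp_equiv_pinsker_bound[OF pinsker_sup_risk_le minimax_risk_le])
  have mm: "(\<lambda>\<epsilon>. enn2real (minimax_risk M \<xi> \<epsilon> Q (sob_ellipsoid \<beta> Q))) \<sim>[at_right 0] pinsker_bound"
    by (rule asymp_equiv_pinsker_bound[OF order_trans[OF minimax_risk_le pinsker_sup_risk_le] order_refl])
  have c: "pinsker_bound \<sim>[at_right 0] (\<lambda>\<epsilon>. pinsker_const \<beta> Q * \<epsilon> powr (4 * \<beta> / (2 * \<beta> + 1)))"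
    using pinsker_const_pos by (intro asymp_equivI'_const[OF pinsker_asymptotics(1)]) simp
  show "(\<lambda>\<epsilon>. enn2real (pinsker_sup_risk \<epsilon>)) \<sim>[at_right 0] (\<lambda>\<epsilon>. enn2real (minimax_risk M \<xi> \<epsilon> Q (sob_ellipsoid \<beta> Q)))"
    using asymp_equiv_trans[OF sup asymp_equiv_sym[THEN iffD1, OF mm]] .
  show "(\<lambda>\<epsilon>. enn2real (minimax_risk M \<xi> \<epsilon> Q (sob_ellipsoid \<beta> Q)))
      \<sim>[at_right 0] (\<lambda>\<epsilon>. pinsker_const \<beta> Q * \<epsilon> powr (4 * \<beta> / (2 * \<beta> + 1)))"
    using asymp_equiv_trans[OF mm c] .
qed

end

theorem theorem5p1:
  fixes Q :: "real^'p^'p" and \<beta> :: real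
    and M :: "'a measure" and \<xi> :: "nat \<Rightarrow> 'a \<Rightarrow> real^'p"
  assumes "CARD('p) > 1" and "\<beta> > 0" and "pos_def Q"
    and "standard_gaussian_noise M \<xi>"
  shows "(\<forall>\<epsilon>>0. \<exists>!\<kappa>. \<kappa> > 0 \<and> pinsker_eq \<beta> Q \<epsilon> \<kappa>) \<and>
    (\<lambda>\<epsilon>. enn2real (SUP \<theta>\<in>sob_ellipsoid \<beta> Q. risk M \<xi> \<epsilon> Q \<theta> (pinsker_estimator \<beta> Q \<epsilon>)))
      \<sim>[at_right 0] (\<lambda>\<epsilon>. enn2real (minimax_risk M \<xi> \<epsilon> Q (sob_ellipsoid \<beta> Q))) \<and>
    (\<lambda>\<epsilon>. enn2real (minimax_risk M \<xi> \<epsilon> Q (sob_ellipsoid \<beta> Q)))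
      \<sim>[at_right 0] (\<lambda>\<epsilon>. pinsker_const \<beta> Q * \<epsilon> powr (4 * \<beta> / (2 * \<beta> + 1)))"
proof -
  obtain U :: "real^'p^'p" and l where "orthogonal_matrix U"
    "Q = transpose U ** diag_mat (\<chi> j. l j) ** U" "\<And>j. l j > (0::real)"
    using pos_def_diagonalization[OF assms(3)] by metis
  with assms interpret gaussian_noise_model Q U l \<beta> M \<xi>
    by unfold_locales auto
  show ?thesis
    using pinsker_theorem unfolding pinsker_sup_risk_def by blast
qed

end
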